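(* Let $G_1 = \mathbb{Z}$ and set $G_{k+1} = \mathbb{Z} \wr G_k$ for $k \geq 1$. Then for every $k\geq 1$, $G_k$ is a torsion-free, hereditarily conjugacy separable, and cyclic subgroup separable solvable group of derived length $k$. Furthermore, $G_k$ is not polycyclic for $k>1$.
   Context: $A \wr B$ denotes the restricted wreath product $A^B\rtimes B$, where $A^B$ is the group of finitely supported functions $B\to A$, on which $B$ acts by left translation of coordinates. A group $G$ is conjugacy separable if for every pair of non-conjugate elements $f,g\in G$ there is a surjective homomorphism $\pi$ onto a finite group such that $\pi(f)$ and $\pi(g)$ are not conjugate in the image; it is hereditarily conjugacy separable if $G$ and each of its finite-index subgroups are conjugacy separable. $G$ is cyclic subgroup separable if every cyclic subgroup of $G$ is closed in the profinite topology on $G$, i.e. for all $g,h\in G$ with $h\notin\langle g\rangle$ there is a finite-index normal subgroup $N$ of $G$ with $h \notin \langle g\rangle N$. *)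

theory Defs
  imports "HOL-Algebra.Algebra" "HOL-Library.Countable_Set"
begin

section \<open>Residual properties of groups\<close>

definition torsion_free :: "('a, 'm) monoid_scheme \<Rightarrow> bool"
  where "torsion_free G \<longleftrightarrow>
    (\<forall>x\<in>carrier G. \<forall>n::nat. n > 0 \<longrightarrow> x [^]\<^bsub>G\<^esub> n = \<one>\<^bsub>G\<^esub> \<longrightarrow> x = \<one>\<^bsub>G\<^esub>)"

definition conjugate :: "('a, 'm) monoid_scheme \<Rightarrow> 'a \<Rightarrow> 'a \<Rightarrow> bool"
  where "conjugate G x y \<longleftrightarrow> (\<exists>c\<in>carrier G. y = c \<otimes>\<^bsub>G\<^esub> x \<otimes>\<^bsub>G\<^esub> inv\<^bsub>G\<^esub> c)"

definition finite_index :: "('a, 'm) monoid_scheme \<Rightarrow> 'a set \<Rightarrow> bool"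
  where "finite_index G H \<longleftrightarrow> finite (rcosets\<^bsub>G\<^esub> H)"

text \<open>The finite image ranges over groups with carrier in \<open>nat\<close>; since every finite group is
  isomorphic to such a group, this is no restriction.\<close>

definition conjugacy_separable :: "('a, 'm) monoid_scheme \<Rightarrow> bool"
  where "conjugacy_separable G \<longleftrightarrow>
    (\<forall>f\<in>carrier G. \<forall>g\<in>carrier G. \<not> conjugate G f g \<longrightarrow>
      (\<exists>(Q :: nat monoid) \<pi>. group Q \<and> finite (carrier Q) \<and> \<pi> \<in> epi G Q \<and>
        \<not> conjugate Q (\<pi> f) (\<pi> g)))"

definition hereditarily_conjugacy_separable :: "('a, 'm) monoid_scheme \<Rightarrow> bool"
  where "hereditarily_conjugacy_separable G \<longleftrightarrow>
    conjugacy_separable G \<and>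
    (\<forall>H. subgroup H G \<and> finite_index G H \<longrightarrow> conjugacy_separable (G\<lparr>carrier := H\<rparr>))"

definition cyclic_subgroup_separable :: "('a, 'm) monoid_scheme \<Rightarrow> bool"
  where "cyclic_subgroup_separable G \<longleftrightarrow>
    (\<forall>g\<in>carrier G. \<forall>h\<in>carrier G. h \<notin> generate G {g} \<longrightarrow>
      (\<exists>N. N \<lhd> G \<and> finite_index G N \<and> h \<notin> generate G {g} <#>\<^bsub>G\<^esub> N))"

section \<open>Derived length and polycyclic groups\<close>

text \<open>Only meaningful for solvable groups, for which the set below is nonempty.\<close>

definition derived_length :: "('a, 'm) monoid_scheme \<Rightarrow> nat"
  where "derived_length G = (LEAST n. (derived G ^^ n) (carrier G) = {\<one>\<^bsub>G\<^esub>})"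

definition polycyclic :: "('a, 'm) monoid_scheme \<Rightarrow> bool"
  where "polycyclic G \<longleftrightarrow>
    (\<exists>(n::nat) H. H 0 = {\<one>\<^bsub>G\<^esub>} \<and> H n = carrier G \<and>
      (\<forall>i\<le>n. subgroup (H i) G) \<and>
      (\<forall>i<n. H i \<lhd> G\<lparr>carrier := H (Suc i)\<rparr> \<and>
             cyclic_group (G\<lparr>carrier := H (Suc i)\<rparr> Mod H i)))"

section \<open>Restricted wreath products\<close>

definition left_translate :: "('b, 'n) monoid_scheme \<Rightarrow> 'b \<Rightarrow> ('b \<Rightarrow> 'a) \<Rightarrow> 'b \<Rightarrow> 'a"
  where "left_translate B b f = (\<lambda>x\<in>carrier B. f (inv\<^bsub>B\<^esub> b \<otimes>\<^bsub>B\<^esub> x))"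

text \<open>The base group \<open>sum_group (carrier B) (\<lambda>_. A)\<close> consists of the finitely supported functions
  from \<open>B\<close> to \<open>A\<close> under pointwise multiplication.\<close>

definition wreath_product ::
  "('a, 'm) monoid_scheme \<Rightarrow> ('b, 'n) monoid_scheme \<Rightarrow> (('b \<Rightarrow> 'a) \<times> 'b) monoid"
  where "wreath_product A B =
    \<lparr>carrier = carrier (sum_group (carrier B) (\<lambda>_. A)) \<times> carrier B,
     monoid.mult = (\<lambda>(f, b) (g, c).
       (f \<otimes>\<^bsub>sum_group (carrier B) (\<lambda>_. A)\<^esub> left_translate B b g, b \<otimes>\<^bsub>B\<^esub> c)),
     one = (\<one>\<^bsub>sum_group (carrier B) (\<lambda>_. A)\<^esub>, \<one>\<^bsub>B\<^esub>)\<rparr>"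

lemma left_translate_closed:
  assumes A: "group A" and B: "group B" and b: "b \<in> carrier B"
    and f: "f \<in> carrier (sum_group (carrier B) (\<lambda>_. A))"
  shows "left_translate B b f \<in> carrier (sum_group (carrier B) (\<lambda>_. A))"
proof -
  interpret B: group B by fact
  have fin: "finite {x \<in> carrier B. f x \<noteq> \<one>\<^bsub>A\<^esub>}" and fPi: "f \<in> carrier B \<rightarrow>\<^sub>E carrier A"
    using f A by (auto simp: carrier_sum_group)
  have "{x \<in> carrier B. f (inv\<^bsub>B\<^esub> b \<otimes>\<^bsub>B\<^esub> x) \<noteq> \<one>\<^bsub>A\<^esub>}
        \<subseteq> (\<lambda>x. b \<otimes>\<^bsub>B\<^esub> x) ` {x \<in> carrier B. f x \<noteq> \<one>\<^bsub>A\<^esub>}"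
  proof
    fix x assume "x \<in> {x \<in> carrier B. f (inv\<^bsub>B\<^esub> b \<otimes>\<^bsub>B\<^esub> x) \<noteq> \<one>\<^bsub>A\<^esub>}"
    then show "x \<in> (\<lambda>x. b \<otimes>\<^bsub>B\<^esub> x) ` {x \<in> carrier B. f x \<noteq> \<one>\<^bsub>A\<^esub>}"
      using b by (intro image_eqI[of _ _ "inv\<^bsub>B\<^esub> b \<otimes>\<^bsub>B\<^esub> x"]) (auto simp flip: B.m_assoc)
  qed
  then have "finite {x \<in> carrier B. f (inv\<^bsub>B\<^esub> b \<otimes>\<^bsub>B\<^esub> x) \<noteq> \<one>\<^bsub>A\<^esub>}"
    using fin finite_surj by blast
  moreover have "left_translate B b f \<in> carrier B \<rightarrow>\<^sub>E carrier A"
    using fPi b unfolding left_translate_def by (auto simp: PiE_iff)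
  ultimately show ?thesis
    using A by (simp add: carrier_sum_group left_translate_def cong: conj_cong)
qed

lemma group_wreath_product:
  assumes A: "group A" and B: "group B"
  shows "group (wreath_product A B)"
proof -
  interpret A: group A by fact
  interpret B: group B by fact
  let ?S = "sum_group (carrier B) (\<lambda>_. A)"
  interpret S: group ?S using A by simp
  have ap: "f x \<in> carrier A" if "f \<in> carrier ?S" "x \<in> carrier B" for f x
    using that A by (auto simp: carrier_sum_group)
  have lt_mult: "left_translate B b (f \<otimes>\<^bsub>?S\<^esub> g) = left_translate B b f \<otimes>\<^bsub>?S\<^esub> left_translate B b g"
    if "b \<in> carrier B" for b f g
    using that by (auto simp: left_translate_def fun_eq_iff)
  have lt_lt: "left_translate B b (left_translate B c f) = left_translate B (b \<otimes>\<^bsub>B\<^esub> c) f"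
    if "b \<in> carrier B" "c \<in> carrier B" for b c f
    using that by (auto simp: left_translate_def fun_eq_iff B.inv_mult_group B.m_assoc)
  have lt_one: "left_translate B \<one>\<^bsub>B\<^esub> f = f" if "f \<in> carrier ?S" for f
    using that A by (auto simp: left_translate_def fun_eq_iff carrier_sum_group PiE_iff extensional_def)
  note lt = left_translate_closed[OF A B]
  show ?thesis
  proof (rule groupI)
    fix p assume "p \<in> carrier (wreath_product A B)"
    then obtain f b where p: "p = (f, b)" and f: "f \<in> carrier ?S" and b: "b \<in> carrier B"
      by (auto simp: wreath_product_def)
    let ?q = "(left_translate B (inv\<^bsub>B\<^esub> b) (inv\<^bsub>?S\<^esub> f), inv\<^bsub>B\<^esub> b)"
    have "?q \<in> carrier (wreath_product A B)"
      using lt[of "inv\<^bsub>B\<^esub> b" "inv\<^bsub>?S\<^esub> f"] f b S.inv_closed[OF f]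
      by (simp only: wreath_product_def) simp
    moreover have "left_translate B (inv\<^bsub>B\<^esub> b) (inv\<^bsub>?S\<^esub> f) \<otimes>\<^bsub>?S\<^esub> left_translate B (inv\<^bsub>B\<^esub> b) f = \<one>\<^bsub>?S\<^esub>"
      using b unfolding lt_mult[OF B.inv_closed[OF b], symmetric] S.l_inv[OF f]
      by (auto simp: left_translate_def fun_eq_iff)
    then have "?q \<otimes>\<^bsub>wreath_product A B\<^esub> p = \<one>\<^bsub>wreath_product A B\<^esub>"
      using b unfolding p wreath_product_def by (simp only: monoid.simps prod.case) simp
    ultimately show "\<exists>q\<in>carrier (wreath_product A B). q \<otimes>\<^bsub>wreath_product A B\<^esub> p = \<one>\<^bsub>wreath_product A B\<^esub>"
      by blast
  next
    fix p q r
    assume "p \<in> carrier (wreath_product A B)" "q \<in> carrier (wreath_product A B)"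
      "r \<in> carrier (wreath_product A B)"
    then obtain f b g c h d where
      eq: "p = (f, b)" "q = (g, c)" "r = (h, d)" and
      S: "f \<in> carrier ?S" "g \<in> carrier ?S" "h \<in> carrier ?S" and
      B': "b \<in> carrier B" "c \<in> carrier B" "d \<in> carrier B"
      by (auto simp: wreath_product_def)
    show "p \<otimes>\<^bsub>wreath_product A B\<^esub> q \<otimes>\<^bsub>wreath_product A B\<^esub> r
        = p \<otimes>\<^bsub>wreath_product A B\<^esub> (q \<otimes>\<^bsub>wreath_product A B\<^esub> r)"
      using S B' lt
      by (simp add: eq wreath_product_def lt_mult lt_lt B.m_assoc S.m_assoc del: mult_sum_group)
  next
    fix p q
    assume "p \<in> carrier (wreath_product A B)" "q \<in> carrier (wreath_product A B)"
    then show "p \<otimes>\<^bsub>wreath_product A B\<^esub> q \<in> carrier (wreath_product A B)"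
      using lt by (auto simp: wreath_product_def simp del: mult_sum_group)
  next
    fix p assume "p \<in> carrier (wreath_product A B)"
    then show "\<one>\<^bsub>wreath_product A B\<^esub> \<otimes>\<^bsub>wreath_product A B\<^esub> p = p"
      using lt_one by (auto simp: wreath_product_def simp del: mult_sum_group one_sum_group)
  qed (auto simp: wreath_product_def simp del: one_sum_group)
qed

lemma countable_wreath_product:
  assumes A: "group A" and cA: "countable (carrier A)" and cB: "countable (carrier B)"
  shows "countable (carrier (wreath_product A B))"
proof -
  let ?S = "sum_group (carrier B) (\<lambda>_. A)"
  let ?graph = "\<lambda>f. (\<lambda>x. (x, f x)) ` {x \<in> carrier B. f x \<noteq> \<one>\<^bsub>A\<^esub>}"
  have "?graph ` carrier ?S \<subseteq> {W. W \<subseteq> carrier B \<times> carrier A \<and> finite W}"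
    using A by (auto simp: carrier_sum_group)
  moreover have "countable {W. W \<subseteq> carrier B \<times> carrier A \<and> finite W}"
    using countable_Collect_finite_subset[of "carrier B \<times> carrier A"] cA cB
    by (simp add: conj_commute)
  ultimately have "countable (?graph ` carrier ?S)"
    by (rule countable_subset)
  moreover have "inj_on ?graph (carrier ?S)"
  proof (rule inj_onI)
    fix f g assume f: "f \<in> carrier ?S" and g: "g \<in> carrier ?S" and eq: "?graph f = ?graph g"
    have iff: "x \<in> carrier B \<and> f x \<noteq> \<one>\<^bsub>A\<^esub> \<and> y = f x \<longleftrightarrow> x \<in> carrier B \<and> g x \<noteq> \<one>\<^bsub>A\<^esub> \<and> y = g x" for x y
    proof -
      have "(x, y) \<in> ?graph f \<longleftrightarrow> (x, y) \<in> ?graph g" using eq by simp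
      then show ?thesis by auto
    qed
    have "f x = g x" if "x \<in> carrier B" for x
      using iff[of x "f x"] iff[of x "g x"] that by metis
    then show "f = g"
      using f g A by (auto simp: carrier_sum_group intro: PiE_ext)
  qed
  ultimately have "countable (carrier ?S)"
    by (rule countable_image_inj_on)
  then show ?thesis
    using cB by (simp add: wreath_product_def)
qed

section \<open>Iterated wreath products\<close>

text \<open>The wreath product changes the type of the elements. To obtain all the groups of the family in
  one type, each of them (they are countable) is transported to a subset of the naturals along an
  injection.\<close>

definition nat_copy :: "('a, 'm) monoid_scheme \<Rightarrow> nat monoid"
  where "nat_copy G = image_group (to_nat_on (carrier G)) G"

lemma nat_copy:
  assumes "group G" and "countable (carrier G)"
  shows "group (nat_copy G)" and "nat_copy G \<cong> G"
proof -
  have inj: "inj_on (to_nat_on (carrier G)) (carrier G)"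
    using assms(2) by (rule inj_on_to_nat_on)
  show "group (nat_copy G)"
    unfolding nat_copy_def using assms(1) inj by (rule group.inj_imp_image_group_is_group)
  have "G \<cong> nat_copy G"
    unfolding nat_copy_def is_iso_def using inj_imp_image_group_iso[OF inj] by blast
  then show "nat_copy G \<cong> G"
    using assms(1) by (simp add: group.iso_sym)
qed

text \<open>The family starts at index 1; the value at index 0 is a dummy.\<close>

fun iterated_wreath :: "nat \<Rightarrow> nat monoid"
  where
    "iterated_wreath 0 = singleton_group 0"
  | "iterated_wreath (Suc 0) = nat_copy integer_group"
  | "iterated_wreath (Suc (Suc k)) =
       nat_copy (wreath_product integer_group (iterated_wreath (Suc k)))"

lemma countable_nat_monoid [simp]: "countable (carrier (G :: nat monoid))"
  by simp

lemma countable_wreath_iterated: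
  "countable (carrier (wreath_product integer_group (iterated_wreath k)))"
  by (intro countable_wreath_product) auto

lemma group_iterated_wreath: "group (iterated_wreath k)"
  by (induction k rule: iterated_wreath.induct)
     (simp_all add: nat_copy group_wreath_product countable_wreath_iterated)

lemma iterated_wreath_1: "iterated_wreath 1 \<cong> integer_group"
  by (simp add: nat_copy)

lemma iterated_wreath_Suc:
  assumes "k \<ge> 1"
  shows "iterated_wreath (k + 1) \<cong> wreath_product integer_group (iterated_wreath k)"
  using assms
  by (cases k)
     (simp_all add: nat_copy group_wreath_product group_iterated_wreath countable_wreath_iterated)

end

theory Submission
  imports Defs "HOL-Library.Function_Algebras"
begin

text \<open>Write \<open>G = \<int> wr B\<close> and represent its elements as pairs \<open>(f, b)\<close> with \<open>f\<close> in the group ring of \<open>B\<close>.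
  The property that all orbits of finite-index normal subgroups \<open>K\<close> under conjugation are closed in
  the profinite topology implies hereditary conjugacy separability. Together with torsion-freeness
  and cyclic subgroup separability it is inherited by \<open>G\<close> from \<open>B\<close>.

  It suffices to consider the kernels \<open>K\<close> of the maps to \<open>(\<int>/q) wr (B/N)\<close>. As \<open>(u, d)\<close> conjugates \<open>(m, b)\<close>
  to \<open>(u + d m - c u, c)\<close> with \<open>c = d b d\<^sup>-\<^sup>1\<close>, the orbits of \<open>B\<close> reduce the claim to the closedness of the
  set of all \<open>e m + (1 - c) u\<close>, where \<open>e\<close> runs through the centralizer of \<open>c\<close> in \<open>N\<close> and \<open>u\<close> through the kernel
  \<open>U\<close> of \<open>\<int>[B] \<rightarrow> \<int>/q[B/N]\<close>. If \<open>m\<close> is a multiple of \<open>1 - c\<close>, then \<open>e m\<close> and \<open>m\<close> agree modulo \<open>(1 - c) U\<close>. Otherwise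
  the supports in the set of right cosets of \<open>\<langle>c\<rangle>\<close> leave finitely many possibilities for \<open>e\<close> modulo a power of \<open>c\<close> that acts
  trivially modulo \<open>(1 - c) U\<close>. In both cases it remains to see that \<open>(1 - c) U\<close> is closed, which is
  detected in quotients of \<open>B\<close> in which the order of \<open>c\<close> is divisible by a prescribed number.

  The derived length grows because a nontrivial element \<open>d\<close> of \<open>B\<close> does not fix \<open>1 - d\<close>, and \<open>G\<close> is not
  polycyclic for infinite \<open>B\<close> because \<open>\<int>[B]\<close> is not finitely generated.\<close>

section \<open>Conjugacy orbits in the profinite topology\<close>

text \<open>The obstacle is that \<open>1 - c\<close> is injective on the group ring when
  \<open>c\<close> has infinite order, whereas in a finite quotient \<open>c\<close> acquires a
  finite order and \<open>1 - c\<close> acquires a kernel. An element of that kernel has the same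
  coefficient along each cycle of \<open>c\<close>, and also along each cycle of a power
  \<open>c^p\<close>, so its total over the cycle is a multiple of the length of the cycle. If
  \<open>c^p\<close> acts trivially in the coarser quotient that defines \<open>U\<close>, that
  quotient adds up such cycles, and the kernel becomes invisible there as soon as the modulus
  \<open>q\<close> divides their length. Arranging this length is where torsion-freeness enters.
  Cyclic subgroup separability supplies both the prescribed lengths and the separation of supports
  modulo \<open>\<langle>c\<rangle>\<close>.

  Orbits of subgroups, not just conjugacy classes, enter because a conjugator taken from
  \<open>K\<close> has its second component in \<open>N\<close> rather than anywhere in
  \<open>B\<close>.\<close>

definition fin_normal :: "('a, 'm) monoid_scheme \<Rightarrow> 'a set \<Rightarrow> bool"
  where "fin_normal G N \<longleftrightarrow> N \<lhd> G \<and> finite_index G N"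

text \<open>The orbit of \<open>x\<close> under conjugation by \<open>K\<close> is closed in the profinite topology of \<open>G\<close>.\<close>

definition orbit_closed :: "('a, 'm) monoid_scheme \<Rightarrow> 'a set \<Rightarrow> 'a \<Rightarrow> bool"
  where "orbit_closed G K x \<longleftrightarrow>
    (\<forall>y\<in>carrier G. (\<forall>k\<in>K. y \<noteq> k \<otimes>\<^bsub>G\<^esub> x \<otimes>\<^bsub>G\<^esub> inv\<^bsub>G\<^esub> k) \<longrightarrow>
      (\<exists>L. fin_normal G L \<and> (\<forall>k\<in>K. y \<otimes>\<^bsub>G\<^esub> inv\<^bsub>G\<^esub> (k \<otimes>\<^bsub>G\<^esub> x \<otimes>\<^bsub>G\<^esub> inv\<^bsub>G\<^esub> k) \<notin> L)))"

definition orbits_closed :: "('a, 'm) monoid_scheme \<Rightarrow> bool"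
  where "orbits_closed G \<longleftrightarrow> (\<forall>K x. fin_normal G K \<longrightarrow> x \<in> carrier G \<longrightarrow> orbit_closed G K x)"

context group
begin

section \<open>Cosets and finite-index normal subgroups\<close>

lemma inv_mult_cancel:
  assumes "a \<in> carrier G" "b \<in> carrier G"
  shows "inv a \<otimes> (a \<otimes> b) = b" "a \<otimes> (inv a \<otimes> b) = b"
  using assms by (simp_all flip: m_assoc)

text \<open>The value \<open>f x\<close> determines the coset of \<open>x\<close>, so there are at
  most as many cosets as values. All finite indices below are obtained from such a finite
  invariant.\<close>

lemma finite_indexI:
  assumes N: "subgroup N G" and fin: "finite (f ` carrier G)"
    and f: "\<And>x y. x \<in> carrier G \<Longrightarrow> y \<in> carrier G \<Longrightarrow> f x = f y \<Longrightarrow> x \<otimes> inv y \<in> N"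
  shows "finite_index G N"
proof -
  interpret N: subgroup N G by fact
  have eq: "N #> x = N #> y" if "x \<in> carrier G" "y \<in> carrier G" "f x = f y" for x y
  proof (rule repr_independence[symmetric])
    show "x \<in> N #> y"
      using N.rcos_module_rev[OF is_group that(2,1)] f[OF that] by simp
  qed (use that N in auto)
  define r where "r v = (SOME x. x \<in> carrier G \<and> f x = v)" for v
  have "(\<lambda>x. N #> x) ` carrier G \<subseteq> (\<lambda>v. N #> r v) ` f ` carrier G"
  proof (intro image_subsetI)
    fix x assume x: "x \<in> carrier G"
    then have "r (f x) \<in> carrier G \<and> f (r (f x)) = f x"
      unfolding r_def by (intro someI[of "\<lambda>z. z \<in> carrier G \<and> f z = f x" x]) auto
    then have "N #> x = N #> r (f x)" using eq x by metis
    then show "N #> x \<in> (\<lambda>v. N #> r v) ` f ` carrier G"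
      using x by blast
  qed
  then have "finite ((\<lambda>x. N #> x) ` carrier G)"
    using fin finite_subset by blast
  moreover have "rcosets N = (\<lambda>x. N #> x) ` carrier G"
    by (auto simp: RCOSETS_def)
  ultimately show ?thesis
    by (simp add: finite_index_def)
qed

text \<open>The representatives are taken inside \<open>S\<close>. For a subgroup \<open>S\<close>
  the decomposition \<open>x = (x t^-1) t\<close> then stays within it.\<close>

lemma finite_coset_representatives:
  assumes N: "subgroup N G" "finite_index G N" and S: "S \<subseteq> carrier G"
  obtains T where "finite T" "T \<subseteq> S" "\<And>x. x \<in> S \<Longrightarrow> \<exists>t\<in>T. x \<otimes> inv t \<in> N"
proof -
  interpret N: subgroup N G by fact
  have "(\<lambda>x. N #> x) ` S \<subseteq> rcosets N"
    using S by (auto simp: RCOSETS_def)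
  then have "finite ((\<lambda>x. N #> x) ` S)"
    using N(2) by (auto simp: finite_index_def intro: finite_subset)
  then obtain T where T: "T \<subseteq> S" "finite T" "(\<lambda>x. N #> x) ` S = (\<lambda>x. N #> x) ` T"
    using finite_subset_image[of "(\<lambda>x. N #> x) ` S" "\<lambda>x. N #> x" S] by auto
  have "\<exists>t\<in>T. x \<otimes> inv t \<in> N" if x: "x \<in> S" for x
  proof -
    have "N #> x \<in> (\<lambda>x. N #> x) ` T"
      using T(3) x by blast
    then obtain t where t: "t \<in> T" "N #> x = N #> t" by auto
    then have "x \<in> N #> t"
      using rcos_self[of x N] N S x by auto
    then show ?thesis
      using N.rcos_module_imp[OF is_group] t T S x by (meson subsetD)
  qed
  then show ?thesis using T that by blast
qed

lemma fin_normalD: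
  assumes "fin_normal G N"
  shows "N \<lhd> G" "subgroup N G" "finite_index G N"
  using assms normal_imp_subgroup by (auto simp: fin_normal_def)

lemma fin_normal_carrier: "fin_normal G (carrier G)"
proof -
  have "finite_index G (carrier G)"
    by (rule finite_indexI[of _ "\<lambda>_. ()"]) (auto simp: subgroup_self)
  then show ?thesis by (simp add: fin_normal_def normal_self)
qed

lemma fin_normal_Int:
  assumes "fin_normal G N" "fin_normal G M"
  shows "fin_normal G (N \<inter> M)"
proof -
  have n: "N \<inter> M \<lhd> G"
    using assms by (simp add: fin_normal_def normal_subgroup_intersect)
  interpret N: normal N G using assms by (simp add: fin_normal_def)
  interpret M: normal M G using assms by (simp add: fin_normal_def)
  have "finite_index G (N \<inter> M)"
  proof (rule finite_indexI[of _ "\<lambda>x. (N #> x, M #> x)"])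
    show "subgroup (N \<inter> M) G" using n normal_imp_subgroup by blast
    have "(\<lambda>x. (N #> x, M #> x)) ` carrier G \<subseteq> (rcosets N) \<times> (rcosets M)"
      by (auto simp: RCOSETS_def)
    then show "finite ((\<lambda>x. (N #> x, M #> x)) ` carrier G)"
      using assms by (auto simp: fin_normal_def finite_index_def intro: finite_subset)
    fix x y assume xy: "x \<in> carrier G" "y \<in> carrier G" "(N #> x, M #> x) = (N #> y, M #> y)"
    then have "x \<in> N #> y" "x \<in> M #> y"
      using rcos_self[of x N] rcos_self[of x M] N.is_subgroup M.is_subgroup by auto
    then show "x \<otimes> inv y \<in> N \<inter> M"
      using N.rcos_module_imp[OF is_group xy(2)] M.rcos_module_imp[OF is_group xy(2)] xy by auto
  qed
  with n show ?thesis by (simp add: fin_normal_def)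
qed

text \<open>Each condition survives shrinking the subgroup, so the intersection of finitely many
  witnesses satisfies them all. This combines separations that are available only for one element at
  a time.\<close>

lemma fin_normal_common:
  assumes "finite S"
    and "\<And>i. i \<in> S \<Longrightarrow> \<exists>N. fin_normal G N \<and> P i N"
    and "\<And>i N M. i \<in> S \<Longrightarrow> fin_normal G N \<Longrightarrow> P i N \<Longrightarrow> fin_normal G M \<Longrightarrow> M \<subseteq> N \<Longrightarrow> P i M"
  shows "\<exists>N. fin_normal G N \<and> (\<forall>i\<in>S. P i N)"
  using assms
proof (induction S)
  case empty
  then show ?case using fin_normal_carrier by blast
next
  case (insert i S)
  have "\<exists>N. fin_normal G N \<and> (\<forall>i\<in>S. P i N)"
  proof (rule insert.IH)
    show "\<And>i. i \<in> S \<Longrightarrow> \<exists>N. fin_normal G N \<and> P i N" using insert.prems(1) by blast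
    show "\<And>i N M. i \<in> S \<Longrightarrow> fin_normal G N \<Longrightarrow> P i N \<Longrightarrow> fin_normal G M \<Longrightarrow> M \<subseteq> N \<Longrightarrow> P i M"
      using insert.prems(2) by blast
  qed
  then obtain N where N: "fin_normal G N" "\<forall>i\<in>S. P i N" by blast
  obtain M where M: "fin_normal G M" "P i M" using insert.prems(1)[of i] by blast
  have "fin_normal G (N \<inter> M)" using N M fin_normal_Int by blast
  moreover have "P j (N \<inter> M)" if "j \<in> insert i S" for j
    using that insert.prems(2)[of j N "N \<inter> M"] insert.prems(2)[of j M "N \<inter> M"] N M calculation
    by blast
  ultimately show ?case by blast
qed

section \<open>Orbits of subgroups acting by conjugation\<close>

lemma conj_by_product:
  assumes "k \<in> carrier G" "t \<in> carrier G" "x \<in> carrier G"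
  shows "(k \<otimes> t) \<otimes> x \<otimes> inv (k \<otimes> t) = k \<otimes> (t \<otimes> x \<otimes> inv t) \<otimes> inv k"
  using assms by (simp add: inv_mult_group m_assoc)

text \<open>Each \<open>H\<close>-orbit is a finite union of \<open>K\<close>-orbits.\<close>

lemma orbit_closed_supergroup:
  assumes K: "fin_normal G K" and H: "subgroup H G" and KH: "K \<subseteq> H"
    and cl: "\<And>x. x \<in> carrier G \<Longrightarrow> orbit_closed G K x" and x: "x \<in> carrier G"
  shows "orbit_closed G H x"
  unfolding orbit_closed_def
proof (intro ballI impI)
  fix y assume y: "y \<in> carrier G" and ne: "\<forall>k\<in>H. y \<noteq> k \<otimes> x \<otimes> inv k"
  interpret H: subgroup H G by fact
  interpret K: subgroup K G using K by (simp add: fin_normalD)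
  obtain T where T: "finite T" "T \<subseteq> H" "\<And>h. h \<in> H \<Longrightarrow> \<exists>t\<in>T. h \<otimes> inv t \<in> K"
    using finite_coset_representatives[of K H] fin_normalD[OF K] H.subset by blast
  have "\<exists>L. fin_normal G L \<and> (\<forall>t\<in>T. \<forall>k\<in>K. y \<otimes> inv (k \<otimes> (t \<otimes> x \<otimes> inv t) \<otimes> inv k) \<notin> L)"
  proof (rule fin_normal_common)
    fix t assume t: "t \<in> T"
    then have tG: "t \<in> carrier G" "t \<in> H" using T(2) H.subset by auto
    have "y \<noteq> k \<otimes> (t \<otimes> x \<otimes> inv t) \<otimes> inv k" if "k \<in> K" for k
      using ne[rule_format, of "k \<otimes> t"] conj_by_product[of k t x] that tG KH x K.subset by auto
    then show "\<exists>L. fin_normal G L \<and> (\<forall>k\<in>K. y \<otimes> inv (k \<otimes> (t \<otimes> x \<otimes> inv t) \<otimes> inv k) \<notin> L)"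
      using cl[of "t \<otimes> x \<otimes> inv t"] tG x y by (auto simp: orbit_closed_def)
  qed (use T in auto)
  then obtain L where L: "fin_normal G L"
    "\<And>t k. t \<in> T \<Longrightarrow> k \<in> K \<Longrightarrow> y \<otimes> inv (k \<otimes> (t \<otimes> x \<otimes> inv t) \<otimes> inv k) \<notin> L" by blast
  have "y \<otimes> inv (h \<otimes> x \<otimes> inv h) \<notin> L" if h: "h \<in> H" for h
  proof -
    obtain t where t: "t \<in> T" "h \<otimes> inv t \<in> K" using T(3) h by blast
    have tG: "t \<in> carrier G" "h \<in> carrier G" using t T(2) h by auto
    then have "h = (h \<otimes> inv t) \<otimes> t" by (simp add: m_assoc)
    then have "h \<otimes> x \<otimes> inv h = (h \<otimes> inv t) \<otimes> (t \<otimes> x \<otimes> inv t) \<otimes> inv (h \<otimes> inv t)"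
      using conj_by_product[of "h \<otimes> inv t" t x] tG x by simp
    then show ?thesis using L(2)[OF t] by simp
  qed
  then show "\<exists>L. fin_normal G L \<and> (\<forall>k\<in>H. y \<otimes> inv (k \<otimes> x \<otimes> inv k) \<notin> L)"
    using L(1) by blast
qed

text \<open>\<open>K\<close> is the intersection of the conjugates of \<open>H\<close>. Two elements
  that act alike by right multiplication on the finitely many right cosets of \<open>H\<close>
  differ by an element of \<open>K\<close>, which bounds its index.\<close>

lemma finite_index_core:
  assumes H: "subgroup H G" and fi: "finite_index G H"
  obtains K where "fin_normal G K" "K \<subseteq> H"
proof -
  interpret H: subgroup H G by fact
  define K where "K = {x \<in> carrier G. \<forall>y\<in>carrier G. y \<otimes> x \<otimes> inv y \<in> H}"
  have sub: "subgroup K G"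
  proof (rule subgroupI)
    show "K \<noteq> {}" by (auto simp: K_def intro!: exI[of _ \<one>])
    fix a assume a: "a \<in> K"
    have "y \<otimes> inv a \<otimes> inv y \<in> H" if "y \<in> carrier G" for y
    proof -
      have "inv (y \<otimes> a \<otimes> inv y) \<in> H" using a that by (auto simp: K_def)
      then show ?thesis using a that by (simp add: K_def inv_mult_group m_assoc)
    qed
    then show "inv a \<in> K" using a by (auto simp: K_def)
    fix b assume b: "b \<in> K"
    have "y \<otimes> (a \<otimes> b) \<otimes> inv y \<in> H" if y: "y \<in> carrier G" for y
    proof -
      have "(y \<otimes> a \<otimes> inv y) \<otimes> (y \<otimes> b \<otimes> inv y) \<in> H" using a b y by (auto simp: K_def)
      also have "(y \<otimes> a \<otimes> inv y) \<otimes> (y \<otimes> b \<otimes> inv y) = y \<otimes> (a \<otimes> b) \<otimes> inv y"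
        using a b y by (simp add: K_def m_assoc inv_mult_cancel)
      finally show ?thesis .
    qed
    then show "a \<otimes> b \<in> K" using a b by (auto simp: K_def)
  qed (auto simp: K_def)
  have norm: "K \<lhd> G"
  proof (rule normal_invI[OF sub])
    fix x h assume x: "x \<in> carrier G" and h: "h \<in> K"
    have "y \<otimes> (x \<otimes> h \<otimes> inv x) \<otimes> inv y \<in> H" if y: "y \<in> carrier G" for y
    proof -
      have "(y \<otimes> x) \<otimes> h \<otimes> inv (y \<otimes> x) \<in> H" using x h y by (auto simp: K_def)
      then show ?thesis using x h y conj_by_product[of y x h] by (simp add: K_def)
    qed
    then show "x \<otimes> h \<otimes> inv x \<in> K" using x h by (auto simp: K_def)
  qed
  obtain T where T: "finite T" "T \<subseteq> carrier G" "\<And>x. x \<in> carrier G \<Longrightarrow> \<exists>t\<in>T. x \<otimes> inv t \<in> H"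
    using finite_coset_representatives[OF H fi, of "carrier G"] by blast
  have "finite_index G K"
  proof (rule finite_indexI[OF sub, of "\<lambda>x. \<lambda>t\<in>T. H #> (t \<otimes> x)"])
    have "(\<lambda>x. \<lambda>t\<in>T. H #> (t \<otimes> x)) ` carrier G \<subseteq> T \<rightarrow>\<^sub>E rcosets H"
      using T(2) H.subset by (auto intro!: rcosetsI m_closed)
    moreover have "finite (T \<rightarrow>\<^sub>E rcosets H)"
      using T(1) fi by (intro finite_PiE) (auto simp: finite_index_def)
    ultimately show "finite ((\<lambda>x. \<lambda>t\<in>T. H #> (t \<otimes> x)) ` carrier G)"
      by (rule finite_subset)
    fix x y assume x: "x \<in> carrier G" and y: "y \<in> carrier G"
      and eq: "(\<lambda>t\<in>T. H #> (t \<otimes> x)) = (\<lambda>t\<in>T. H #> (t \<otimes> y))"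
    have "z \<otimes> (x \<otimes> inv y) \<otimes> inv z \<in> H" if z: "z \<in> carrier G" for z
    proof -
      obtain t where t: "t \<in> T" "z \<otimes> inv t \<in> H" using T(3) z by blast
      then have tG: "t \<in> carrier G" using T(2) by auto
      have "H #> (t \<otimes> x) = H #> (t \<otimes> y)" using eq t(1) by (metis restrict_apply')
      then have "t \<otimes> x \<in> H #> (t \<otimes> y)"
        using rcos_self[of "t \<otimes> x" H] H tG x by auto
      then have h: "(t \<otimes> x) \<otimes> inv (t \<otimes> y) \<in> H"
        using H.rcos_module_imp[OF is_group, of "t \<otimes> y" "t \<otimes> x"] tG x y by auto
      \<comment> \<open>Since \<open>z = (z t^-1) t\<close> with \<open>z t^-1\<close> in
        \<open>H\<close>, conjugation by \<open>z\<close> reduces to conjugation by the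
        representative \<open>t\<close>.\<close>
      have "(z \<otimes> inv t) \<otimes> ((t \<otimes> x) \<otimes> inv (t \<otimes> y)) \<otimes> inv (z \<otimes> inv t) \<in> H"
        using t(2) h by blast
      also have "(z \<otimes> inv t) \<otimes> ((t \<otimes> x) \<otimes> inv (t \<otimes> y)) \<otimes> inv (z \<otimes> inv t) = z \<otimes> (x \<otimes> inv y) \<otimes> inv z"
        using tG x y z by (simp add: inv_mult_group m_assoc inv_mult_cancel)
      finally show ?thesis .
    qed
    then show "x \<otimes> inv y \<in> K" using x y by (auto simp: K_def)
  qed
  then have "fin_normal G K" using norm by (simp add: fin_normal_def)
  moreover have "K \<subseteq> H"
  proof
    fix x assume "x \<in> K"
    then have "x \<in> carrier G" "\<one> \<otimes> x \<otimes> inv \<one> \<in> H" unfolding K_def by blast+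
    then show "x \<in> H" by simp
  qed
  ultimately show ?thesis using that by blast
qed

section \<open>Finite quotients and conjugacy separability\<close>

text \<open>The quotient is transported to the naturals, where the definition of conjugacy
  separability expects its finite images.\<close>

lemma finite_quotient:
  assumes "fin_normal G N"
  obtains Q :: "nat monoid" and \<pi> where "group Q" "finite (carrier Q)" "\<pi> \<in> epi G Q"
    "\<And>x y. x \<in> carrier G \<Longrightarrow> y \<in> carrier G \<Longrightarrow> \<pi> x = \<pi> y \<Longrightarrow> x \<otimes> inv y \<in> N"
proof -
  interpret N: normal N G using assms by (simp add: fin_normal_def)
  have fin: "finite (carrier (G Mod N))"
    using assms by (simp add: fin_normal_def finite_index_def FactGroup_def)
  let ?c = "to_nat_on (carrier (G Mod N))"
  have inj: "inj_on ?c (carrier (G Mod N))"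
    using fin by (intro inj_on_to_nat_on countable_finite)
  have iso: "?c \<in> iso (G Mod N) (nat_copy (G Mod N))"
    unfolding nat_copy_def using inj by (rule inj_imp_image_group_iso)
  show ?thesis
  proof
    show "group (nat_copy (G Mod N))"
      using N.factorgroup_is_group fin by (intro nat_copy(1) countable_finite)
    have carr: "carrier (nat_copy (G Mod N)) = ?c ` carrier (G Mod N)"
      using iso by (auto simp: iso_def bij_betw_def)
    then show "finite (carrier (nat_copy (G Mod N)))"
      using fin by simp
    have "?c \<circ> (\<lambda>x. N #> x) \<in> hom G (nat_copy (G Mod N))"
      using N.r_coset_hom_Mod iso by (auto simp: iso_def hom_def Pi_iff)
    moreover have "(?c \<circ> (\<lambda>x. N #> x)) ` carrier G = carrier (nat_copy (G Mod N))"
      unfolding carr by (simp add: carrier_FactGroup image_comp)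
    ultimately show "?c \<circ> (\<lambda>x. N #> x) \<in> epi G (nat_copy (G Mod N))"
      by (simp add: epi_def)
    fix x y assume x: "x \<in> carrier G" and y: "y \<in> carrier G"
      and eq: "(?c \<circ> (\<lambda>x. N #> x)) x = (?c \<circ> (\<lambda>x. N #> x)) y"
    then have "N #> x = N #> y"
      using inj x y by (auto simp: carrier_FactGroup inj_on_def)
    then have "x \<in> N #> y"
      using rcos_self[of x N] N.is_subgroup x by auto
    then show "x \<otimes> inv y \<in> N"
      using N.rcos_module_imp[OF is_group y] by simp
  qed
qed

text \<open>If \<open>L\<close> separates \<open>g\<close> from the \<open>H\<close>-orbit of
  \<open>f\<close>, the quotient of \<open>H\<close> by \<open>H \<inter> L\<close> does the job: a
  conjugator in the image lifts to some \<open>h\<close> in \<open>H\<close>, which would place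
  \<open>g (h f h^-1)^-1\<close> in \<open>L\<close>.\<close>

lemma conjugacy_separable_if_orbit_closed:
  assumes H: "subgroup H G" and cl: "\<And>x. x \<in> H \<Longrightarrow> orbit_closed G H x"
  shows "conjugacy_separable (G\<lparr>carrier := H\<rparr>)"
  unfolding conjugacy_separable_def
proof (intro ballI impI)
  interpret H: subgroup H G by fact
  let ?H = "G\<lparr>carrier := H\<rparr>"
  interpret HG: group ?H by (rule subgroup_imp_group[OF H])
  fix f g assume f: "f \<in> carrier ?H" and g: "g \<in> carrier ?H" and nc: "\<not> conjugate ?H f g"
  have "\<forall>k\<in>H. g \<noteq> k \<otimes> f \<otimes> inv k"
    using nc H by (auto simp: conjugate_def m_inv_consistent)
  then obtain L where L: "fin_normal G L" "\<And>k. k \<in> H \<Longrightarrow> g \<otimes> inv (k \<otimes> f \<otimes> inv k) \<notin> L"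
    using cl[of f] f g by (auto simp: orbit_closed_def)
  interpret L: normal L G using L by (simp add: fin_normal_def)
  have norm: "H \<inter> L \<lhd> ?H"
    using normal_Int_subgroup[OF H] L by (metis Int_commute fin_normal_def)
  have "finite_index ?H (H \<inter> L)"
  proof (rule HG.finite_indexI[of _ "\<lambda>x. L #> x"])
    show "subgroup (H \<inter> L) ?H" using norm normal_imp_subgroup by blast
    have "(\<lambda>x. L #> x) ` carrier ?H \<subseteq> rcosets L" using H.subset by (auto simp: RCOSETS_def)
    then show "finite ((\<lambda>x. L #> x) ` carrier ?H)"
      using L by (auto simp: fin_normal_def finite_index_def intro: finite_subset)
    fix x y assume xy: "x \<in> carrier ?H" "y \<in> carrier ?H" "L #> x = L #> y"
    then have "x \<in> L #> y" using rcos_self[of x L] L.is_subgroup by auto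
    then have "x \<otimes> inv y \<in> L" using L.rcos_module_imp[OF is_group, of y x] xy by auto
    then show "x \<otimes>\<^bsub>?H\<^esub> inv\<^bsub>?H\<^esub> y \<in> H \<inter> L" using xy H by (auto simp: m_inv_consistent)
  qed
  then have "fin_normal ?H (H \<inter> L)" using norm by (simp add: fin_normal_def)
  then obtain Q :: "nat monoid" and \<pi> where Q: "group Q" "finite (carrier Q)" and epi: "\<pi> \<in> epi ?H Q"
    and sep: "\<And>x y. x \<in> carrier ?H \<Longrightarrow> y \<in> carrier ?H \<Longrightarrow> \<pi> x = \<pi> y \<Longrightarrow> x \<otimes>\<^bsub>?H\<^esub> inv\<^bsub>?H\<^esub> y \<in> H \<inter> L"
    using HG.finite_quotient by metis
  interpret \<pi>: group_hom ?H Q \<pi>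
    using Q epi by (simp add: group_hom_def group_hom_axioms_def epi_def HG.is_group)
  have "\<not> conjugate Q (\<pi> f) (\<pi> g)"
  proof
    assume "conjugate Q (\<pi> f) (\<pi> g)"
    then obtain c where c: "c \<in> carrier Q" "\<pi> g = c \<otimes>\<^bsub>Q\<^esub> \<pi> f \<otimes>\<^bsub>Q\<^esub> inv\<^bsub>Q\<^esub> c"
      by (auto simp: conjugate_def)
    then obtain h where h: "h \<in> carrier ?H" "c = \<pi> h"
      using epi by (auto simp: epi_def)
    have "\<pi> g = \<pi> (h \<otimes>\<^bsub>?H\<^esub> f \<otimes>\<^bsub>?H\<^esub> inv\<^bsub>?H\<^esub> h)"
      using c h f by (simp only: \<pi>.hom_mult \<pi>.hom_inv HG.m_closed HG.inv_closed)
    then have "g \<otimes>\<^bsub>?H\<^esub> inv\<^bsub>?H\<^esub> (h \<otimes>\<^bsub>?H\<^esub> f \<otimes>\<^bsub>?H\<^esub> inv\<^bsub>?H\<^esub> h) \<in> H \<inter> L"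
      using h f by (intro sep[OF g]) (simp_all add: m_inv_consistent H)
    moreover have "h \<otimes> f \<otimes> inv h \<in> H" using h f by simp
    ultimately show False
      using L(2)[of h] h f H by (simp add: m_inv_consistent)
  qed
  then show "\<exists>Q \<pi>. group (Q :: nat monoid) \<and> finite (carrier Q) \<and> \<pi> \<in> epi ?H Q \<and> \<not> conjugate Q (\<pi> f) (\<pi> g)"
    using Q epi by blast
qed

lemma hereditarily_conjugacy_separable_if_orbits_closed:
  assumes "orbits_closed G"
  shows "hereditarily_conjugacy_separable G"
proof -
  have *: "conjugacy_separable (G\<lparr>carrier := H\<rparr>)" if H: "subgroup H G" "finite_index G H" for H
  proof (rule conjugacy_separable_if_orbit_closed[OF H(1)])
    fix x assume "x \<in> H"
    then have x: "x \<in> carrier G" using H(1) subgroup.mem_carrier by fastforce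
    obtain K where "fin_normal G K" "K \<subseteq> H" using finite_index_core[OF H] .
    then show "orbit_closed G H x"
      using orbit_closed_supergroup[of K H x] H x assms by (simp add: orbits_closed_def)
  qed
  moreover have "conjugacy_separable G"
    using *[OF subgroup_self] fin_normalD(3)[OF fin_normal_carrier] by simp
  ultimately show ?thesis by (simp add: hereditarily_conjugacy_separable_def)
qed

text \<open>The product set is traded for congruences: for normal \<open>N\<close>, lying in
  \<open>\<langle>g\<rangle> N\<close> means agreeing with a power of \<open>g\<close> modulo
  \<open>N\<close>, and normality makes the side of the quotient irrelevant.\<close>

lemma cyclic_subgroup_separable_iff:
  "cyclic_subgroup_separable G \<longleftrightarrow>
    (\<forall>g\<in>carrier G. \<forall>h\<in>carrier G. (\<forall>i::int. h \<noteq> g [^] i) \<longrightarrow>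
      (\<exists>N. fin_normal G N \<and> (\<forall>i::int. h \<otimes> inv (g [^] i) \<notin> N)))"
proof -
  have *: "h \<notin> generate G {g} <#> N \<longleftrightarrow> (\<forall>i::int. h \<otimes> inv (g [^] i) \<notin> N)"
    if g: "g \<in> carrier G" and h: "h \<in> carrier G" and N: "N \<lhd> G" for g h N
  proof -
    interpret N: normal N G by fact
    have conj: "h \<otimes> inv a \<in> N \<longleftrightarrow> inv a \<otimes> h \<in> N" if a: "a \<in> carrier G" for a
    proof
      assume "h \<otimes> inv a \<in> N"
      then have "inv a \<otimes> (h \<otimes> inv a) \<otimes> a \<in> N" using N.inv_op_closed1 a by blast
      then show "inv a \<otimes> h \<in> N" using a h by (simp add: m_assoc)
    next
      assume "inv a \<otimes> h \<in> N"
      then have "a \<otimes> (inv a \<otimes> h) \<otimes> inv a \<in> N" using N.inv_op_closed2 a by blast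
      then show "h \<otimes> inv a \<in> N" using a h by (simp flip: m_assoc)
    qed
    have "h \<in> generate G {g} <#> N \<longleftrightarrow> (\<exists>i::int. \<exists>n\<in>N. h = g [^] i \<otimes> n)"
      using g by (auto simp: generate_pow set_mult_def)
    also have "\<dots> \<longleftrightarrow> (\<exists>i::int. inv (g [^] i) \<otimes> h \<in> N)"
    proof (intro ex_cong1 iffI)
      fix i :: int assume "\<exists>n\<in>N. h = g [^] i \<otimes> n"
      then show "inv (g [^] i) \<otimes> h \<in> N" using g by (auto simp flip: m_assoc)
    next
      fix i :: int assume "inv (g [^] i) \<otimes> h \<in> N"
      then show "\<exists>n\<in>N. h = g [^] i \<otimes> n"
        using g h by (intro bexI[of _ "inv (g [^] i) \<otimes> h"]) (auto simp flip: m_assoc)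
    qed
    finally show ?thesis using conj g by simp
  qed
  have **: "(\<exists>N. N \<lhd> G \<and> finite_index G N \<and> h \<notin> generate G {g} <#> N) \<longleftrightarrow>
      (\<exists>N. fin_normal G N \<and> (\<forall>i::int. h \<otimes> inv (g [^] i) \<notin> N))"
    if g: "g \<in> carrier G" and h: "h \<in> carrier G" for g h
    using *[OF g h] unfolding fin_normal_def by blast
  have gen: "h \<notin> generate G {g} \<longleftrightarrow> (\<forall>i::int. h \<noteq> g [^] i)" if "g \<in> carrier G" for g h
    using that by (auto simp: generate_pow)
  show ?thesis
    unfolding cyclic_subgroup_separable_def by (intro ball_cong refl) (simp only: ** gen)
qed

end

section \<open>The integral group ring and its augmentation kernels\<close>

definition scale :: "int \<Rightarrow> ('a \<Rightarrow> int) \<Rightarrow> 'a \<Rightarrow> int"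
  where "scale c f = (\<lambda>x. c * f x)"

definition point :: "'a \<Rightarrow> 'a \<Rightarrow> int"
  where "point g = (\<lambda>x. if x = g then 1 else 0)"

text \<open>\<open>{x. f x \<noteq> 0 \<and> x \<in> S}\<close> is finite for the \<open>f\<close> of interest, while \<open>S\<close> may be infinite.\<close>

definition csum :: "('a \<Rightarrow> int) \<Rightarrow> 'a set \<Rightarrow> int"
  where "csum f S = (\<Sum>x | f x \<noteq> 0 \<and> x \<in> S. f x)"

text \<open>Subgroups of the additive group of functions, as a predicate on plain sets so that the
  pointwise operations apply directly. Closure under differences covers negatives and sums.\<close>

definition additive :: "('a \<Rightarrow> int) set \<Rightarrow> bool"
  where "additive V \<longleftrightarrow> 0 \<in> V \<and> (\<forall>f\<in>V. \<forall>g\<in>V. f - g \<in> V)"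

lemma additive_closed:
  assumes "additive V" and f: "f \<in> V"
  shows "- f \<in> V" "g \<in> V \<Longrightarrow> f + g \<in> V" "g \<in> V \<Longrightarrow> f - g \<in> V" "scale c f \<in> V"
proof -
  have minus: "f - g \<in> V" if "f \<in> V" "g \<in> V" for f g
    using assms(1) that by (auto simp: additive_def)
  have zero: "0 \<in> V" using assms(1) by (simp add: additive_def)
  have neg: "- f \<in> V" if "f \<in> V" for f
    using minus[OF zero that] by simp
  have add: "f + g \<in> V" if "f \<in> V" "g \<in> V" for f g
    using minus[OF that(1) neg[OF that(2)]] by simp
  show "- f \<in> V" "g \<in> V \<Longrightarrow> f + g \<in> V" "g \<in> V \<Longrightarrow> f - g \<in> V"
    using neg add minus f by auto
  have nat: "scale (int n) f \<in> V" for n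
  proof (induction n)
    case 0
    have "scale (int 0) f = 0" by (simp add: scale_def fun_eq_iff)
    then have "scale (int 0) f \<in> V" using zero by simp
    then show ?case .
  next
    case (Suc n)
    have "scale (int (Suc n)) f = scale (int n) f + f"
      by (simp add: scale_def fun_eq_iff algebra_simps)
    then have "scale (int (Suc n)) f \<in> V" using Suc add f by metis
    then show ?case .
  qed
  show "scale c f \<in> V"
  proof (cases "c \<ge> 0")
    case True
    then show ?thesis using nat[of "nat c"] by simp
  next
    case False
    then have "scale c f = - scale (int (nat (- c))) f"
      by (simp add: scale_def fun_eq_iff)
    then show ?thesis using neg[OF nat[of "nat (- c)"]] by metis
  qed
qed

lemma additive_sum:
  assumes "additive V" "\<And>i. i \<in> I \<Longrightarrow> h i \<in> V"
  shows "sum h I \<in> V"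
proof -
  have zero: "0 \<in> V" using assms(1) by (simp add: additive_def)
  have "(\<forall>i\<in>I. h i \<in> V) \<longrightarrow> sum h I \<in> V"
  proof (induction I rule: infinite_finite_induct)
    case (insert x F)
    have eq: "sum h (insert x F) = h x + sum h F" using insert by simp
    show ?case
    proof
      assume "\<forall>i\<in>insert x F. h i \<in> V"
      then have "h x + sum h F \<in> V"
        using insert additive_closed(2)[OF assms(1), of "h x" "sum h F"] by blast
      then show "sum h (insert x F) \<in> V" unfolding eq .
    qed
  next
    case (infinite A)
    then have "sum h A = 0" by simp
    then have "sum h A \<in> V" using zero by metis
    then show ?case by blast
  next
    case empty
    have "sum h {} = 0" by simp
    then have "sum h {} \<in> V" using zero by metis
    then show ?case by blast
  qed
  then show ?thesis using assms(2) by blast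
qed

section \<open>Sums of coefficients over subsets\<close>

lemma csum_eq_sum:
  assumes "finite A" "A \<subseteq> S" "\<And>x. x \<in> S \<Longrightarrow> f x \<noteq> 0 \<Longrightarrow> x \<in> A"
  shows "csum f S = sum f A"
  unfolding csum_def using assms by (intro sum.mono_neutral_left) auto

lemma csum_cong: "(\<And>x. f x \<noteq> 0 \<Longrightarrow> x \<in> S \<longleftrightarrow> x \<in> T) \<Longrightarrow> csum f S = csum f T"
  unfolding csum_def by (intro sum.cong) auto

lemma csum_nonzero:
  assumes "csum f S \<noteq> 0" shows "\<exists>t\<in>S. f t \<noteq> 0"
proof (rule ccontr)
  assume "\<not> (\<exists>t\<in>S. f t \<noteq> 0)"
  then have "{x. f x \<noteq> 0 \<and> x \<in> S} = {}" by blast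
  then show False using assms unfolding csum_def by (simp only: sum.empty)
qed

lemma csum_point: "csum (point g) S = (if g \<in> S then 1 else 0)"
proof -
  have "{x. point g x \<noteq> 0 \<and> x \<in> S} = (if g \<in> S then {g} else {})"
    by (auto simp: point_def)
  then show ?thesis by (auto simp: csum_def point_def)
qed

lemma csum_add:
  assumes "finite {x. f x \<noteq> 0}" "finite {x. g x \<noteq> 0}"
  shows "csum (f + g) S = csum f S + csum g S"
proof -
  let ?A = "({x. f x \<noteq> 0} \<union> {x. g x \<noteq> 0}) \<inter> S"
  have fin: "finite ?A" using assms by auto
  have "csum f S = sum f ?A" "csum g S = sum g ?A" "csum (f + g) S = sum (f + g) ?A"
    by (intro csum_eq_sum fin; auto)+
  then show ?thesis by (simp add: sum.distrib)
qed

lemma csum_scale: "csum (scale c f) S = c * csum f S"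
proof (cases "c = 0")
  case True
  then show ?thesis by (simp add: csum_def scale_def)
next
  case False
  then have "{x. scale c f x \<noteq> 0 \<and> x \<in> S} = {x. f x \<noteq> 0 \<and> x \<in> S}"
    by (auto simp: scale_def)
  then show ?thesis by (simp add: csum_def scale_def sum_distrib_left)
qed

lemma csum_diff:
  assumes "finite {x. f x \<noteq> 0}" "finite {x. g x \<noteq> 0}"
  shows "csum (f - g) S = csum f S - csum g S"
proof -
  have eq: "f - g = f + scale (-1) g" by (auto simp: scale_def fun_eq_iff)
  have "finite {x. scale (-1) g x \<noteq> 0}" using assms(2) by (simp add: scale_def)
  then show ?thesis unfolding eq csum_add[OF assms(1)] csum_scale by (simp add: csum_add assms(1) csum_scale)
qed

lemma csum_UN_disjoint:
  assumes f: "finite {x. f x \<noteq> 0}" and I: "finite I"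
    and dis: "\<And>i j. i \<in> I \<Longrightarrow> j \<in> I \<Longrightarrow> i \<noteq> j \<Longrightarrow> A i \<inter> A j = {}"
  shows "csum f (\<Union>i\<in>I. A i) = (\<Sum>i\<in>I. csum f (A i))"
proof -
  have "{x. f x \<noteq> 0 \<and> x \<in> (\<Union>i\<in>I. A i)} = (\<Union>i\<in>I. {x. f x \<noteq> 0 \<and> x \<in> A i})"
    by auto
  then show ?thesis
    unfolding csum_def using f I dis
    by (simp only:) (rule sum.UNION_disjoint, auto)
qed

context group
begin

text \<open>\<open>fsupp\<close> is the group ring of \<open>G\<close> over the integers, \<open>tr b\<close> is left multiplication by \<open>b\<close>, and \<open>aug D q\<close>
  is the kernel of the map from \<open>fsupp\<close> to the functions on the right cosets of \<open>D\<close> with values in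
  the integers modulo \<open>q\<close>, where \<open>q = 0\<close> stands for the integers themselves.\<close>

definition fsupp :: "('a \<Rightarrow> int) set"
  where "fsupp = {f. finite {x. f x \<noteq> 0} \<and> {x. f x \<noteq> 0} \<subseteq> carrier G}"

definition tr :: "'a \<Rightarrow> ('a \<Rightarrow> int) \<Rightarrow> 'a \<Rightarrow> int"
  where "tr b f = (\<lambda>x. if x \<in> carrier G then f (inv b \<otimes> x) else 0)"

definition aug :: "'a set \<Rightarrow> int \<Rightarrow> ('a \<Rightarrow> int) set"
  where "aug D q = {f \<in> fsupp. \<forall>g\<in>carrier G. q dvd csum f (D #> g)}"

section \<open>The kernels \<open>aug\<close> and their generators\<close>

lemma finite_supp: "f \<in> fsupp \<Longrightarrow> finite {x. f x \<noteq> 0}"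
  by (simp add: fsupp_def)

lemma fsupp_carrier: "f \<in> fsupp \<Longrightarrow> f x \<noteq> 0 \<Longrightarrow> x \<in> carrier G"
  by (auto simp: fsupp_def)

lemma additive_fsupp: "additive fsupp"
  unfolding additive_def
proof (intro conjI ballI)
  fix f g assume "f \<in> fsupp" "g \<in> fsupp"
  then have "finite ({x. f x \<noteq> 0} \<union> {x. g x \<noteq> 0})" "{x. f x \<noteq> 0} \<union> {x. g x \<noteq> 0} \<subseteq> carrier G"
    by (auto simp: fsupp_def)
  moreover have "{x. (f - g) x \<noteq> 0} \<subseteq> {x. f x \<noteq> 0} \<union> {x. g x \<noteq> 0}" by auto
  ultimately show "f - g \<in> fsupp"
    unfolding fsupp_def by (blast intro: finite_subset)
qed (simp add: fsupp_def)

lemmas fsupp_closed = additive_closed[OF additive_fsupp]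

lemma zero_fsupp: "0 \<in> fsupp"
  using additive_fsupp by (simp add: additive_def)

lemma point_fsupp: "g \<in> carrier G \<Longrightarrow> point g \<in> fsupp"
  by (auto simp: fsupp_def point_def)

lemma additive_aug: "additive (aug D q)"
  unfolding additive_def
proof (intro conjI ballI)
  show "0 \<in> aug D q" by (simp add: aug_def zero_fsupp csum_def)
  fix f g assume "f \<in> aug D q" "g \<in> aug D q"
  then show "f - g \<in> aug D q"
    by (auto simp: aug_def fsupp_closed csum_diff finite_supp)
qed

lemmas aug_closed = additive_closed[OF additive_aug]

lemma zero_aug: "0 \<in> aug D q"
  using additive_aug by (simp add: additive_def)

lemma aug_fsupp: "f \<in> aug D q \<Longrightarrow> f \<in> fsupp"
  by (simp add: aug_def)

lemma aug_1: "aug D 1 = fsupp"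
  by (auto simp: aug_def)

lemma scale_aug: "f \<in> fsupp \<Longrightarrow> q dvd c \<Longrightarrow> scale c f \<in> aug D q"
  by (auto simp: aug_def fsupp_closed csum_scale)

lemma mult_mem_rcos_iff:
  assumes D: "subgroup D G" and "d \<in> D" "g \<in> carrier G" "k \<in> carrier G"
  shows "d \<otimes> g \<in> D #> k \<longleftrightarrow> g \<in> D #> k"
proof -
  interpret D: subgroup D G by fact
  have "d \<otimes> g \<in> D #> k \<longleftrightarrow> (d \<otimes> g) \<otimes> inv k \<in> D"
    using assms D.rcos_module[OF is_group, of k "d \<otimes> g"] by auto
  also have "\<dots> \<longleftrightarrow> d \<otimes> (g \<otimes> inv k) \<in> D"
    using assms by (simp add: m_assoc D.mem_carrier)
  also have "\<dots> \<longleftrightarrow> g \<otimes> inv k \<in> D"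
  proof
    assume "d \<otimes> (g \<otimes> inv k) \<in> D"
    then have "inv d \<otimes> (d \<otimes> (g \<otimes> inv k)) \<in> D" using assms by blast
    then show "g \<otimes> inv k \<in> D" using assms by (simp add: inv_mult_cancel D.mem_carrier)
  qed (use assms in auto)
  also have "\<dots> \<longleftrightarrow> g \<in> D #> k"
    using assms D.rcos_module[OF is_group, of k g] by auto
  finally show ?thesis .
qed

lemma point_diff_aug:
  assumes D: "subgroup D G" and d: "d \<in> D" and g: "g \<in> carrier G"
  shows "point (d \<otimes> g) - point g \<in> aug D q"
proof -
  have "d \<in> carrier G" using D d subgroup.mem_carrier by fastforce
  then show ?thesis
    using g mult_mem_rcos_iff[OF D d g]
    by (auto simp: aug_def fsupp_closed point_fsupp csum_diff finite_supp csum_point)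
qed

text \<open>As an abelian group, \<open>aug D q\<close> is generated by the two kinds of elements in the last two premises.\<close>

lemma aug_induct:
  assumes D: "subgroup D G" and f: "f \<in> aug D q" and V: "additive V"
    and diff: "\<And>d g. d \<in> D \<Longrightarrow> g \<in> carrier G \<Longrightarrow> point (d \<otimes> g) - point g \<in> V"
    and mult: "\<And>g. g \<in> carrier G \<Longrightarrow> scale q (point g) \<in> V"
  shows "f \<in> V"
  using f
proof (induction "card {x. f x \<noteq> 0}" arbitrary: f rule: less_induct)
  case less
  interpret D: subgroup D G by fact
  note fF = aug_fsupp[OF less.prems]
  have step: "f \<in> V" if "f' \<in> aug D q" "f - f' \<in> V" "f' g = 0" "f g \<noteq> 0"
    "\<And>x. f' x \<noteq> 0 \<Longrightarrow> f x \<noteq> 0" for f' g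
  proof -
    have "{x. f' x \<noteq> 0} \<subset> {x. f x \<noteq> 0}" using that by auto
    then have "f' \<in> V"
      using less.hyps[of f'] that(1) finite_supp[OF fF] psubset_card_mono by blast
    then show ?thesis
      using additive_closed(2)[OF V that(2), of f'] by simp
  qed
  show ?case
  proof (cases "f = 0")
    case True
    then show ?thesis using V by (simp add: additive_def)
  next
    case False
    then obtain g where g: "f g \<noteq> 0" by (auto simp: fun_eq_iff)
    then have gG: "g \<in> carrier G" using fF fsupp_carrier by blast
    show ?thesis
    proof (cases "\<exists>k. f k \<noteq> 0 \<and> k \<noteq> g \<and> k \<in> D #> g")
      case True
      then obtain k where k: "f k \<noteq> 0" "k \<noteq> g" "k \<in> D #> g" by blast
      then obtain d where d: "d \<in> D" "k = d \<otimes> g" by (auto simp: r_coset_def)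
      \<comment> \<open>The coefficient at \<open>g\<close> is moved to the support point
        \<open>k = d g\<close> of the same coset, which removes \<open>g\<close> from the support
        and adds no new point.\<close>
      define f' where "f' = f + scale (f g) (point (d \<otimes> g) - point g)"
      show ?thesis
      proof (rule step[of f' g])
        show "f' \<in> aug D q"
          unfolding f'_def
          by (rule aug_closed(2)[OF less.prems aug_closed(4)[OF point_diff_aug[OF D d(1) gG]]])
        have "- scale (f g) (point (d \<otimes> g) - point g) \<in> V"
          by (rule additive_closed(1)[OF V additive_closed(4)[OF V diff[OF d(1) gG]]])
        then show "f - f' \<in> V" by (simp add: f'_def)
        show "f' g = 0" "f g \<noteq> 0"
          using k d g by (auto simp: f'_def scale_def point_def)
        show "\<And>x. f' x \<noteq> 0 \<Longrightarrow> f x \<noteq> 0"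
          using k d g by (auto simp: f'_def scale_def point_def split: if_splits)
      qed
    next
      case False
      \<comment> \<open>Here \<open>g\<close> is the only support point in its coset, so its
        coefficient is the whole coset sum and hence a multiple of \<open>q\<close>.\<close>
      have "g \<in> D #> g" using rcos_self[OF gG D] .
      then have "csum f (D #> g) = sum f {g}"
        using False by (intro csum_eq_sum) auto
      then have "q dvd f g" using less.prems gG by (auto simp: aug_def)
      then obtain c where c: "f g = q * c" by (elim dvdE)
      define f' where "f' = f - scale c (scale q (point g))"
      show ?thesis
      proof (rule step[of f' g])
        have "scale q (point g) \<in> aug D q" by (intro scale_aug point_fsupp gG) simp
        then show "f' \<in> aug D q"
          unfolding f'_def by (rule aug_closed(3)[OF less.prems aug_closed(4)])
        have "scale c (scale q (point g)) \<in> V"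
          by (rule additive_closed(4)[OF V mult[OF gG]])
        then show "f - f' \<in> V" by (simp add: f'_def)
        show "f' g = 0" "f g \<noteq> 0"
          using c g by (auto simp: f'_def scale_def point_def)
        show "\<And>x. f' x \<noteq> 0 \<Longrightarrow> f x \<noteq> 0"
          using g by (auto simp: f'_def scale_def point_def split: if_splits)
      qed
    qed
  qed
qed

text \<open>For \<open>q = 1\<close> the divisibility condition is void and \<open>aug\<close> is
  the whole group ring, so its generation result applies.\<close>

lemma fsupp_induct:
  assumes f: "f \<in> fsupp" and V: "additive V" and point: "\<And>g. g \<in> carrier G \<Longrightarrow> point g \<in> V"
  shows "f \<in> V"
  using subgroup_self f[folded aug_1[of "carrier G"]] V
proof (rule aug_induct)
  show "scale 1 (point g) \<in> V" if "g \<in> carrier G" for g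
    using point[OF that] by (simp add: scale_def)
qed (use point additive_closed[OF V] in auto)

text \<open>Checked on generators. Splitting a coset of \<open>D'\<close> into cosets of
  \<open>D\<close> directly could produce infinitely many pieces.\<close>

lemma aug_mono:
  assumes "subgroup D G" "subgroup D' G" "D \<subseteq> D'" "q' dvd q"
  shows "aug D q \<subseteq> aug D' q'"
proof
  fix f assume "f \<in> aug D q"
  with assms(1) show "f \<in> aug D' q'"
    using additive_aug
    by (rule aug_induct) (use assms in \<open>auto intro: point_diff_aug scale_aug point_fsupp\<close>)
qed

lemma tr_diff: "tr b (f - g) = tr b f - tr b g"
  by (auto simp: tr_def fun_eq_iff)

lemma tr_add: "tr b (f + g) = tr b f + tr b g"
  by (auto simp: tr_def fun_eq_iff)

lemma tr_uminus: "tr b (- f) = - tr b f"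
  by (auto simp: tr_def fun_eq_iff)

lemma tr_zero: "tr b 0 = 0"
  by (auto simp: tr_def fun_eq_iff)

lemma tr_scale: "tr b (scale c f) = scale c (tr b f)"
  by (auto simp: tr_def scale_def fun_eq_iff)

lemma tr_sum: "tr b (sum h I) = (\<Sum>i\<in>I. tr b (h i))"
  using sum_comp_morphism[of "tr b" h I] by (simp add: tr_zero tr_add o_def)

lemma tr_one: "f \<in> fsupp \<Longrightarrow> tr \<one> f = f"
  by (auto simp: tr_def fun_eq_iff dest: fsupp_carrier)

lemma tr_tr: "b \<in> carrier G \<Longrightarrow> c \<in> carrier G \<Longrightarrow> tr b (tr c f) = tr (b \<otimes> c) f"
  by (auto simp: tr_def fun_eq_iff inv_mult_group m_assoc)

lemma tr_point:
  assumes "b \<in> carrier G" "g \<in> carrier G"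
  shows "tr b (point g) = point (b \<otimes> g)"
proof -
  have "inv b \<otimes> x = g \<longleftrightarrow> x = b \<otimes> g" if "x \<in> carrier G" for x
    using assms that by (metis inv_solve_left)
  then show ?thesis
    using assms by (auto simp: tr_def point_def fun_eq_iff)
qed

lemma additive_vimage_tr: "additive V \<Longrightarrow> additive {f. tr b f \<in> V}"
  by (auto simp: additive_def tr_zero tr_diff)

lemma tr_fsupp:
  assumes "b \<in> carrier G" "f \<in> fsupp"
  shows "tr b f \<in> fsupp"
proof -
  have "f \<in> {f. tr b f \<in> fsupp}"
    using assms(2) additive_vimage_tr[OF additive_fsupp]
    by (rule fsupp_induct) (simp add: tr_point point_fsupp assms(1))
  then show ?thesis by simp
qed

text \<open>For normal \<open>N\<close> the kernel is a two-sided ideal: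
  \<open>b (d g - g) = (b d b^-1) (b g) - b g\<close> is again a generator.\<close>

lemma tr_aug:
  assumes "N \<lhd> G" "b \<in> carrier G" "f \<in> aug N q"
  shows "tr b f \<in> aug N q"
proof -
  interpret N: normal N G by fact
  have "f \<in> {f. tr b f \<in> aug N q}"
    using N.is_subgroup assms(3) additive_vimage_tr[OF additive_aug]
  proof (rule aug_induct)
    fix d g assume d: "d \<in> N" and g: "g \<in> carrier G"
    have "point ((b \<otimes> d \<otimes> inv b) \<otimes> (b \<otimes> g)) - point (b \<otimes> g) \<in> aug N q"
      using assms d g by (intro point_diff_aug N.is_subgroup N.inv_op_closed2) auto
    moreover have "(b \<otimes> d \<otimes> inv b) \<otimes> (b \<otimes> g) = b \<otimes> (d \<otimes> g)"
      using assms d g by (simp add: m_assoc inv_mult_cancel)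
    ultimately show "point (d \<otimes> g) - point g \<in> {f. tr b f \<in> aug N q}"
      using assms d g by (simp add: tr_diff tr_point)
  next
    fix g assume "g \<in> carrier G"
    then show "scale q (point g) \<in> {f. tr b f \<in> aug N q}"
      using assms by (simp add: tr_scale tr_point scale_aug point_fsupp)
  qed
  then show ?thesis by simp
qed

text \<open>Left multiplication by \<open>d\<close> permutes every right coset of \<open>D\<close>,
  so no coset sum changes.\<close>

lemma tr_diff_aug:
  assumes D: "subgroup D G" and d: "d \<in> D" and f: "f \<in> fsupp"
  shows "tr d f - f \<in> aug D q"
proof -
  have dG: "d \<in> carrier G" using D d subgroup.mem_carrier by fastforce
  have "additive {f. tr d f - f \<in> aug D q}"
    unfolding additive_def
  proof (intro conjI ballI)
    show "0 \<in> {f. tr d f - f \<in> aug D q}" by (simp add: tr_zero zero_aug)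
    fix f g assume "f \<in> {f. tr d f - f \<in> aug D q}" "g \<in> {f. tr d f - f \<in> aug D q}"
    then have "(tr d f - f) - (tr d g - g) \<in> aug D q" by (auto intro: aug_closed(3))
    then show "f - g \<in> {f. tr d f - f \<in> aug D q}" by (simp add: tr_diff algebra_simps)
  qed
  with f have "f \<in> {f. tr d f - f \<in> aug D q}"
    by (rule fsupp_induct) (use D d dG in \<open>simp add: tr_point point_diff_aug\<close>)
  then show ?thesis by simp
qed

lemma diff_tr_aug:
  assumes "subgroup D G" "d \<in> D" "f \<in> fsupp"
  shows "f - tr d f \<in> aug D q"
  using aug_closed(1)[OF tr_diff_aug[OF assms]] by simp

text \<open>There may be no action on the quotient by \<open>V\<close>: the lemma is applied to
  \<open>cobound b U\<close>, which left translation does not preserve in general. As the condition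
  ranges over all of \<open>fsupp\<close>, translates of \<open>f\<close> can be inserted
  instead.\<close>

lemma trivial_action_subgroup:
  assumes V: "additive V"
  shows "subgroup {a \<in> carrier G. \<forall>f\<in>fsupp. tr a f - f \<in> V} G"
proof (rule subgroupI)
  have "\<one> \<in> {a \<in> carrier G. \<forall>f\<in>fsupp. tr a f - f \<in> V}"
    using V by (auto simp: tr_one additive_def)
  then show "{a \<in> carrier G. \<forall>f\<in>fsupp. tr a f - f \<in> V} \<noteq> {}" by blast
next
  fix a assume a: "a \<in> {a \<in> carrier G. \<forall>f\<in>fsupp. tr a f - f \<in> V}"
  have "tr (inv a) f - f \<in> V" if f: "f \<in> fsupp" for f
  proof -
    have "tr a (tr (inv a) f) - tr (inv a) f \<in> V" using a f by (simp add: tr_fsupp)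
    moreover have "tr a (tr (inv a) f) = f" using a f by (simp add: tr_tr tr_one)
    ultimately show ?thesis using additive_closed(1)[OF V, of "f - tr (inv a) f"] by simp
  qed
  then show "inv a \<in> {a \<in> carrier G. \<forall>f\<in>fsupp. tr a f - f \<in> V}" using a by simp
  fix b assume b: "b \<in> {a \<in> carrier G. \<forall>f\<in>fsupp. tr a f - f \<in> V}"
  have "tr (a \<otimes> b) f - f \<in> V" if f: "f \<in> fsupp" for f
  proof -
    have "(tr a (tr b f) - tr b f) + (tr b f - f) \<in> V"
      using a b f by (intro additive_closed(2)[OF V]) (auto simp: tr_fsupp)
    then show ?thesis using a b by (simp add: tr_tr)
  qed
  then show "a \<otimes> b \<in> {a \<in> carrier G. \<forall>f\<in>fsupp. tr a f - f \<in> V}" using a b by simp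
qed auto

text \<open>\<open>cobound b U\<close> is the image of \<open>U\<close> under multiplication by \<open>1 - b\<close>.\<close>

definition cobound :: "'a \<Rightarrow> ('a \<Rightarrow> int) set \<Rightarrow> ('a \<Rightarrow> int) set"
  where "cobound b U = (\<lambda>u. u - tr b u) ` U"

lemma coboundI: "u \<in> U \<Longrightarrow> f = u - tr b u \<Longrightarrow> f \<in> cobound b U"
  by (simp add: cobound_def)

lemma additive_cobound:
  assumes "additive U" shows "additive (cobound b U)"
  unfolding additive_def
proof (intro conjI ballI)
  show "0 \<in> cobound b U"
    using assms by (auto simp: cobound_def additive_def tr_zero intro!: image_eqI[of _ _ 0])
  fix f g assume "f \<in> cobound b U" "g \<in> cobound b U"
  then obtain u v where "u \<in> U" "v \<in> U" "f = u - tr b u" "g = v - tr b v"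
    by (auto simp: cobound_def)
  then show "f - g \<in> cobound b U"
    using additive_closed(3)[OF assms, of u v]
    by (auto simp: cobound_def tr_diff algebra_simps intro!: image_eqI[of _ _ "u - v"])
qed

text \<open>Modulo the multiples of \<open>1 - b\<close> the element \<open>b\<close> acts
  trivially, hence so does \<open>\<langle>b\<rangle>\<close>, and all generators
  \<open>d g - g\<close> vanish. Thus zero sums over the cosets of
  \<open>\<langle>b\<rangle>\<close> already yield a preimage under \<open>1 - b\<close>.\<close>

lemma aug_cyclic_eq_cobound:
  assumes b: "b \<in> carrier G"
  shows "aug (generate G {b}) 0 = cobound b fsupp"
proof (intro equalityI subsetI)
  have sub: "subgroup (generate G {b}) G" using b by (intro generate_is_subgroup) auto
  fix f assume f: "f \<in> aug (generate G {b}) 0"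
  let ?S = "{a \<in> carrier G. \<forall>f\<in>fsupp. tr a f - f \<in> cobound b fsupp}"
  have "b \<in> ?S"
  proof -
    have "tr b f - f \<in> cobound b fsupp" if "f \<in> fsupp" for f
      using fsupp_closed(1)[OF that]
      by (auto simp: cobound_def tr_uminus intro!: image_eqI[of _ _ "- f"])
    then show ?thesis using b by simp
  qed
  then have gen: "generate G {b} \<subseteq> ?S"
    using trivial_action_subgroup[OF additive_cobound[OF additive_fsupp]]
    by (intro generate_subgroup_incl) auto
  show "f \<in> cobound b fsupp"
    using sub f additive_cobound[OF additive_fsupp]
  proof (rule aug_induct)
    fix d g assume "d \<in> generate G {b}" "g \<in> carrier G"
    then show "point (d \<otimes> g) - point g \<in> cobound b fsupp"
      using gen point_fsupp by (force simp flip: tr_point)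
  next
    fix g :: 'a
    have "scale 0 (point g) = 0" by (simp add: scale_def fun_eq_iff)
    then show "scale 0 (point g) \<in> cobound b fsupp"
      using additive_cobound[OF additive_fsupp] by (simp add: additive_def)
  qed
next
  fix f assume "f \<in> cobound b fsupp"
  then show "f \<in> aug (generate G {b}) 0"
    using b diff_tr_aug[of "generate G {b}" b]
    by (auto simp: cobound_def generate.incl intro: generate_is_subgroup)
qed


subsection \<open>Separation in finite quotients\<close>

lemma mem_rcos_iff:
  assumes "subgroup D G" "x \<in> carrier G" "g \<in> carrier G"
  shows "x \<in> D #> g \<longleftrightarrow> x \<otimes> inv g \<in> D"
  using subgroup.rcos_module[OF assms(1) is_group assms(3,2)] .

lemma rcos_carrier: "subgroup D G \<Longrightarrow> g \<in> carrier G \<Longrightarrow> x \<in> D #> g \<Longrightarrow> x \<in> carrier G"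
  using r_coset_subset_G subgroup.subset by blast

lemma csum_tr:
  assumes a: "a \<in> carrier G" and f: "f \<in> fsupp"
  shows "csum (tr a f) S = csum f {x \<in> carrier G. a \<otimes> x \<in> S}"
proof -
  let ?V = "{f \<in> fsupp. csum (tr a f) S = csum f {x \<in> carrier G. a \<otimes> x \<in> S}}"
  have "additive ?V"
    unfolding additive_def
  proof (intro conjI ballI)
    show "0 \<in> ?V" using zero_fsupp by (simp add: tr_zero csum_def)
    fix f g assume "f \<in> ?V" "g \<in> ?V"
    then show "f - g \<in> ?V"
      using a by (simp add: tr_diff csum_diff finite_supp tr_fsupp fsupp_closed(3))
  qed
  with f have "f \<in> ?V"
    by (rule fsupp_induct) (use a in \<open>auto simp: tr_point csum_point point_fsupp\<close>)
  then show ?thesis by simp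
qed

text \<open>As \<open>a\<close> normalises \<open>D\<close>, left multiplication by it carries
  \<open>D s\<close> onto \<open>D a s\<close>. Besides normal subgroups, this serves for
  \<open>D = N \<langle>b\<rangle>\<close> and \<open>a\<close> commuting with
  \<open>b\<close>.\<close>

lemma csum_tr_rcos:
  assumes D: "subgroup D G" and a: "a \<in> carrier G" and s: "s \<in> carrier G" and f: "f \<in> fsupp"
    and n1: "\<And>d. d \<in> D \<Longrightarrow> a \<otimes> d \<otimes> inv a \<in> D" and n2: "\<And>d. d \<in> D \<Longrightarrow> inv a \<otimes> d \<otimes> a \<in> D"
  shows "csum (tr a f) (D #> (a \<otimes> s)) = csum f (D #> s)"
proof -
  have "{x \<in> carrier G. a \<otimes> x \<in> D #> (a \<otimes> s)} = D #> s"
  proof (intro equalityI subsetI)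
    fix x assume "x \<in> {x \<in> carrier G. a \<otimes> x \<in> D #> (a \<otimes> s)}"
    then have x: "x \<in> carrier G" "(a \<otimes> x) \<otimes> inv (a \<otimes> s) \<in> D"
      using D a s by (auto simp: mem_rcos_iff)
    have "inv a \<otimes> ((a \<otimes> x) \<otimes> inv (a \<otimes> s)) \<otimes> a \<in> D" by (rule n2[OF x(2)])
    also have "inv a \<otimes> ((a \<otimes> x) \<otimes> inv (a \<otimes> s)) \<otimes> a = x \<otimes> inv s"
      using x a s by (simp add: m_assoc inv_mult_group inv_mult_cancel)
    finally show "x \<in> D #> s" using D x s by (simp add: mem_rcos_iff)
  next
    fix x assume "x \<in> D #> s"
    then have x: "x \<in> carrier G" "x \<otimes> inv s \<in> D"
      using rcos_carrier[OF D s] mem_rcos_iff[OF D _ s] by blast+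
    have "a \<otimes> (x \<otimes> inv s) \<otimes> inv a \<in> D" by (rule n1[OF x(2)])
    also have "a \<otimes> (x \<otimes> inv s) \<otimes> inv a = (a \<otimes> x) \<otimes> inv (a \<otimes> s)"
      using x a s by (simp add: m_assoc inv_mult_group)
    finally show "x \<in> {x \<in> carrier G. a \<otimes> x \<in> D #> (a \<otimes> s)}" using D x a s by (simp add: mem_rcos_iff)
  qed
  then show ?thesis using csum_tr[OF a f] by simp
qed

lemma csum_tr_normal:
  assumes "N \<lhd> G" "a \<in> carrier G" "s \<in> carrier G" "f \<in> fsupp"
  shows "csum (tr a f) (N #> (a \<otimes> s)) = csum f (N #> s)"
proof -
  interpret N: normal N G by fact
  show ?thesis
    using assms by (intro csum_tr_rcos N.is_subgroup N.inv_op_closed1 N.inv_op_closed2) auto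
qed

lemma mem_mult_cyclic:
  assumes N: "subgroup N G" and b: "b \<in> carrier G" and x: "x \<in> carrier G"
  shows "x \<in> N <#> generate G {b} \<longleftrightarrow> (\<exists>i::int. x \<otimes> inv (b [^] i) \<in> N)"
proof
  assume "x \<in> N <#> generate G {b}"
  then obtain n i where "n \<in> N" "x = n \<otimes> b [^] (i::int)"
    using b by (auto simp: set_mult_def generate_pow)
  moreover have "n \<in> carrier G" using N \<open>n \<in> N\<close> subgroup.mem_carrier by fastforce
  ultimately have "x \<otimes> inv (b [^] i) \<in> N" using b by (simp add: m_assoc)
  then show "\<exists>i::int. x \<otimes> inv (b [^] i) \<in> N" ..
next
  assume "\<exists>i::int. x \<otimes> inv (b [^] i) \<in> N"
  then obtain i :: int where i: "x \<otimes> inv (b [^] i) \<in> N" ..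
  have "x = (x \<otimes> inv (b [^] i)) \<otimes> b [^] i" using b x by (simp add: m_assoc)
  then show "x \<in> N <#> generate G {b}"
    using i b by (auto simp: set_mult_def generate_pow)
qed

lemma subgroup_mult_cyclic: "N \<lhd> G \<Longrightarrow> b \<in> carrier G \<Longrightarrow> subgroup (N <#> generate G {b}) G"
  by (intro mult_norm_subgroup generate_is_subgroup) auto

lemma cyclic_subset_mult: 
  assumes "subgroup N G" "b \<in> carrier G" shows "generate G {b} \<subseteq> N <#> generate G {b}"
proof
  fix x assume x: "x \<in> generate G {b}"
  then have "x \<in> carrier G" using assms generate_in_carrier[of "{b}"] by auto
  then show "x \<in> N <#> generate G {b}"
    using x subgroup.one_closed[OF assms(1)] by (force simp: set_mult_def)
qed

lemma normal_subset_mult: 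
  assumes "subgroup N G" "b \<in> carrier G" shows "N \<subseteq> N <#> generate G {b}"
proof
  fix x assume x: "x \<in> N"
  then have "x \<in> carrier G" using assms subgroup.subset by blast
  then show "x \<in> N <#> generate G {b}"
    using x generate.one[of G "{b}"] by (force simp: set_mult_def)
qed

lemma separate_cyclic:
  assumes css: "cyclic_subgroup_separable G" and b: "b \<in> carrier G" and h: "h \<in> carrier G"
    and "h \<notin> generate G {b}"
  shows "\<exists>N. fin_normal G N \<and> h \<notin> N <#> generate G {b}"
proof -
  have "\<forall>i::int. h \<noteq> b [^] i" using assms by (auto simp: generate_pow)
  then obtain N where "fin_normal G N" "\<forall>i::int. h \<otimes> inv (b [^] i) \<notin> N"
    using css b h unfolding cyclic_subgroup_separable_iff by blast
  then show ?thesis using b h fin_normalD(2) by (auto simp: mem_mult_cyclic)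
qed

text \<open>Residual finiteness, from the trivial cyclic subgroup.\<close>

lemma separate_one:
  assumes css: "cyclic_subgroup_separable G" and h: "h \<in> carrier G" "h \<noteq> \<one>"
  shows "\<exists>N. fin_normal G N \<and> h \<notin> N"
proof -
  obtain N where "fin_normal G N" "h \<notin> N <#> generate G {\<one>}"
    using separate_cyclic[OF css one_closed h(1)] h(2) generate_one by auto
  then show ?thesis using normal_subset_mult[of N \<one>] fin_normalD(2) by blast
qed

text \<open>Only the finitely many support points outside \<open>\<langle>b\<rangle> s\<close> have
  to be kept out of \<open>N \<langle>b\<rangle> s\<close>. The conclusion covers all smaller
  \<open>M\<close>, so that several such choices can be intersected.\<close>

lemma separate_support:
  assumes css: "cyclic_subgroup_separable G" and b: "b \<in> carrier G" and s: "s \<in> carrier G"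
    and f: "f \<in> fsupp"
  obtains N where "fin_normal G N"
    "\<And>M. fin_normal G M \<Longrightarrow> M \<subseteq> N \<Longrightarrow> csum f ((M <#> generate G {b}) #> s) = csum f (generate G {b} #> s)"
proof -
  let ?C = "generate G {b}"
  have C: "subgroup ?C G" using b by (intro generate_is_subgroup) auto
  have "\<exists>N. fin_normal G N \<and> (\<forall>t\<in>{x. f x \<noteq> 0}. t \<in> (N <#> ?C) #> s \<longrightarrow> t \<in> ?C #> s)"
  proof (rule fin_normal_common[OF finite_supp[OF f]])
    fix t assume "t \<in> {x. f x \<noteq> 0}"
    then have t: "t \<in> carrier G" using fsupp_carrier[OF f] by blast
    show "\<exists>N. fin_normal G N \<and> (t \<in> (N <#> ?C) #> s \<longrightarrow> t \<in> ?C #> s)"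
    proof (cases "t \<otimes> inv s \<in> ?C")
      case True
      then show ?thesis using fin_normal_carrier t s C by (auto simp: mem_rcos_iff)
    next
      case False
      then obtain N where "fin_normal G N" "t \<otimes> inv s \<notin> N <#> ?C"
        using separate_cyclic[OF css b] t s by blast
      then show ?thesis
        using t s mem_rcos_iff[OF subgroup_mult_cyclic[OF _ b], of N t s] fin_normalD(1) by blast
    qed
  next
    fix t N M assume "t \<in> (N <#> ?C) #> s \<longrightarrow> t \<in> ?C #> s" "M \<subseteq> N"
    then show "t \<in> (M <#> ?C) #> s \<longrightarrow> t \<in> ?C #> s"
      by (auto simp: set_mult_def r_coset_def)
  qed
  then obtain N where N: "fin_normal G N"
    "\<And>t. f t \<noteq> 0 \<Longrightarrow> t \<in> (N <#> ?C) #> s \<Longrightarrow> t \<in> ?C #> s" by blast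
  show ?thesis
  proof (rule that[OF N(1)])
    fix M assume M: "fin_normal G M" "M \<subseteq> N"
    show "csum f ((M <#> ?C) #> s) = csum f (?C #> s)"
    proof (rule csum_cong)
      fix x assume x: "f x \<noteq> 0"
      have "x \<in> (N <#> ?C) #> s" if "x \<in> (M <#> ?C) #> s"
        using that M(2) by (auto simp: set_mult_def r_coset_def)
      moreover have "x \<in> (M <#> ?C) #> s" if "x \<in> ?C #> s"
        using that cyclic_subset_mult[OF fin_normalD(2)[OF M(1)] b] by (auto simp: r_coset_def)
      ultimately show "x \<in> (M <#> ?C) #> s \<longleftrightarrow> x \<in> ?C #> s" using N(2)[OF x] by blast
    qed
  qed
qed

section \<open>Powers and norm elements modulo a finite-index normal subgroup\<close>

lemma fin_normal_pow:
  assumes "fin_normal G N"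
  obtains k :: nat where "k > 0" "\<And>x. x \<in> carrier G \<Longrightarrow> x [^] k \<in> N"
proof -
  interpret N: normal N G using assms by (rule fin_normalD)
  interpret Q: group "G Mod N" by (rule N.factorgroup_is_group)
  have fin: "finite (carrier (G Mod N))"
    using assms by (simp add: fin_normal_def finite_index_def FactGroup_def)
  show ?thesis
  proof
    show "order (G Mod N) > 0" using fin Q.order_gt_0_iff_finite by simp
    fix x assume x: "x \<in> carrier G"
    then have "(N #> x) [^]\<^bsub>G Mod N\<^esub> order (G Mod N) = \<one>\<^bsub>G Mod N\<^esub>"
      by (intro Q.pow_order_eq_1) (auto simp: carrier_FactGroup)
    then have "N #> (x [^] order (G Mod N)) = N"
      using N.FactGroup_pow[OF x] by simp
    then show "x [^] order (G Mod N) \<in> N"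
      using rcos_self[of "x [^] order (G Mod N)" N] x N.is_subgroup by auto
  qed
qed

text \<open>This prescribes a divisor of the order of \<open>b\<close> modulo \<open>N\<close>.
  Infinite order keeps \<open>b^j\<close> with \<open>0 < j < m\<close> out of
  \<open>\<langle>b^m\<rangle>\<close>, so these can be kept out of
  \<open>N \<langle>b^m\<rangle>\<close> as well; but \<open>b^k\<close> in \<open>N\<close> puts
  \<open>b^(k mod m)\<close> there.\<close>

lemma separate_powers:
  assumes css: "cyclic_subgroup_separable G" and b: "b \<in> carrier G"
    and inf: "\<And>k::nat. k > 0 \<Longrightarrow> b [^] k \<noteq> \<one>" and m: "m > 0"
  obtains N where "fin_normal G N" "\<And>k::nat. b [^] k \<in> N \<Longrightarrow> m dvd k"
proof -
  let ?C = "generate G {b [^] m}"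
  have "\<exists>N. fin_normal G N \<and> (\<forall>j\<in>{0<..<m}. b [^] j \<notin> N <#> ?C)"
  proof (rule fin_normal_common)
    fix j assume j: "j \<in> {0<..<m}"
    have "b [^] j \<notin> ?C"
    proof
      assume "b [^] j \<in> ?C"
      then obtain i :: int where "b [^] j = (b [^] m) [^] i" using b by (auto simp: generate_pow)
      then have "b [^] int j = b [^] (int m * i)"
        using b by (metis int_pow_int int_pow_pow)
      then have "b [^] (int j - int m * i) = \<one>"
        using b by (simp add: int_pow_diff)
      moreover have nz: "int j - int m * i \<noteq> 0"
        using j by (metis diff_eq_diff_eq dvd_triv_left eq_iff_diff_eq_0 greaterThanLessThan_iff int_dvd_int_iff nat_dvd_not_less)
      ultimately have "b [^] nat \<bar>int j - int m * i\<bar> = \<one>"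
        using b by (metis abs_if int_pow_neg inv_one int_nat_eq int_pow_int abs_ge_zero int_pow_closed)
      then show False using inf[of "nat \<bar>int j - int m * i\<bar>"] nz by simp
    qed
    then show "\<exists>N. fin_normal G N \<and> b [^] j \<notin> N <#> ?C"
      using b by (intro separate_cyclic[OF css]) auto
  next
    fix j N M assume "b [^] j \<notin> N <#> ?C" "M \<subseteq> N"
    then show "b [^] j \<notin> M <#> ?C" by (auto simp: set_mult_def)
  qed auto
  then obtain N where N: "fin_normal G N" "\<And>j. j \<in> {0<..<m} \<Longrightarrow> b [^] j \<notin> N <#> ?C" by blast
  show ?thesis
  proof (rule that[OF N(1)])
    fix k :: nat assume k: "b [^] k \<in> N"
    show "m dvd k"
    proof (rule ccontr)
      assume "\<not> m dvd k"
      then have "k mod m \<in> {0<..<m}" using m by (auto simp: dvd_eq_mod_eq_0)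
      moreover have "b [^] (k mod m) \<otimes> inv ((b [^] m) [^] (- int (k div m))) \<in> N"
      proof -
        have "(b [^] m) [^] (- int (k div m)) = inv (b [^] (m * (k div m)))"
          using b by (simp add: int_pow_neg int_pow_int nat_pow_pow)
        then have "b [^] (k mod m) \<otimes> inv ((b [^] m) [^] (- int (k div m))) = b [^] (k mod m) \<otimes> b [^] (m * (k div m))"
          using b by simp
        also have "\<dots> = b [^] k" using b by (simp add: nat_pow_mult)
        finally show ?thesis using k by simp
      qed
      then have "b [^] (k mod m) \<in> N <#> ?C"
        using b mem_mult_cyclic[OF fin_normalD(2)[OF N(1)], of "b [^] m" "b [^] (k mod m)"] by auto
      ultimately show False using N(2) by blast
    qed
  qed
qed

text \<open>The sum \<open>1 + b + ... + b^(p m - 1)\<close> falls into \<open>m\<close> blocks of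
  length \<open>p\<close>. These agree modulo \<open>N\<close>, because \<open>b^p\<close> acts
  trivially there, so the total is \<open>m\<close> times the first block.\<close>

lemma tr_sum_aug:
  assumes N: "N \<lhd> G" and b: "b \<in> carrier G" and p: "b [^] (p::nat) \<in> N" and f: "f \<in> fsupp"
    and q: "q dvd int m"
  shows "(\<Sum>l<p * m. tr (b [^] l) f) \<in> aug N q"
proof -
  let ?h = "\<Sum>l<p. tr (b [^] l) f"
  interpret N: normal N G by fact
  have hF: "tr (b [^] l) f \<in> fsupp" for l :: nat using b f by (simp add: tr_fsupp)
  have hF': "?h \<in> fsupp" by (intro additive_sum additive_fsupp hF)
  have "(\<Sum>l<p * m. tr (b [^] l) f) - scale (int m) ?h \<in> aug N q"
  proof (induction m)
    case 0
    have "(\<Sum>l<p * 0. tr (b [^] l) f) - scale (int 0) ?h = 0"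
      by (auto simp: scale_def fun_eq_iff)
    then show ?case using zero_aug by metis
  next
    case (Suc m)
    have "b [^] (p * m) \<in> N"
      using subgroup_int_pow_closed[OF N.is_subgroup p, of "int m"] b
      by (simp add: int_pow_int nat_pow_pow)
    then have "tr (b [^] (p * m)) ?h - ?h \<in> aug N q"
      using tr_diff_aug[OF N.is_subgroup _ hF'] by blast
    then have "((\<Sum>l<p * m. tr (b [^] l) f) - scale (int m) ?h) + (tr (b [^] (p * m)) ?h - ?h) \<in> aug N q"
      using Suc aug_closed(2) by blast
    moreover have "tr (b [^] (p * m)) ?h = (\<Sum>l\<in>{p * m..<p * m + p}. tr (b [^] l) f)"
    proof -
      have "tr (b [^] (p * m)) ?h = (\<Sum>l<p. tr (b [^] (p * m + l)) f)"
        using b unfolding tr_sum by (intro sum.cong refl) (simp add: tr_tr nat_pow_mult)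
      also have "\<dots> = (\<Sum>l\<in>{p * m..<p * m + p}. tr (b [^] l) f)"
        by (rule sum.reindex_bij_witness[of _ "\<lambda>l. l - p * m" "\<lambda>l. p * m + l"]) auto
      finally show ?thesis .
    qed
    moreover have "(\<Sum>l<p * Suc m. tr (b [^] l) f)
        = (\<Sum>l<p * m. tr (b [^] l) f) + (\<Sum>l\<in>{p * m..<p * m + p}. tr (b [^] l) f)"
    proof -
      have eq: "{..<p * Suc m} = {..<p * m} \<union> {p * m..<p * m + p}" by auto
      show ?thesis unfolding eq by (rule sum.union_disjoint) auto
    qed
    moreover have "scale (int (Suc m)) ?h = scale (int m) ?h + ?h"
      by (simp add: scale_def fun_eq_iff algebra_simps)
    moreover have "(A + T) - (S + h) = (A - S) + (T - h)" for A S T h :: "'a \<Rightarrow> int"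
      by (simp add: algebra_simps)
    ultimately have "(\<Sum>l<p * Suc m. tr (b [^] l) f) - scale (int (Suc m)) ?h \<in> aug N q"
      by metis
    then show ?case .
  qed
  from aug_closed(2)[OF this scale_aug[OF hF' q]] show ?thesis by simp
qed


section \<open>Closedness of the set of multiples of \<open>1 - b\<close> by elements of
  \<open>U\<close>\<close>

lemma diff_tr_pow_aug:
  assumes N: "N \<lhd> G" and b: "b \<in> carrier G" and v: "v \<in> fsupp" and inv: "v - tr b v \<in> aug N r"
  shows "v - tr (b [^] (i::nat)) v \<in> aug N r"
proof (induction i)
  case 0
  have "v - tr (b [^] (0::nat)) v = 0" using v by (simp add: tr_one)
  then show ?case using zero_aug by metis
next
  case (Suc i)
  have "tr (b [^] i) (v - tr b v) \<in> aug N r" using N b inv by (intro tr_aug) auto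
  then have "tr (b [^] i) v - tr (b [^] i) (tr b v) \<in> aug N r"
    by (simp add: tr_diff)
  moreover have "v - tr (b [^] i) v \<in> aug N r" using Suc .
  ultimately have "(v - tr (b [^] i) v) + (tr (b [^] i) v - tr (b [^] i) (tr b v)) \<in> aug N r"
    using aug_closed(2) by blast
  then have "v - tr (b [^] Suc i) v \<in> aug N r"
    using b by (simp add: tr_tr)
  then show ?case .
qed

text \<open>Modulo \<open>q\<close>, all the \<open>k\<close> cosets of \<open>N\<close> inside a coset of \<open>\<langle>a\<rangle>N\<close> contribute the same sum,
  and \<open>q\<close> divides \<open>k\<close>.\<close>

lemma diff_tr_aug_imp_aug:
  assumes N0: "subgroup N\<^sub>0 G" and N: "N \<lhd> G" "N \<subseteq> N\<^sub>0" and a: "a \<in> N\<^sub>0" and v: "v \<in> fsupp"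
    and inv: "v - tr a v \<in> aug N r" and k: "a [^] (k::nat) \<in> N" "k > 0"
    and least: "\<And>j::nat. 0 < j \<Longrightarrow> j < k \<Longrightarrow> a [^] j \<notin> N" and q: "q dvd r" "q dvd int k"
  shows "v \<in> aug N\<^sub>0 q"
proof -
  interpret N: normal N G by fact
  have aG: "a \<in> carrier G" using N0 a subgroup.mem_carrier by fastforce
  let ?D = "N <#> generate G {a}"
  have D: "subgroup ?D G" using N(1) aG by (rule subgroup_mult_cyclic)
  have DN0: "?D \<subseteq> N\<^sub>0"
  proof -
    have "generate G {a} \<subseteq> N\<^sub>0" using a N0 by (intro generate_subgroup_incl) auto
    then show ?thesis
      using N(2) subgroup.m_closed[OF N0] by (auto simp: set_mult_def)
  qed
  have "q dvd csum v (?D #> g)" if g: "g \<in> carrier G" for g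
  proof -
    have mem: "x \<in> N #> (a [^] (i::nat) \<otimes> g) \<longleftrightarrow> x \<otimes> inv g \<otimes> inv (a [^] i) \<in> N"
      if "x \<in> carrier G" for x i
      using that aG g by (simp add: mem_rcos_iff N.is_subgroup inv_mult_group m_assoc)
    \<comment> \<open>\<open>k\<close> is the exact order of \<open>a\<close> modulo
      \<open>N\<close>, so a coset of \<open>N \<langle>a\<rangle>\<close> is the disjoint union of
      \<open>k\<close> cosets of \<open>N\<close>, one for each exponent below
      \<open>k\<close>.\<close>
    have "?D #> g = (\<Union>i<k. N #> (a [^] i \<otimes> g))"
    proof (intro equalityI subsetI)
      fix x assume x: "x \<in> ?D #> g"
      then have xG: "x \<in> carrier G" using rcos_carrier[OF D g] by blast
      then have "x \<otimes> inv g \<in> ?D" using x D g mem_rcos_iff by blast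
      then obtain i :: int where i: "x \<otimes> inv g \<otimes> inv (a [^] i) \<in> N"
        using mem_mult_cyclic[OF N.is_subgroup aG] xG g by auto
      define j where "j = nat (i mod int k)"
      define c where "c = a [^] (int k * (i div int k))"
      have c: "c \<in> N" "c \<in> carrier G"
        using subgroup_int_pow_closed[OF N.is_subgroup k(1), of "i div int k"] aG
        by (simp_all add: c_def int_pow_pow flip: int_pow_int)
      have "int j = i mod int k" using k(2) by (simp add: j_def)
      then have "i = int k * (i div int k) + int j" by simp
      then have "a [^] i = c \<otimes> a [^] j"
        unfolding c_def using aG by (metis int_pow_int int_pow_mult)
      then have "x \<otimes> inv g \<otimes> inv (a [^] i) \<otimes> c = x \<otimes> inv g \<otimes> inv (a [^] j)"
        using xG g aG c by (simp add: inv_mult_group m_assoc)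
      then have "x \<otimes> inv g \<otimes> inv (a [^] j) \<in> N"
        using N.m_closed[OF i c(1)] by simp
      moreover have "j < k" using k(2) by (simp add: j_def nat_less_iff)
      ultimately show "x \<in> (\<Union>i<k. N #> (a [^] i \<otimes> g))" using mem[OF xG] by blast
    next
      fix x assume "x \<in> (\<Union>i<k. N #> (a [^] i \<otimes> g))"
      then obtain i :: nat where i: "x \<in> N #> (a [^] i \<otimes> g)" by auto
      then have xG: "x \<in> carrier G" using rcos_carrier[OF N.is_subgroup] aG g by blast
      have "x \<otimes> inv g \<otimes> inv (a [^] int i) \<in> N" using i mem[OF xG] by (simp add: int_pow_int)
      then have "x \<otimes> inv g \<in> ?D"
        using mem_mult_cyclic[OF N.is_subgroup aG, of "x \<otimes> inv g"] xG g by blast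
      then show "x \<in> ?D #> g" using mem_rcos_iff[OF D xG g] by blast
    qed
    moreover have "csum v (\<Union>i\<in>{..<k}. N #> (a [^] i \<otimes> g)) = (\<Sum>i<k. csum v (N #> (a [^] i \<otimes> g)))"
    proof (rule csum_UN_disjoint[OF finite_supp[OF v]])
      have "(N #> (a [^] i \<otimes> g)) \<inter> (N #> (a [^] j \<otimes> g)) = {}" if ij: "i < j" "j < k" for i j
      proof (rule ccontr)
        assume "(N #> (a [^] i \<otimes> g)) \<inter> (N #> (a [^] j \<otimes> g)) \<noteq> {}"
        then obtain x where x: "x \<in> N #> (a [^] i \<otimes> g)" "x \<in> N #> (a [^] j \<otimes> g)" by blast
        then have xG: "x \<in> carrier G" using rcos_carrier[OF N.is_subgroup] aG g by blast
        have "inv (x \<otimes> inv g \<otimes> inv (a [^] j)) \<otimes> (x \<otimes> inv g \<otimes> inv (a [^] i)) \<in> N"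
          using x mem[OF xG] by auto
        also have "inv (x \<otimes> inv g \<otimes> inv (a [^] j)) \<otimes> (x \<otimes> inv g \<otimes> inv (a [^] i)) = a [^] j \<otimes> inv (a [^] i)"
          using xG g aG by (simp add: inv_mult_group m_assoc inv_mult_cancel)
        also have "a [^] j \<otimes> inv (a [^] i) = a [^] (j - i)"
          using ij aG inv_solve_right[of "a [^] (j - i)" "a [^] j" "a [^] i"] by (simp add: nat_pow_mult)
        finally show False using least[of "j - i"] ij by simp
      qed
      then show "(N #> (a [^] i \<otimes> g)) \<inter> (N #> (a [^] j \<otimes> g)) = {}"
        if "i \<in> {..<k}" "j \<in> {..<k}" "i \<noteq> j" for i j
        using that by (metis Int_commute lessThan_iff linorder_neqE_nat)
    qed auto
    moreover have "q dvd csum v (N #> (a [^] i \<otimes> g)) - csum v (N #> g)" for i :: nat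
    proof -
      have "v - tr (a [^] i) v \<in> aug N r" by (rule diff_tr_pow_aug[OF N(1) aG v inv])
      then have "r dvd csum (v - tr (a [^] i) v) (N #> (a [^] i \<otimes> g))"
        using aG g by (auto simp: aug_def)
      also have "csum (v - tr (a [^] i) v) (N #> (a [^] i \<otimes> g)) = csum v (N #> (a [^] i \<otimes> g)) - csum v (N #> g)"
        using aG g v N(1) by (simp add: csum_diff finite_supp tr_fsupp csum_tr_normal)
      finally show ?thesis using q(1) dvd_trans by blast
    qed
    then have "q dvd (\<Sum>i<k. csum v (N #> (a [^] i \<otimes> g)) - csum v (N #> g))"
      by (intro dvd_sum)
    then have "q dvd (\<Sum>i<k. csum v (N #> (a [^] i \<otimes> g))) - int k * csum v (N #> g)"
      by (simp add: sum_subtractf)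
    then have "q dvd (\<Sum>i<k. csum v (N #> (a [^] i \<otimes> g)))"
      using q(2) by (metis dvd_diff_commute dvd_mult2 dvd_diffD1 diff_add_cancel dvd_add)
    ultimately show ?thesis by simp
  qed
  then have "v \<in> aug ?D q" using v by (simp add: aug_def)
  then show ?thesis using aug_mono[OF D N0 DN0 dvd_refl] by blast
qed

text \<open>If \<open>v = (1 - b) w\<close>, then \<open>N\<close> is taken so small that the order of \<open>b\<close> modulo \<open>N\<close> is a multiple of
  \<open>p q\<close>, where \<open>b ^ p\<close> lies in \<open>N\<^sub>0\<close>; this is where \<open>b\<close> has to be of infinite order.\<close>

lemma cobound_closed:
  assumes css: "cyclic_subgroup_separable G" and tf: "torsion_free G" and b: "b \<in> carrier G"
    and N0: "fin_normal G N\<^sub>0" and q: "(q::nat) > 0" and v: "v \<in> fsupp"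
    and nv: "v \<notin> cobound b (aug N\<^sub>0 (int q))"
  shows "\<exists>N r. fin_normal G N \<and> (r::nat) > 0 \<and>
    (\<forall>u\<in>aug N\<^sub>0 (int q). v - (u - tr b u) \<notin> aug N (int r))"
proof (cases "v \<in> aug (generate G {b}) 0")
  \<comment> \<open>Not even a multiple of \<open>1 - b\<close>: some sum over a coset of
    \<open>\<langle>b\<rangle>\<close> is nonzero, whereas the sums of \<open>u - b u\<close> over
    cosets of \<open>N \<langle>b\<rangle>\<close> vanish.\<close>
  case False
  let ?C = "generate G {b}"
  obtain s where s: "s \<in> carrier G" "csum v (?C #> s) \<noteq> 0"
    using False v by (auto simp: aug_def)
  obtain N where N: "fin_normal G N" "csum v ((N <#> ?C) #> s) = csum v (?C #> s)"
    using separate_support[OF css b s(1) v] by blast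
  \<comment> \<open>Larger than the absolute value of the nonzero coset sum, so it cannot divide
    it.\<close>
  define r where "r = Suc (nat \<bar>csum v (?C #> s)\<bar>)"
  have D: "subgroup (N <#> ?C) G" using fin_normalD(1)[OF N(1)] b by (rule subgroup_mult_cyclic)
  have "v - (u - tr b u) \<notin> aug N (int r)" if u: "u \<in> aug N\<^sub>0 (int q)" for u
  proof
    assume "v - (u - tr b u) \<in> aug N (int r)"
    then have "v - (u - tr b u) \<in> aug (N <#> ?C) (int r)"
      using aug_mono[OF fin_normalD(2)[OF N(1)] D normal_subset_mult[OF fin_normalD(2)[OF N(1)] b] dvd_refl] by blast
    moreover have "u - tr b u \<in> aug (N <#> ?C) (int r)"
      using cyclic_subset_mult[OF fin_normalD(2)[OF N(1)] b] aug_fsupp[OF u]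
      by (intro diff_tr_aug D) (auto intro: generate.incl)
    ultimately have "v \<in> aug (N <#> ?C) (int r)"
      using aug_closed(2) by fastforce
    then have "int r dvd csum v (?C #> s)" using s(1) N(2) by (auto simp: aug_def)
    then have "\<bar>int r\<bar> \<le> \<bar>csum v (?C #> s)\<bar>" using s(2) by (intro dvd_imp_le_int) auto
    then show False by (simp add: r_def)
  qed
  then show ?thesis using N(1) by (intro exI[of _ N] exI[of _ r]) (auto simp: r_def)
next
  case True
  then obtain w where w: "w \<in> fsupp" "v = w - tr b w"
    using aug_cyclic_eq_cobound[OF b] by (auto simp: cobound_def)
  have wn: "w \<notin> aug N\<^sub>0 (int q)" using nv w by (auto simp: cobound_def)
  have "b \<noteq> \<one>"
  proof
    assume "b = \<one>"
    then have "v = 0" using w by (simp add: tr_one)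
    then show False
      using nv additive_cobound[OF additive_aug] by (simp add: additive_def)
  qed
  then have inf: "b [^] k \<noteq> \<one>" if "k > 0" for k :: nat
    using tf b that by (auto simp: torsion_free_def)
  obtain p :: nat where p: "p > 0" "b [^] p \<in> N\<^sub>0" using fin_normal_pow[OF N0] b by metis
  obtain N1 where N1: "fin_normal G N1" "\<And>k::nat. b [^] k \<in> N1 \<Longrightarrow> p * q dvd k"
    using separate_powers[OF css b inf, of "p * q"] p q by auto
  define N where "N = N\<^sub>0 \<inter> N1"
  have N: "fin_normal G N" unfolding N_def using N0 N1(1) by (rule fin_normal_Int)
  obtain k0 :: nat where k0: "k0 > 0" "(b [^] p) [^] k0 \<in> N" using fin_normal_pow[OF N] b by (metis nat_pow_closed)
  \<comment> \<open>The exact order of \<open>b^p\<close> modulo \<open>N\<close>. As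
    \<open>b^(p k)\<close> lies in \<open>N1\<close>, the product \<open>p q\<close> divides
    \<open>p k\<close>, hence \<open>q\<close> divides \<open>k\<close>.\<close>
  define k where "k = (LEAST k::nat. k > 0 \<and> (b [^] p) [^] k \<in> N)"
  have k: "k > 0" "(b [^] p) [^] k \<in> N"
    using LeastI[of "\<lambda>k::nat. k > 0 \<and> (b [^] p) [^] k \<in> N" k0] k0 by (auto simp: k_def)
  have least: "(b [^] p) [^] j \<notin> N" if "0 < j" "j < k" for j
    using not_less_Least[of j "\<lambda>k::nat. k > 0 \<and> (b [^] p) [^] k \<in> N"] that by (auto simp: k_def)
  have "b [^] (p * k) \<in> N1" using k(2) b by (simp add: N_def nat_pow_pow)
  then have "q dvd k" using N1(2) p(1) by fastforce
  have "v - (u - tr b u) \<notin> aug N (int q)" if u: "u \<in> aug N\<^sub>0 (int q)" for u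
  proof
    assume "v - (u - tr b u) \<in> aug N (int q)"
    then have z: "(w - u) - tr b (w - u) \<in> aug N (int q)"
      by (simp add: w(2) tr_diff algebra_simps)
    have zF: "w - u \<in> fsupp" using w(1) aug_fsupp[OF u] by (rule fsupp_closed(3))
    have "w - u \<in> aug N\<^sub>0 (int q)"
    proof (rule diff_tr_aug_imp_aug[OF fin_normalD(2)[OF N0] fin_normalD(1)[OF N] _ p(2) zF])
      show "w - u - tr (b [^] p) (w - u) \<in> aug N (int q)"
        by (rule diff_tr_pow_aug[OF fin_normalD(1)[OF N] b zF z])
    qed (use k least \<open>q dvd k\<close> N_def in auto)
    then have "(w - u) + u \<in> aug N\<^sub>0 (int q)" using u by (rule aug_closed(2))
    then show False using wn by simp
  qed
  then show ?thesis using N q by blast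
qed

section \<open>Translates of \<open>(1 - b) U\<close> indexed by a centraliser\<close>

lemma commute_int_pow:
  assumes "e \<in> carrier G" "b \<in> carrier G" "e \<otimes> b = b \<otimes> e"
  shows "e \<otimes> b [^] (i::int) = b [^] i \<otimes> e"
proof -
  have "e \<otimes> b \<otimes> inv e = b" using assms by (simp add: m_assoc)
  then have "b [^] i \<otimes> e = (e \<otimes> b \<otimes> inv e) [^] i \<otimes> e" by simp
  also have "(e \<otimes> b \<otimes> inv e) [^] i = e \<otimes> b [^] i \<otimes> inv e"
  proof -
    have "(\<lambda>x. e \<otimes> x \<otimes> inv e) \<in> hom G G"
      using assms by (auto simp: hom_def m_assoc inv_mult_cancel)
    then interpret h: group_hom G G "\<lambda>x. e \<otimes> x \<otimes> inv e"
      by (simp add: group_hom_def group_hom_axioms_def)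
    show ?thesis using h.hom_int_pow[OF assms(2), of i] by simp
  qed
  finally show ?thesis using assms by (simp add: m_assoc)
qed

text \<open>A union of closed sets over a possibly infinite family of elements \<open>e\<close> need
  not be closed, so one pair \<open>N\<close>, \<open>r\<close> has to serve all \<open>e\<close>.
  Only the support of \<open>n\<close> and the exponents below a fixed \<open>Q\<close> turn out to
  matter.\<close>

lemma orbit_cobound_closed:
  assumes css: "cyclic_subgroup_separable G" and tf: "torsion_free G" and b: "b \<in> carrier G"
    and N0: "fin_normal G N\<^sub>0" and q: "(q::nat) > 0" and m: "m \<in> fsupp" and n: "n \<in> fsupp"
    and ne: "\<And>e. e \<in> N\<^sub>0 \<Longrightarrow> e \<otimes> b = b \<otimes> e \<Longrightarrow> n - tr e m \<notin> cobound b (aug N\<^sub>0 (int q))"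
  shows "\<exists>N r. fin_normal G N \<and> (r::nat) > 0 \<and>
    (\<forall>e\<in>N\<^sub>0. e \<otimes> b = b \<otimes> e \<longrightarrow>
      (\<forall>u\<in>aug N\<^sub>0 (int q). n - tr e m - (u - tr b u) \<notin> aug N (int r)))"
proof -
  interpret N0: normal N\<^sub>0 G using N0 by (rule fin_normalD)
  let ?U = "aug N\<^sub>0 (int q)"
  show ?thesis
  proof (cases "m \<in> aug (generate G {b}) 0")
    case True
    then obtain w where w: "w \<in> fsupp" "m = w - tr b w"
      using aug_cyclic_eq_cobound[OF b] by (auto simp: cobound_def)
    have "n - tr \<one> m \<notin> cobound b ?U" using ne[of \<one>] b by simp
    then have "n - m \<notin> cobound b ?U" using m by (simp add: tr_one)
    then obtain N r where N: "fin_normal G N" "(r::nat) > 0"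
      "\<And>u. u \<in> ?U \<Longrightarrow> n - m - (u - tr b u) \<notin> aug N (int r)"
      using cobound_closed[OF css tf b N0 q fsupp_closed(3)[OF n m]] by blast
    have "n - tr e m - (u - tr b u) \<notin> aug N (int r)"
      if e: "e \<in> N\<^sub>0" "e \<otimes> b = b \<otimes> e" and u: "u \<in> ?U" for e u
    proof -
      \<comment> \<open>As \<open>e\<close> commutes with \<open>b\<close>, one has
        \<open>e m - m = (1 - b) (e w - w)\<close>, and \<open>e w - w\<close> lies in
        \<open>U\<close> because \<open>e\<close> lies in \<open>N\<^sub>0\<close>. The difference
        is absorbed into \<open>u\<close>.\<close>
      define u' where "u' = u + (tr e w - w)"
      have "u' \<in> ?U"
        unfolding u'_def by (rule aug_closed(2)[OF u tr_diff_aug[OF N0.is_subgroup e(1) w(1)]])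
      moreover have "tr b (tr e w) = tr e (tr b w)"
        using e b by (simp add: tr_tr)
      then have "n - m - (u' - tr b u') = n - tr e m - (u - tr b u)"
        by (simp add: u'_def w(2) tr_add tr_diff algebra_simps)
      ultimately show ?thesis using N(3)[of u'] by metis
    qed
    then show ?thesis using N by blast
  next
    case False
    let ?C = "generate G {b}"
    obtain s where s: "s \<in> carrier G" "csum m (?C #> s) \<noteq> 0"
      using False m by (auto simp: aug_def)
    obtain N1 where N1: "fin_normal G N1" "\<And>M. fin_normal G M \<Longrightarrow> M \<subseteq> N1 \<Longrightarrow>
        csum m ((M <#> ?C) #> s) = csum m (?C #> s)"
      using separate_support[OF css b s(1) m] by blast
    define r1 where "r1 = Suc (nat \<bar>csum m (?C #> s)\<bar>)"
    obtain p :: nat where p: "p > 0" "b [^] p \<in> N\<^sub>0" using fin_normal_pow[OF N0] b by metis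
    \<comment> \<open>The factor \<open>p\<close> brings powers of \<open>b\<close> into
      \<open>N\<^sub>0\<close>; the factor \<open>q\<close> makes
      \<open>1 + b + ... + b^(Q - 1)\<close> map the group ring into \<open>U\<close>. Since
      \<open>1 - b^Q\<close> is \<open>1 - b\<close> times this sum, \<open>b^Q\<close> acts
      trivially modulo \<open>(1 - b) U\<close>.\<close>
    define Q where "Q = p * q"
    let ?triv = "{a \<in> carrier G. \<forall>f\<in>fsupp. tr a f - f \<in> cobound b ?U}"
    have triv: "subgroup ?triv G"
      by (intro trivial_action_subgroup additive_cobound additive_aug)
    have bQ: "b [^] Q \<in> ?triv"
    proof -
      have "tr (b [^] Q) f - f \<in> cobound b ?U" if f: "f \<in> fsupp" for f
      proof -
        have "(\<Sum>l<Q. tr (b [^] l) f) \<in> ?U"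
          unfolding Q_def using N0.normal_axioms b p(2) f by (rule tr_sum_aug) simp
        moreover have "(\<Sum>l<Q. tr (b [^] l) f) - tr b (\<Sum>l<Q. tr (b [^] l) f) = f - tr (b [^] Q) f"
        proof -
          have "tr b (\<Sum>l<Q. tr (b [^] l) f) = (\<Sum>l<Q. tr (b [^] Suc l) f)"
            unfolding tr_sum using b by (intro sum.cong refl) (metis tr_tr nat_pow_Suc2 nat_pow_closed)
          then have "(\<Sum>l<Q. tr (b [^] l) f) - tr b (\<Sum>l<Q. tr (b [^] l) f)
              = (\<Sum>l<Q. tr (b [^] l) f - tr (b [^] Suc l) f)"
            by (simp only: sum_subtractf)
          also have "\<dots> = tr (b [^] (0::nat)) f - tr (b [^] Q) f"
            by (rule sum_lessThan_telescope')
          finally show ?thesis using f by (simp only: nat_pow_0 tr_one)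
        qed
        ultimately have "f - tr (b [^] Q) f \<in> cobound b ?U"
          by (rule coboundI[OF _ sym])
        then have "- (f - tr (b [^] Q) f) \<in> cobound b ?U"
          by (rule additive_closed(1)[OF additive_cobound[OF additive_aug]])
        then show ?thesis by simp
      qed
      then show ?thesis using b by simp
    qed
    \<comment> \<open>Comparing the sums over the cosets of \<open>\<langle>b\<rangle>N\<close> shows that \<open>e\<close> agrees with one of these finitely
      many candidates up to an element of \<open>N\<close> and a power of \<open>b ^ Q\<close>.\<close>
    define cand where "cand = (\<lambda>(i::nat, t). b [^] i \<otimes> t \<otimes> inv s)"
    \<comment> \<open>Candidates in \<open>N\<^sub>0\<close> commuting with \<open>b\<close> get the
      desired separation. For those that do not commute, the commutator with \<open>b\<close> is
      kept out of \<open>N\<close>, so that commuting modulo \<open>N\<close> will imply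
      commuting.\<close>
    define P where "P e N r \<longleftrightarrow> (e \<otimes> b = b \<otimes> e \<longrightarrow> e \<in> N\<^sub>0 \<longrightarrow>
        (\<forall>u\<in>?U. n - tr e m - (u - tr b u) \<notin> aug N (int r))) \<and>
      (e \<otimes> b \<noteq> b \<otimes> e \<longrightarrow> e \<otimes> b \<otimes> inv e \<otimes> inv b \<notin> N)" for e N r
    have P_mono: "P e M r'" if "P e N r" "fin_normal G N" "fin_normal G M" "M \<subseteq> N" "r dvd r'" for e N M r r'
    proof -
      have "int r dvd int r'" using that(5) by simp
      then have "aug M (int r') \<subseteq> aug N (int r)"
        using that by (intro aug_mono) (auto dest: fin_normalD)
      then show ?thesis using that unfolding P_def by blast
    qed
    have "\<exists>N. fin_normal G N \<and> (\<forall>x\<in>{..<Q} \<times> {t. n t \<noteq> 0}. \<exists>r>0. P (cand x) N r)"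
    proof (rule fin_normal_common)
      show "finite ({..<Q} \<times> {t. n t \<noteq> 0})" using finite_supp[OF n] by simp
      fix x assume "x \<in> {..<Q} \<times> {t. n t \<noteq> 0}"
      then have xG: "cand x \<in> carrier G"
        using b s(1) fsupp_carrier[OF n] by (auto simp: cand_def)
      show "\<exists>N. fin_normal G N \<and> (\<exists>r>0. P (cand x) N r)"
      proof (cases "cand x \<otimes> b = b \<otimes> cand x")
        case True
        show ?thesis
        proof (cases "cand x \<in> N\<^sub>0")
          case e: True
          have "n - tr (cand x) m \<in> fsupp" using n m xG by (simp add: fsupp_closed(3) tr_fsupp)
          then show ?thesis
            using cobound_closed[OF css tf b N0 q _ ne[OF e True]] True unfolding P_def by blast
        next
          case False
          then show ?thesis using True fin_normal_carrier unfolding P_def by blast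
        qed
      next
        case False
        have "cand x \<otimes> b \<otimes> inv (cand x) \<otimes> inv b \<noteq> \<one>"
        proof
          assume "cand x \<otimes> b \<otimes> inv (cand x) \<otimes> inv b = \<one>"
          then have "cand x \<otimes> b \<otimes> inv (cand x) = b"
            using xG b by (metis inv_closed inv_equality inv_inv m_closed)
          then show False using False xG b inv_solve_right'[of b "cand x \<otimes> b" "cand x"] by simp
        qed
        then show ?thesis
          using separate_one[OF css, of "cand x \<otimes> b \<otimes> inv (cand x) \<otimes> inv b"] xG b False
          unfolding P_def by (metis inv_closed m_closed zero_less_one)
      qed
    next
      fix x N M assume NM: "fin_normal G N" "\<exists>r>0. P (cand x) N r" "fin_normal G M" "M \<subseteq> N"
      then obtain r where "r > 0" "P (cand x) N r" by blast
      then show "\<exists>r>0. P (cand x) M r" using P_mono[OF _ NM(1,3,4) dvd_refl] by blast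
    qed
    then obtain N2 where N2: "fin_normal G N2"
      "\<And>x. x \<in> {..<Q} \<times> {t. n t \<noteq> 0} \<Longrightarrow> \<exists>r>0. P (cand x) N2 r" by blast
    then have "\<forall>x\<in>{..<Q} \<times> {t. n t \<noteq> 0}. \<exists>r. r > 0 \<and> P (cand x) N2 r" by blast
    from bchoice[OF this] obtain \<rho>
      where \<rho>: "\<forall>x\<in>{..<Q} \<times> {t. n t \<noteq> 0}. \<rho> x > 0 \<and> P (cand x) N2 (\<rho> x)" ..
    \<comment> \<open>A common multiple of all required moduli, since divisibility by
      \<open>r\<close> has to imply divisibility by each of them.\<close>
    define r where "r = r1 * (\<Prod>x\<in>{..<Q} \<times> {t. n t \<noteq> 0}. \<rho> x)"
    have r0: "r > 0"
      unfolding r_def r1_def using \<rho> by (intro mult_pos_pos prod_pos) blast+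
    define N where "N = N\<^sub>0 \<inter> (N1 \<inter> N2)"
    have N: "fin_normal G N" unfolding N_def using N0 N1(1) N2(1) by (intro fin_normal_Int)
    interpret N: normal N G using N by (rule fin_normalD)
    let ?D = "N <#> ?C"
    have D: "subgroup ?D G" using N.normal_axioms b by (rule subgroup_mult_cyclic)
    have "n - tr e m - (u - tr b u) \<notin> aug N (int r)"
      if e: "e \<in> N\<^sub>0" "e \<otimes> b = b \<otimes> e" and u: "u \<in> ?U" for e u
    proof
      assume z: "n - tr e m - (u - tr b u) \<in> aug N (int r)"
      have eG: "e \<in> carrier G" using e(1) by simp
      \<comment> \<open>\<open>e\<close> commutes with \<open>b\<close> and \<open>N\<close> is
        normal, so \<open>e\<close> normalises \<open>N \<langle>b\<rangle>\<close>. This allows the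
        coset sums of \<open>e m\<close> and \<open>m\<close> to be compared.\<close>
      have conj: "e \<otimes> d \<otimes> inv e \<in> ?D" "inv e \<otimes> d \<otimes> e \<in> ?D" if d: "d \<in> ?D" for d
      proof -
        have dG: "d \<in> carrier G" using D d subgroup.mem_carrier by fastforce
        obtain i :: int where i: "d \<otimes> inv (b [^] i) \<in> N"
          using d mem_mult_cyclic[OF N.is_subgroup b dG] by blast
        have c: "e \<otimes> inv (b [^] i) = inv (b [^] i) \<otimes> e"
          using commute_int_pow[OF eG b e(2), of "- i"] b by (simp add: int_pow_neg)
        have "e \<otimes> (d \<otimes> inv (b [^] i)) \<otimes> inv e \<in> N" using i eG by (rule N.inv_op_closed2[rotated])
        also have "e \<otimes> (d \<otimes> inv (b [^] i)) \<otimes> inv e = e \<otimes> d \<otimes> inv e \<otimes> inv (b [^] i)"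
        proof -
          have "inv (b [^] i) \<otimes> inv e = inv e \<otimes> inv (b [^] i)"
            using c eG b by (metis inv_closed inv_mult_group int_pow_closed inv_inv commute_int_pow e(2))
          then show ?thesis using eG dG b by (simp add: m_assoc)
        qed
        finally show "e \<otimes> d \<otimes> inv e \<in> ?D"
          using mem_mult_cyclic[OF N.is_subgroup b, of "e \<otimes> d \<otimes> inv e"] eG dG by blast
        have "inv e \<otimes> (d \<otimes> inv (b [^] i)) \<otimes> e \<in> N" using eG i by (rule N.inv_op_closed1)
        also have "inv e \<otimes> (d \<otimes> inv (b [^] i)) \<otimes> e = inv e \<otimes> d \<otimes> e \<otimes> inv (b [^] i)"
          using c eG dG b by (simp add: m_assoc)
        finally show "inv e \<otimes> d \<otimes> e \<in> ?D"
          using mem_mult_cyclic[OF N.is_subgroup b, of "inv e \<otimes> d \<otimes> e"] eG dG by blast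
      qed
      have "n - tr e m \<in> aug ?D (int r)"
      proof -
        have "n - tr e m - (u - tr b u) \<in> aug ?D (int r)"
          using z aug_mono[OF N.is_subgroup D normal_subset_mult[OF N.is_subgroup b] dvd_refl] by blast
        moreover have "u - tr b u \<in> aug ?D (int r)"
          using cyclic_subset_mult[OF N.is_subgroup b] aug_fsupp[OF u]
          by (intro diff_tr_aug D) (auto intro: generate.incl)
        ultimately have "(n - tr e m - (u - tr b u)) + (u - tr b u) \<in> aug ?D (int r)"
          by (rule aug_closed(2))
        then show ?thesis by simp
      qed
      then have "int r dvd csum (n - tr e m) (?D #> (e \<otimes> s))"
        using eG s(1) by (auto simp: aug_def)
      also have "csum (n - tr e m) (?D #> (e \<otimes> s)) = csum n (?D #> (e \<otimes> s)) - csum m (?C #> s)"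
        using csum_tr_rcos[OF D eG s(1) m conj] N1(2)[OF N] n m eG
        by (simp add: csum_diff finite_supp tr_fsupp N_def le_infI2)
      finally have dvd: "int r dvd csum n (?D #> (e \<otimes> s)) - csum m (?C #> s)" .
      \<comment> \<open>Otherwise \<open>r1\<close> would divide the nonzero sum of
        \<open>m\<close>, which it exceeds. Hence \<open>n\<close> has a support point
        \<open>t\<close> in the coset of \<open>e s\<close>, and \<open>e\<close> becomes tied to
        the finite support of \<open>n\<close>.\<close>
      have "csum n (?D #> (e \<otimes> s)) \<noteq> 0"
      proof
        assume "csum n (?D #> (e \<otimes> s)) = 0"
        then have "int r1 dvd csum m (?C #> s)" using dvd by (auto simp: r_def intro: dvd_mult_left)
        then have "\<bar>int r1\<bar> \<le> \<bar>csum m (?C #> s)\<bar>" using s(2) by (intro dvd_imp_le_int) auto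
        then show False by (simp add: r1_def)
      qed
      then obtain t where t: "n t \<noteq> 0" "t \<in> ?D #> (e \<otimes> s)"
        using csum_nonzero by blast
      have tG: "t \<in> carrier G" using t(1) fsupp_carrier[OF n] by blast
      have tsG: "t \<otimes> inv (e \<otimes> s) \<in> carrier G" using tG eG s(1) by simp
      have "t \<otimes> inv (e \<otimes> s) \<in> ?D" using t(2) mem_rcos_iff[OF D tG] eG s(1) by blast
      then obtain i :: int where i: "t \<otimes> inv (e \<otimes> s) \<otimes> inv (b [^] i) \<in> N"
        unfolding mem_mult_cyclic[OF N.is_subgroup b tsG] ..
      define \<nu> where "\<nu> = t \<otimes> inv (e \<otimes> s) \<otimes> inv (b [^] i)"
      have \<nu>: "\<nu> \<in> N" "\<nu> \<in> carrier G" using i by (simp_all add: \<nu>_def tG eG s(1) b)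
      \<comment> \<open>From \<open>t = \<nu> b^i e s\<close> follows
        \<open>e = b^(-i) \<nu>^-1 t s^-1\<close>. Division of \<open>-i\<close> by \<open>Q\<close>
        leaves the remainder \<open>j\<close>, and moving \<open>\<nu>^-1\<close> to the left of
        \<open>b^j\<close> gives \<open>e = a \<beta> e'\<close> with \<open>a\<close> a power of
        \<open>b^Q\<close>, \<open>\<beta>\<close> in \<open>N\<close> and \<open>e'\<close> a
        candidate.\<close>
      define j where "j = nat ((- i) mod int Q)"
      have Q0: "Q > 0" using p q by (simp add: Q_def)
      have j: "j < Q" "int j = (- i) mod int Q" using Q0 by (simp_all add: j_def nat_less_iff)
      define a where "a = b [^] (int Q * ((- i) div int Q))"
      define \<beta> where "\<beta> = b [^] j \<otimes> inv \<nu> \<otimes> inv (b [^] j)"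
      define e' where "e' = cand (j, t)"
      have aG: "a \<in> carrier G" using b by (simp add: a_def)
      have \<beta>: "\<beta> \<in> N" "\<beta> \<in> carrier G"
        using \<nu> b N.inv_op_closed2[of "b [^] j" "inv \<nu>"] by (auto simp: \<beta>_def)
      have e'G: "e' \<in> carrier G" using b tG s(1) by (simp add: e'_def cand_def)
      have ab: "b [^] (- i) = a \<otimes> b [^] j"
      proof -
        have "- i = int Q * ((- i) div int Q) + int j" using j(2) by simp
        then show ?thesis unfolding a_def using b by (metis int_pow_int int_pow_mult)
      qed
      have e_eq: "e = a \<otimes> (\<beta> \<otimes> e')"
      proof -
        have "a \<otimes> (\<beta> \<otimes> e') = (a \<otimes> b [^] j) \<otimes> inv \<nu> \<otimes> t \<otimes> inv s"
          using aG b \<nu> tG s(1) by (simp add: \<beta>_def e'_def cand_def m_assoc inv_mult_cancel)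
        also have "\<dots> = b [^] (- i) \<otimes> inv \<nu> \<otimes> t \<otimes> inv s" by (simp add: ab)
        also have "\<dots> = e"
          using eG b tG s(1) by (simp add: \<nu>_def m_assoc inv_mult_cancel inv_mult_group int_pow_neg)
        finally show ?thesis by simp
      qed
      have atriv: "a \<in> ?triv"
        using subgroup_int_pow_closed[OF triv bQ, of "(- i) div int Q"] b
        by (simp add: a_def int_pow_pow flip: int_pow_int)
      have aN0: "a \<in> N\<^sub>0"
        using subgroup_int_pow_closed[OF N0.is_subgroup p(2), of "int q * ((- i) div int Q)"] b
        by (simp add: a_def int_pow_pow Q_def mult.assoc flip: int_pow_int)
      have e'_eq: "e' = inv \<beta> \<otimes> (inv a \<otimes> e)"
        using aG \<beta> e'G by (simp add: e_eq inv_mult_cancel)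
      have e'N0: "e' \<in> N\<^sub>0"
        unfolding e'_eq using \<beta>(1) aN0 e(1) by (simp add: N_def)
      define c where "c = inv a \<otimes> e"
      have cG: "c \<in> carrier G" using aG eG by (simp add: c_def)
      have "inv a \<otimes> b = b \<otimes> inv a"
        using commute_int_pow[OF b b refl, of "- (int Q * ((- i) div int Q))"] b by (simp add: a_def int_pow_neg)
      have cb: "c \<otimes> b = b \<otimes> c"
      proof -
        have "inv a \<otimes> e \<otimes> b = inv a \<otimes> b \<otimes> e"
          using aG b eG e(2) by (simp add: m_assoc)
        also have "\<dots> = b \<otimes> inv a \<otimes> e"
          using \<open>inv a \<otimes> b = b \<otimes> inv a\<close> by simp
        finally show ?thesis unfolding c_def using aG b eG by (simp add: m_assoc)
      qed
      \<comment> \<open>Both \<open>a\<close> and \<open>e\<close> commute with \<open>b\<close>, so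
        \<open>e'\<close> does so up to \<open>\<beta>\<close>, that is, modulo \<open>N\<close>.
        The choice of \<open>N2\<close> turns this into genuine commutation.\<close>
      have "e' \<otimes> b \<otimes> inv e' \<otimes> inv b = inv \<beta> \<otimes> (b \<otimes> \<beta> \<otimes> inv b)"
      proof -
        have "e' \<otimes> b \<otimes> inv e' \<otimes> inv b = inv \<beta> \<otimes> (c \<otimes> b) \<otimes> inv c \<otimes> \<beta> \<otimes> inv b"
          using \<beta>(2) cG b by (simp add: e'_eq inv_mult_group m_assoc flip: c_def)
        also have "\<dots> = inv \<beta> \<otimes> (b \<otimes> \<beta> \<otimes> inv b)"
          unfolding cb using \<beta>(2) cG b by (simp add: m_assoc inv_mult_cancel)
        finally show ?thesis .
      qed
      then have "e' \<otimes> b \<otimes> inv e' \<otimes> inv b \<in> N" using \<beta>(1) b by (simp add: N.inv_op_closed2)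
      then have e'N2: "e' \<otimes> b \<otimes> inv e' \<otimes> inv b \<in> N2" by (simp add: N_def)
      have jt: "(j, t) \<in> {..<Q} \<times> {t. n t \<noteq> 0}" using j(1) t(1) by simp
      have Pe': "P e' N2 (\<rho> (j, t))" using bspec[OF \<rho> jt] by (simp add: e'_def)
      then have e'b: "e' \<otimes> b = b \<otimes> e'" using e'N2 by (auto simp: P_def)
      define f where "f = tr e' m"
      have f: "f \<in> fsupp" using e'G m by (simp add: f_def tr_fsupp)
      \<comment> \<open>Passing from \<open>e\<close> to \<open>e'\<close> costs an element of
        \<open>aug N r\<close> for \<open>\<beta>\<close> and a multiple \<open>(1 - b) w\<close>
        for \<open>a\<close>; the latter is absorbed into \<open>u\<close>.\<close>
      obtain w where w: "w \<in> ?U" "tr a f - f = w - tr b w"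
        using atriv f by (auto simp: cobound_def)
      have "tr e m - tr a f \<in> aug N (int r)"
      proof -
        have "tr a (tr \<beta> f - f) \<in> aug N (int r)"
          using \<beta>(1) f by (intro tr_aug N.normal_axioms aG tr_diff_aug N.is_subgroup)
        moreover have "tr e m = tr a (tr \<beta> f)"
          unfolding e_eq f_def using aG \<beta>(2) e'G by (simp add: tr_tr)
        ultimately show ?thesis by (simp add: tr_diff)
      qed
      then have "(n - tr e m - (u - tr b u)) + (tr e m - tr a f) \<in> aug N (int r)"
        using z aug_closed(2) by blast
      moreover have "(n - tr e m - (u - tr b u)) + (tr e m - tr a f) = n - f - ((u + w) - tr b (u + w))"
      proof -
        have "tr a f = f + (w - tr b w)" using w(2) by (simp add: algebra_simps)
        then show ?thesis by (simp add: tr_add algebra_simps)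
      qed
      ultimately have "n - f - ((u + w) - tr b (u + w)) \<in> aug N (int r)" by simp
      moreover have "aug N (int r) \<subseteq> aug N2 (int (\<rho> (j, t)))"
      proof (rule aug_mono[OF N.is_subgroup fin_normalD(2)[OF N2(1)]])
        have "\<rho> (j, t) dvd (\<Prod>x\<in>{..<Q} \<times> {t. n t \<noteq> 0}. \<rho> x)"
          using jt finite_supp[OF n] by (intro dvd_prodI) auto
        then have "\<rho> (j, t) dvd r" unfolding r_def by (rule dvd_mult)
        then show "int (\<rho> (j, t)) dvd int r" by simp
      qed (auto simp: N_def)
      ultimately show False
        using Pe' e'b e'N0 aug_closed(2)[OF u w(1)] unfolding P_def f_def by blast
    qed
    then show ?thesis using N r0 by blast
  qed
qed


section \<open>Residual finiteness of the group ring\<close>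

text \<open>With the trivial cyclic subgroup in \<open>separate_support\<close>, a single
  coefficient becomes a coset sum in all sufficiently large finite quotients.\<close>

lemma separate_point:
  assumes css: "cyclic_subgroup_separable G" and f: "f \<in> fsupp" and s: "s \<in> carrier G"
  obtains N where "fin_normal G N"
    "\<And>M. fin_normal G M \<Longrightarrow> M \<subseteq> N \<Longrightarrow> csum f (M #> s) = f s"
proof -
  have one: "generate G {\<one>} = {\<one>}" by (rule generate_one)
  obtain N where N: "fin_normal G N"
    "\<And>M. fin_normal G M \<Longrightarrow> M \<subseteq> N \<Longrightarrow> csum f ((M <#> {\<one>}) #> s) = csum f ({\<one>} #> s)"
    using separate_support[OF css one_closed s f] unfolding one by blast
  show ?thesis
  proof (rule that[OF N(1)])
    fix M assume M: "fin_normal G M" "M \<subseteq> N"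
    interpret M: subgroup M G using M(1) by (rule fin_normalD)
    have "M <#> {\<one>} = M" by (auto simp: set_mult_def)
    moreover have "csum f ({\<one>} #> s) = f s"
    proof -
      have "csum f ({\<one>} #> s) = sum f {s}"
        using s by (intro csum_eq_sum) (auto simp: r_coset_def)
      then show ?thesis by simp
    qed
    ultimately show "csum f (M #> s) = f s" using N(2)[OF M] by simp
  qed
qed

text \<open>A nonzero coefficient is realised as a coset sum, and \<open>r\<close> is taken larger
  than its absolute value.\<close>

lemma separate_zero:
  assumes css: "cyclic_subgroup_separable G" and f: "f \<in> fsupp" "f \<noteq> 0"
  obtains N r where "fin_normal G N" "(r::nat) > 0" "f \<notin> aug N (int r)"
proof -
  obtain s where s: "f s \<noteq> 0" using f(2) by (auto simp: fun_eq_iff)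
  have sG: "s \<in> carrier G" using f(1) s by (rule fsupp_carrier)
  obtain N where N: "fin_normal G N" "csum f (N #> s) = f s"
    using separate_point[OF css f(1) sG] by blast
  define r where "r = Suc (nat \<bar>f s\<bar>)"
  have "f \<notin> aug N (int r)"
  proof
    assume "f \<in> aug N (int r)"
    then have "int r dvd f s" using N(2) sG by (auto simp: aug_def)
    then have "\<bar>int r\<bar> \<le> \<bar>f s\<bar>" using s by (intro dvd_imp_le_int)
    then show False by (simp add: r_def)
  qed
  moreover have "r > 0" by (simp add: r_def)
  ultimately show ?thesis using that N(1) by blast
qed

subsection \<open>Torsion, derived subgroups and polycyclic groups\<close>

lemma torsion_freeD: "torsion_free G \<Longrightarrow> x \<in> carrier G \<Longrightarrow> x [^] (n::nat) = \<one> \<Longrightarrow> n > 0 \<Longrightarrow> x = \<one>"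
  by (auto simp: torsion_free_def)

lemma torsion_free_infinite:
  assumes "torsion_free G" "carrier G \<noteq> {\<one>}"
  shows "infinite (carrier G)"
proof
  assume fin: "finite (carrier G)"
  then have "order G > 0" using order_gt_0_iff_finite by simp
  then have "x = \<one>" if "x \<in> carrier G" for x
    using torsion_freeD[OF assms(1) that pow_order_eq_1[OF that]] by simp
  then show False using assms(2) by blast
qed

lemma derived_subset_one:
  assumes "H \<subseteq> carrier G" "\<And>x y. x \<in> H \<Longrightarrow> y \<in> H \<Longrightarrow> x \<otimes> y = y \<otimes> x"
  shows "derived G H = {\<one>}"
proof -
  have "derived_set G H \<subseteq> {\<one>}"
  proof clarify
    fix x y assume xy: "x \<in> H" "y \<in> H"
    then have G: "x \<in> carrier G" "y \<in> carrier G" using assms(1) by auto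
    show "x \<otimes> y \<otimes> inv x \<otimes> inv y = \<one>"
      unfolding assms(2)[OF xy] using G by (simp add: m_assoc)
  qed
  then have "derived G H \<subseteq> generate G {\<one>}"
    unfolding derived_def by (rule mono_generate)
  moreover have "\<one> \<in> derived G H" unfolding derived_def by (rule generate.one)
  ultimately show ?thesis by (auto simp: generate_one)
qed

text \<open>The exponents of the generator \<open>C\<close> that occur on \<open>S\<close> form a
  subgroup \<open>Z\<close> of the integers, hence the multiples of some \<open>d\<close>. One
  element of \<open>S\<close> above \<open>C^d\<close> suffices in addition to
  \<open>F\<close>.\<close>

lemma finitely_generated_extension:
  assumes K: "K \<lhd> G" and cyc: "cyclic_group (G Mod K)" and S: "subgroup S G"
    and F: "finite F" "generate G F = S \<inter> K"
  shows "\<exists>F'. finite F' \<and> generate G F' = S"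
proof -
  interpret K: normal K G by (rule K)
  interpret S: subgroup S G by (rule S)
  let ?\<pi> = "\<lambda>x. K #> x"
  interpret Q: group "G Mod K" by (rule K.factorgroup_is_group)
  interpret \<pi>: group_hom G "G Mod K" ?\<pi>
    by unfold_locales (rule K.r_coset_hom_Mod)
  obtain C where C: "C \<in> carrier (G Mod K)" "carrier (G Mod K) = range (\<lambda>n::int. C [^]\<^bsub>G Mod K\<^esub> n)"
    using cyc Q.cyclic_group by blast
  have ker: "x \<otimes> inv y \<in> K" if "x \<in> carrier G" "y \<in> carrier G" "?\<pi> x = ?\<pi> y" for x y
    using that rcos_self[of x K] K.is_subgroup mem_rcos_iff[of K x y] by auto
  define Z where "Z = {n::int. \<exists>x\<in>S. ?\<pi> x = C [^]\<^bsub>G Mod K\<^esub> n}"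
  have Z0: "0 \<in> Z"
  proof -
    have "?\<pi> \<one> = C [^]\<^bsub>G Mod K\<^esub> (0::int)" using \<pi>.hom_one by (simp only: int_pow_0)
    then show ?thesis using S.one_closed unfolding Z_def by blast
  qed
  have Z_diff: "m - n \<in> Z" if mn: "m \<in> Z" "n \<in> Z" for m n
  proof -
    obtain x y where xy: "x \<in> S" "y \<in> S" "?\<pi> x = C [^]\<^bsub>G Mod K\<^esub> m" "?\<pi> y = C [^]\<^bsub>G Mod K\<^esub> n"
      using mn unfolding Z_def by blast
    have "?\<pi> (x \<otimes> inv y) = ?\<pi> x \<otimes>\<^bsub>G Mod K\<^esub> inv\<^bsub>G Mod K\<^esub> ?\<pi> y"
      using xy(1,2) by (simp only: \<pi>.hom_mult \<pi>.hom_inv S.mem_carrier inv_closed)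
    also have "\<dots> = C [^]\<^bsub>G Mod K\<^esub> (m - n)"
      unfolding xy(3,4) using C(1) by (rule Q.int_pow_diff[symmetric])
    finally show ?thesis using xy(1,2) unfolding Z_def by blast
  qed
  have Z_mult: "c * m \<in> Z" if m: "m \<in> Z" for m c
  proof -
    have neg: "- k \<in> Z" if "k \<in> Z" for k using Z_diff[OF Z0 that] by simp
    have "int k * m \<in> Z" for k
    proof (induction k)
      case (Suc k)
      then have "int k * m - (- m) \<in> Z" using Z_diff neg m by blast
      then show ?case by (simp add: algebra_simps)
    qed (simp add: Z0)
    from this[of "nat \<bar>c\<bar>"] neg[OF this[of "nat \<bar>c\<bar>"]] show ?thesis
      by (cases "c \<ge> 0") simp_all
  qed
  have cov: "\<exists>n\<in>Z. ?\<pi> x = C [^]\<^bsub>G Mod K\<^esub> n" if x: "x \<in> S" for x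
  proof -
    have "?\<pi> x \<in> carrier (G Mod K)" using x by simp
    then show ?thesis using C(2) x unfolding Z_def by blast
  qed
  obtain d where d: "d \<in> Z" "\<And>n. n \<in> Z \<Longrightarrow> d dvd n"
  proof (cases "Z \<subseteq> {0}")
    case True
    then show ?thesis using that[of 0] Z0 by auto
  next
    case False
    then obtain n where n: "n \<in> Z" "n \<noteq> 0" by blast
    have "int (nat \<bar>n\<bar>) = sgn n * n" by (auto simp: sgn_if)
    then have "int (nat \<bar>n\<bar>) \<in> Z" using Z_mult[OF n(1), of "sgn n"] by (simp only:)
    then have ex: "\<exists>k. k > 0 \<and> int k \<in> Z" using n(2) by (intro exI[of _ "nat \<bar>n\<bar>"]) auto
    define k where "k = (LEAST k. k > 0 \<and> int k \<in> Z)"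
    have k: "k > 0" "int k \<in> Z" using LeastI_ex[OF ex] by (auto simp: k_def)
    have "int k dvd m" if m: "m \<in> Z" for m
    proof (rule ccontr)
      assume "\<not> int k dvd m"
      then have "m mod int k \<noteq> 0" by (simp add: dvd_eq_mod_eq_0)
      then have pos: "nat (m mod int k) > 0" "int (nat (m mod int k)) = m mod int k" "nat (m mod int k) < k"
        using pos_mod_sign[of "int k" m] pos_mod_bound[of "int k" m] k(1) by linarith+
      have "m - (m div int k) * int k \<in> Z" by (rule Z_diff[OF m Z_mult[OF k(2)]])
      then have "int (nat (m mod int k)) \<in> Z" unfolding pos(2) by (simp add: minus_div_mult_eq_mod)
      then show False using not_less_Least[of "nat (m mod int k)" "\<lambda>k. k > 0 \<and> int k \<in> Z"] pos
        unfolding k_def by blast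
    qed
    then show ?thesis using that k(2) by blast
  qed
  obtain s where s: "s \<in> S" "?\<pi> s = C [^]\<^bsub>G Mod K\<^esub> d" using d(1) unfolding Z_def by blast
  have "F \<subseteq> generate G F" by (rule subsetI) (rule generate.incl)
  then have FS: "F \<subseteq> S" using F(2) by blast
  then have sub: "insert s F \<subseteq> carrier G" using s(1) S.subset by blast
  have "generate G (insert s F) = S"
  proof
    show "generate G (insert s F) \<subseteq> S" using FS s(1) S by (intro generate_subgroup_incl) auto
    interpret T: subgroup "generate G (insert s F)" G using sub by (rule generate_is_subgroup)
    show "S \<subseteq> generate G (insert s F)"
    proof
      fix x assume x: "x \<in> S"
      obtain n where n: "n \<in> Z" "?\<pi> x = C [^]\<^bsub>G Mod K\<^esub> n" using cov[OF x] by blast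
      obtain c where c: "n = d * c" using d(2)[OF n(1)] by (elim dvdE)
      have "?\<pi> (s [^] c) = (?\<pi> s) [^]\<^bsub>G Mod K\<^esub> c" using s(1) by (intro \<pi>.hom_int_pow) simp
      also have "\<dots> = ?\<pi> x" unfolding s(2) n(2) c using C(1) by (rule Q.int_pow_pow)
      finally have "x \<otimes> inv (s [^] c) \<in> K" using ker[of x "s [^] c"] x s(1) by simp
      moreover have sc: "s [^] c \<in> S" using S s(1) by (rule subgroup_int_pow_closed)
      then have "x \<otimes> inv (s [^] c) \<in> S" using x by blast
      ultimately have "x \<otimes> inv (s [^] c) \<in> generate G F" using F(2) by blast
      then have "x \<otimes> inv (s [^] c) \<in> generate G (insert s F)"
        using mono_generate[of F "insert s F"] by blast
      moreover have "s [^] c \<in> generate G (insert s F)"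
        using T.is_subgroup by (rule subgroup_int_pow_closed) (simp add: generate.incl)
      ultimately have "(x \<otimes> inv (s [^] c)) \<otimes> s [^] c \<in> generate G (insert s F)" by blast
      then show "x \<in> generate G (insert s F)" using x s(1) by (simp add: m_assoc)
    qed
  qed
  then show ?thesis using F(1) by (intro exI[of _ "insert s F"]) simp
qed

text \<open>Induction on \<open>i\<close> for \<open>S \<inter> H i\<close>. Each step takes place
  in the group with carrier \<open>H (Suc i)\<close>, as \<open>H i\<close> is normal only
  there.\<close>

lemma polycyclic_subgroup_finitely_generated:
  assumes "polycyclic G" and S: "subgroup S G"
  shows "\<exists>F. finite F \<and> generate G F = S"
proof -
  obtain n :: nat and H where H: "H 0 = {\<one>}" "H n = carrier G" "\<And>i. i \<le> n \<Longrightarrow> subgroup (H i) G"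
    "\<And>i. i < n \<Longrightarrow> H i \<lhd> G\<lparr>carrier := H (Suc i)\<rparr>"
    "\<And>i. i < n \<Longrightarrow> cyclic_group (G\<lparr>carrier := H (Suc i)\<rparr> Mod H i)"
    using assms(1) unfolding polycyclic_def by blast
  have "i \<le> n \<Longrightarrow> \<exists>F. finite F \<and> generate G F = S \<inter> H i" for i
  proof (induction i)
    case 0
    have "generate G {} = S \<inter> H 0"
      using H(1) subgroup.one_closed[OF S] by (auto simp: generate_empty)
    then show ?case by blast
  next
    case (Suc i)
    let ?L = "G\<lparr>carrier := H (Suc i)\<rparr>"
    have HS: "subgroup (H (Suc i)) G" using H(3) Suc.prems by blast
    interpret L: group ?L using HS by (rule subgroup_imp_group)
    have norm: "H i \<lhd> ?L" using H(4) Suc.prems by simp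
    have sub: "H i \<subseteq> H (Suc i)"
      using subgroup.subset[OF normal_imp_subgroup[OF norm]] by simp
    obtain F where F: "finite F" "generate G F = S \<inter> H i" using Suc by auto
    have FL: "F \<subseteq> H (Suc i)" using F(2) sub generate.incl by fastforce
    have "subgroup (S \<inter> H (Suc i)) ?L"
      using subgroup_incl[OF subgroups_Inter_pair[OF S HS] HS] by simp
    moreover have "generate ?L F = (S \<inter> H (Suc i)) \<inter> H i"
      using generate_consistent[OF FL HS] F(2) sub by auto
    ultimately obtain F' where F': "finite F'" "generate ?L F' = S \<inter> H (Suc i)"
      using L.finitely_generated_extension[OF norm _ _ F(1)] H(5) Suc.prems by (metis Suc_le_lessD)
    have "F' \<subseteq> H (Suc i)" using F'(2) generate.incl by fastforce
    then show ?case using F' generate_consistent[OF _ HS, of F'] by auto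
  qed
  from this[of n] show ?thesis using H(2) subgroup.subset[OF S] by (simp add: Int_absorb2)
qed

end

section \<open>Wreath products with the integers\<close>

text \<open>\<open>G\<close> is isomorphic to the wreath product of the integers with \<open>B\<close>, and \<open>\<phi>\<close> and \<open>\<beta>\<close> are the two
  components. Unlike in \<open>wreath_product\<close>, functions vanish outside \<open>carrier B\<close>.\<close>

locale integer_wreath = group G + B: group B
  for G :: "('a, 'm) monoid_scheme" (structure) and B :: "('b, 'n) monoid_scheme" +
  fixes \<phi> :: "'a \<Rightarrow> 'b \<Rightarrow> int" and \<beta> :: "'a \<Rightarrow> 'b" and elt :: "('b \<Rightarrow> int) \<Rightarrow> 'b \<Rightarrow> 'a"
  assumes \<phi>_fsupp [simp]: "x \<in> carrier G \<Longrightarrow> \<phi> x \<in> B.fsupp"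
    and \<beta>_closed [simp]: "x \<in> carrier G \<Longrightarrow> \<beta> x \<in> carrier B"
    and elt_closed [simp]: "f \<in> B.fsupp \<Longrightarrow> b \<in> carrier B \<Longrightarrow> elt f b \<in> carrier G"
    and \<phi>_elt [simp]: "f \<in> B.fsupp \<Longrightarrow> b \<in> carrier B \<Longrightarrow> \<phi> (elt f b) = f"
    and \<beta>_elt [simp]: "f \<in> B.fsupp \<Longrightarrow> b \<in> carrier B \<Longrightarrow> \<beta> (elt f b) = b"
    and elt_\<phi>_\<beta>: "x \<in> carrier G \<Longrightarrow> elt (\<phi> x) (\<beta> x) = x"
    and \<phi>_mult: "x \<in> carrier G \<Longrightarrow> y \<in> carrier G \<Longrightarrow> \<phi> (x \<otimes> y) = \<phi> x + B.tr (\<beta> x) (\<phi> y)"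
    and \<beta>_mult: "x \<in> carrier G \<Longrightarrow> y \<in> carrier G \<Longrightarrow> \<beta> (x \<otimes> y) = \<beta> x \<otimes>\<^bsub>B\<^esub> \<beta> y"
begin

section \<open>Arithmetic of the two components\<close>

lemma eqI: "x \<in> carrier G \<Longrightarrow> y \<in> carrier G \<Longrightarrow> \<phi> x = \<phi> y \<Longrightarrow> \<beta> x = \<beta> y \<Longrightarrow> x = y"
  by (metis elt_\<phi>_\<beta>)

sublocale \<beta>: group_hom G B \<beta>
  by unfold_locales (auto simp: hom_def \<beta>_mult)

lemma \<phi>_one: "\<phi> \<one> = 0"
proof -
  have "\<phi> \<one> = \<phi> \<one> + B.tr \<one>\<^bsub>B\<^esub> (\<phi> \<one>)" using \<phi>_mult[of \<one> \<one>] by simp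
  then show ?thesis by (simp add: B.tr_one)
qed

lemma \<phi>_inv:
  assumes x: "x \<in> carrier G"
  shows "\<phi> (inv x) = - B.tr (inv\<^bsub>B\<^esub> \<beta> x) (\<phi> x)"
proof -
  have "\<phi> (inv x) + B.tr (inv\<^bsub>B\<^esub> \<beta> x) (\<phi> x) = 0"
    using \<phi>_mult[of "inv x" x] x by (simp add: \<phi>_one)
  then show ?thesis by (simp add: eq_neg_iff_add_eq_0)
qed

lemma \<phi>_mult_inv:
  assumes "x \<in> carrier G" "y \<in> carrier G"
  shows "\<phi> (x \<otimes> inv y) = \<phi> x - B.tr (\<beta> x \<otimes>\<^bsub>B\<^esub> inv\<^bsub>B\<^esub> \<beta> y) (\<phi> y)"
  using assms by (simp add: \<phi>_mult \<phi>_inv B.tr_uminus B.tr_tr)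

lemma \<phi>_conj:
  assumes "k \<in> carrier G" "x \<in> carrier G"
  shows "\<phi> (k \<otimes> x \<otimes> inv k)
    = \<phi> k + B.tr (\<beta> k) (\<phi> x) - B.tr (\<beta> k \<otimes>\<^bsub>B\<^esub> \<beta> x \<otimes>\<^bsub>B\<^esub> inv\<^bsub>B\<^esub> \<beta> k) (\<phi> k)"
  unfolding \<phi>_mult_inv[OF m_closed[OF assms] assms(1)] using assms by (simp add: \<phi>_mult)

text \<open>Since \<open>\<phi>\<close> is a crossed homomorphism, powers produce the norm sums
  controlled by \<open>tr_sum_aug\<close>.\<close>

lemma \<phi>_pow: "x \<in> carrier G \<Longrightarrow> \<phi> (x [^] (n::nat)) = (\<Sum>l<n. B.tr (\<beta> x [^]\<^bsub>B\<^esub> l) (\<phi> x))"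
proof (induction n)
  case 0
  have "\<phi> (x [^] (0::nat)) = (\<Sum>l<(0::nat). B.tr (\<beta> x [^]\<^bsub>B\<^esub> l) (\<phi> x))"
    by (simp add: \<phi>_one)
  then show ?case .
next
  case (Suc n)
  have "\<phi> (x [^] Suc n) = \<phi> (x [^] n) + B.tr (\<beta> x [^]\<^bsub>B\<^esub> n) (\<phi> x)"
    using Suc.prems by (simp add: \<phi>_mult \<beta>.hom_nat_pow)
  also have "\<dots> = (\<Sum>l<Suc n. B.tr (\<beta> x [^]\<^bsub>B\<^esub> l) (\<phi> x))"
    unfolding Suc.IH[OF Suc.prems] by (rule sum.lessThan_Suc[symmetric])
  finally show ?case .
qed

lemma \<phi>_pow_base:
  assumes x: "x \<in> carrier G" "\<beta> x = \<one>\<^bsub>B\<^esub>"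
  shows "\<phi> (x [^] (n::nat)) = scale (int n) (\<phi> x)"
proof (induction n)
  case 0
  have "\<phi> (x [^] (0::nat)) = scale (int 0) (\<phi> x)"
    by (simp add: \<phi>_one scale_def fun_eq_iff)
  then show ?case .
next
  case (Suc n)
  have "\<phi> (x [^] Suc n) = \<phi> (x [^] n) + \<phi> x"
    using x by (simp add: \<phi>_mult \<beta>.hom_nat_pow B.tr_one)
  also have "\<dots> = scale (int (Suc n)) (\<phi> x)"
    unfolding Suc.IH by (simp add: scale_def fun_eq_iff algebra_simps)
  finally show ?case .
qed

lemma \<phi>_int_pow_base:
  assumes x: "x \<in> carrier G" "\<beta> x = \<one>\<^bsub>B\<^esub>"
  shows "\<phi> (x [^] (i::int)) = scale i (\<phi> x)"
proof (cases i rule: int_cases2)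
  case (nonneg n)
  then show ?thesis using \<phi>_pow_base[OF x] by (simp add: int_pow_int)
next
  case (nonpos n)
  have "\<phi> (x [^] i) = - scale (int n) (\<phi> x)"
    using x by (simp add: nonpos int_pow_neg int_pow_int \<phi>_inv \<beta>.hom_nat_pow B.tr_one \<phi>_pow_base
        B.fsupp_closed(4))
  also have "\<dots> = scale i (\<phi> x)" by (simp add: nonpos scale_def fun_eq_iff)
  finally show ?thesis .
qed

text \<open>The kernel of the map to the wreath product of the integers modulo \<open>q\<close> with \<open>B Mod N\<close>.\<close>

definition level :: "'b set \<Rightarrow> int \<Rightarrow> 'a set"
  where "level N q = {x \<in> carrier G. \<beta> x \<in> N \<and> \<phi> x \<in> B.aug N q}"

section \<open>Congruence subgroups of the wreath product\<close>

text \<open>The finite wreath product with this kernel is not constructed. Normality follows from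
  the formula for \<open>\<phi>\<close> on conjugates, where \<open>1 - c\<close> with
  \<open>c\<close> in \<open>N\<close> maps into \<open>aug N q\<close>.\<close>

lemma fin_normal_level:
  assumes N: "fin_normal B N" and q: "q > 0"
  shows "fin_normal G (level N q)"
proof -
  interpret N: normal N B using N by (rule B.fin_normalD)
  have sub: "subgroup (level N q) G"
  proof (rule subgroupI)
    show "level N q \<noteq> {}"
      by (auto simp: level_def \<phi>_one B.zero_aug intro!: exI[of _ \<one>])
    fix x assume x: "x \<in> level N q"
    then show "inv x \<in> level N q"
      by (auto simp: level_def \<phi>_inv intro!: B.aug_closed(1) B.tr_aug N.normal_axioms)
    fix y assume "y \<in> level N q"
    then show "x \<otimes> y \<in> level N q"
      using x by (auto simp: level_def \<phi>_mult intro!: B.aug_closed(2) B.tr_aug N.normal_axioms)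
  qed (auto simp: level_def)
  have "level N q \<lhd> G"
  proof (rule normal_invI[OF sub])
    fix k x assume k: "k \<in> carrier G" and "x \<in> level N q"
    then have x: "x \<in> carrier G" "\<beta> x \<in> N" "\<phi> x \<in> B.aug N q" by (auto simp: level_def)
    have c: "\<beta> k \<otimes>\<^bsub>B\<^esub> \<beta> x \<otimes>\<^bsub>B\<^esub> inv\<^bsub>B\<^esub> \<beta> k \<in> N"
      using k x by (intro N.inv_op_closed2) auto
    have "B.tr (\<beta> k) (\<phi> x) \<in> B.aug N q"
      using N.normal_axioms k x by (intro B.tr_aug) auto
    moreover have "\<phi> k - B.tr (\<beta> k \<otimes>\<^bsub>B\<^esub> \<beta> x \<otimes>\<^bsub>B\<^esub> inv\<^bsub>B\<^esub> \<beta> k) (\<phi> k) \<in> B.aug N q"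
      using c k by (intro B.diff_tr_aug N.is_subgroup) auto
    ultimately have "B.tr (\<beta> k) (\<phi> x)
        + (\<phi> k - B.tr (\<beta> k \<otimes>\<^bsub>B\<^esub> \<beta> x \<otimes>\<^bsub>B\<^esub> inv\<^bsub>B\<^esub> \<beta> k) (\<phi> k)) \<in> B.aug N q"
      by (rule B.aug_closed(2))
    then have "\<phi> (k \<otimes> x \<otimes> inv k) \<in> B.aug N q"
      using k x by (simp add: \<phi>_conj algebra_simps)
    then show "k \<otimes> x \<otimes> inv k \<in> level N q"
      using k x c by (simp add: level_def)
  qed
  moreover have "finite_index G (level N q)"
  \<comment> \<open>The invariant encodes the image in the finite wreath product: the coset of
    \<open>\<beta> x\<close> and the coset sums of \<open>\<phi> x\<close> modulo
    \<open>q\<close>.\<close>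
  proof (rule finite_indexI[OF sub, of "\<lambda>x. (N #>\<^bsub>B\<^esub> \<beta> x, \<lambda>C\<in>rcosets\<^bsub>B\<^esub> N. csum (\<phi> x) C mod q)"])
    have fin: "finite (rcosets\<^bsub>B\<^esub> N)" using B.fin_normalD(3)[OF N] by (simp add: finite_index_def)
    have "(\<lambda>x. (N #>\<^bsub>B\<^esub> \<beta> x, \<lambda>C\<in>rcosets\<^bsub>B\<^esub> N. csum (\<phi> x) C mod q)) ` carrier G
        \<subseteq> (rcosets\<^bsub>B\<^esub> N) \<times> ((rcosets\<^bsub>B\<^esub> N) \<rightarrow>\<^sub>E {0..<q})"
      using q by (auto intro!: B.rcosetsI)
    then show "finite ((\<lambda>x. (N #>\<^bsub>B\<^esub> \<beta> x, \<lambda>C\<in>rcosets\<^bsub>B\<^esub> N. csum (\<phi> x) C mod q)) ` carrier G)"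
      by (rule finite_subset) (intro finite_cartesian_product finite_PiE fin, auto)
    fix x y assume x: "x \<in> carrier G" and y: "y \<in> carrier G"
      and eq: "(N #>\<^bsub>B\<^esub> \<beta> x, \<lambda>C\<in>rcosets\<^bsub>B\<^esub> N. csum (\<phi> x) C mod q)
        = (N #>\<^bsub>B\<^esub> \<beta> y, \<lambda>C\<in>rcosets\<^bsub>B\<^esub> N. csum (\<phi> y) C mod q)"
    have "\<beta> x \<in> N #>\<^bsub>B\<^esub> \<beta> y"
      using eq x B.rcos_self[of "\<beta> x" N] N.is_subgroup by simp
    then have \<beta>: "\<beta> x \<otimes>\<^bsub>B\<^esub> inv\<^bsub>B\<^esub> \<beta> y \<in> N"
      using B.mem_rcos_iff[OF N.is_subgroup] x y by simp
    have "csum (\<phi> x) (N #>\<^bsub>B\<^esub> g) mod q = csum (\<phi> y) (N #>\<^bsub>B\<^esub> g) mod q" if g: "g \<in> carrier B" for g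
    proof -
      have "N #>\<^bsub>B\<^esub> g \<in> rcosets\<^bsub>B\<^esub> N" using g N.subset by (intro B.rcosetsI)
      moreover have "(\<lambda>C\<in>rcosets\<^bsub>B\<^esub> N. csum (\<phi> x) C mod q) = (\<lambda>C\<in>rcosets\<^bsub>B\<^esub> N. csum (\<phi> y) C mod q)"
        using eq by simp
      ultimately show ?thesis by (metis (no_types, lifting) restrict_apply')
    qed
    then have "\<phi> x - \<phi> y \<in> B.aug N q"
      using x y by (auto simp: B.aug_def B.fsupp_closed(3) csum_diff B.finite_supp mod_eq_dvd_iff)
    moreover have "\<phi> y - B.tr (\<beta> x \<otimes>\<^bsub>B\<^esub> inv\<^bsub>B\<^esub> \<beta> y) (\<phi> y) \<in> B.aug N q"
      using \<beta> y by (intro B.diff_tr_aug N.is_subgroup) auto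
    ultimately have "(\<phi> x - \<phi> y) + (\<phi> y - B.tr (\<beta> x \<otimes>\<^bsub>B\<^esub> inv\<^bsub>B\<^esub> \<beta> y) (\<phi> y)) \<in> B.aug N q"
      by (rule B.aug_closed(2))
    then have "\<phi> (x \<otimes> inv y) \<in> B.aug N q"
      using x y by (simp add: \<phi>_mult_inv)
    then show "x \<otimes> inv y \<in> level N q" using x y \<beta> by (simp add: level_def)
  qed
  ultimately show ?thesis by (simp add: fin_normal_def)
qed

lemma elt_mult:
  assumes "f \<in> B.fsupp" "g \<in> B.fsupp" "b \<in> carrier B" "c \<in> carrier B"
  shows "elt f b \<otimes> elt g c = elt (f + B.tr b g) (b \<otimes>\<^bsub>B\<^esub> c)"
proof -
  have "f + B.tr b g \<in> B.fsupp" using assms by (intro B.fsupp_closed(2) B.tr_fsupp)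
  then show ?thesis using assms by (intro eqI) (auto simp: \<phi>_mult)
qed

text \<open>\<open>N\<close> consists of the elements of the complement \<open>B\<close> that lie in
  \<open>K\<close>, and \<open>q\<close> is an exponent of the quotient by \<open>K\<close>. Both
  kinds of generators of \<open>aug N q\<close> then lie in \<open>K\<close>: \<open>d g - g\<close>
  is the commutator of \<open>d\<close> with the base element at \<open>g\<close>, and
  \<open>q g\<close> is a \<open>q\<close>-th power.\<close>

lemma level_subset:
  assumes K: "fin_normal G K"
  obtains N q where "fin_normal B N" "(q::nat) > 0" "level N (int q) \<subseteq> K"
proof -
  interpret K: normal K G using K by (rule fin_normalD)
  let ?s = "elt 0"
  have s_hom: "?s \<in> hom B G"
    by (auto simp: hom_def B.zero_fsupp elt_mult B.tr_zero)
  interpret s: group_hom B G ?s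
    using s_hom by (simp add: group_hom_def group_hom_axioms_def B.is_group)
  define N where "N = {b \<in> carrier B. ?s b \<in> K}"
  have subN: "subgroup N B"
    by (rule B.subgroupI) (auto simp: N_def intro!: exI[of _ "\<one>\<^bsub>B\<^esub>"])
  have "N \<lhd> B"
    by (rule B.normal_invI[OF subN]) (auto simp: N_def K.inv_op_closed2)
  moreover have "finite_index B N"
  proof (rule B.finite_indexI[OF subN, of "\<lambda>b. K #> ?s b"])
    have "(\<lambda>b. K #> ?s b) ` carrier B \<subseteq> rcosets K"
      using K.subset by (auto intro!: rcosetsI)
    then show "finite ((\<lambda>b. K #> ?s b) ` carrier B)"
      using fin_normalD(3)[OF K] by (auto simp: finite_index_def intro: finite_subset)
    fix x y assume x: "x \<in> carrier B" and y: "y \<in> carrier B" and eq: "K #> ?s x = K #> ?s y"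
    have "?s x \<in> K #> ?s y" using rcos_self[of "?s x" K] K.is_subgroup x eq by simp
    then have "?s x \<otimes> inv (?s y) \<in> K" using x y mem_rcos_iff[OF K.is_subgroup] by simp
    then show "x \<otimes>\<^bsub>B\<^esub> inv\<^bsub>B\<^esub> y \<in> N" using x y by (simp add: N_def)
  qed
  ultimately have N: "fin_normal B N" by (simp add: fin_normal_def)
  obtain q :: nat where q: "q > 0" "\<And>x. x \<in> carrier G \<Longrightarrow> x [^] q \<in> K"
    using fin_normal_pow[OF K] by blast
  define V where "V = {f \<in> B.fsupp. elt f \<one>\<^bsub>B\<^esub> \<in> K}"
  have V: "additive V"
    unfolding additive_def
  proof (intro conjI ballI)
    have "elt 0 \<one>\<^bsub>B\<^esub> = \<one>" by (rule s.hom_one)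
    then show "0 \<in> V" by (simp add: V_def B.zero_fsupp)
    fix f g assume "f \<in> V" "g \<in> V"
    then have f: "f \<in> B.fsupp" "elt f \<one>\<^bsub>B\<^esub> \<in> K" and g: "g \<in> B.fsupp" "elt g \<one>\<^bsub>B\<^esub> \<in> K"
      by (auto simp: V_def)
    have fg: "f - g \<in> B.fsupp" using f(1) g(1) by (rule B.fsupp_closed(3))
    have "elt (f - g) \<one>\<^bsub>B\<^esub> = elt f \<one>\<^bsub>B\<^esub> \<otimes> inv (elt g \<one>\<^bsub>B\<^esub>)"
      using f g fg by (intro eqI) (auto simp: \<phi>_mult_inv B.tr_one)
    then show "f - g \<in> V" using f g fg by (simp add: V_def)
  qed
  have "f \<in> V" if f: "f \<in> B.aug N (int q)" for f
    using subN f V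
  proof (rule B.aug_induct)
    fix d g assume d: "d \<in> N" and g: "g \<in> carrier B"
    have dB: "d \<in> carrier B" and sd: "?s d \<in> K" using d by (auto simp: N_def)
    define y where "y = elt (point g) \<one>\<^bsub>B\<^esub>"
    have y: "y \<in> carrier G" "\<phi> y = point g" "\<beta> y = \<one>\<^bsub>B\<^esub>"
      using g by (simp_all add: y_def B.point_fsupp)
    have F: "point (d \<otimes>\<^bsub>B\<^esub> g) - point g \<in> B.fsupp"
      using dB g by (intro B.fsupp_closed(3) B.point_fsupp) auto
    have "?s d \<otimes> y \<otimes> inv (?s d) \<otimes> inv y \<in> K"
    proof -
      have "?s d \<otimes> (y \<otimes> inv (?s d) \<otimes> inv y) \<in> K"
        using sd y by (intro K.m_closed K.inv_op_closed2) auto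
      then show ?thesis using dB y by (simp add: m_assoc B.zero_fsupp)
    qed
    also have "?s d \<otimes> y \<otimes> inv (?s d) \<otimes> inv y = elt (point (d \<otimes>\<^bsub>B\<^esub> g) - point g) \<one>\<^bsub>B\<^esub>"
      using F dB g y
      by (intro eqI) (auto simp: B.zero_fsupp \<phi>_inv \<phi>_mult B.tr_zero B.tr_uminus B.tr_one B.tr_point B.point_fsupp)
    finally show "point (d \<otimes>\<^bsub>B\<^esub> g) - point g \<in> V" using F by (simp add: V_def)
  next
    fix g assume g: "g \<in> carrier B"
    define y where "y = elt (point g) \<one>\<^bsub>B\<^esub>"
    have y: "y \<in> carrier G" "\<phi> y = point g" "\<beta> y = \<one>\<^bsub>B\<^esub>"
      using g by (simp_all add: y_def B.point_fsupp)
    have F: "scale (int q) (point g) \<in> B.fsupp"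
      using g by (intro B.fsupp_closed(4) B.point_fsupp)
    have "elt (scale (int q) (point g)) \<one>\<^bsub>B\<^esub> = y [^] q"
      using F y by (intro eqI) (auto simp: \<phi>_pow_base \<beta>.hom_nat_pow)
    then show "scale (int q) (point g) \<in> V" using q(2)[OF y(1)] F by (simp add: V_def)
  qed
  then have "level N (int q) \<subseteq> K"
  proof (intro subsetI)
    fix x assume "x \<in> level N (int q)"
    then have x: "x \<in> carrier G" "?s (\<beta> x) \<in> K" "\<phi> x \<in> B.aug N (int q)"
      by (auto simp: level_def N_def)
    have "elt (\<phi> x) \<one>\<^bsub>B\<^esub> \<in> K" using \<open>\<And>f. f \<in> B.aug N (int q) \<Longrightarrow> f \<in> V\<close>[OF x(3)] by (simp add: V_def)
    then have "elt (\<phi> x) \<one>\<^bsub>B\<^esub> \<otimes> ?s (\<beta> x) \<in> K" using x by blast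
    also have "elt (\<phi> x) \<one>\<^bsub>B\<^esub> \<otimes> ?s (\<beta> x) = x"
      using x by (simp add: elt_mult B.zero_fsupp B.tr_zero elt_\<phi>_\<beta>)
    finally show "x \<in> K" .
  qed
  then show ?thesis using that N q by blast
qed

section \<open>Closed orbits in the wreath product\<close>

text \<open>In a finite quotient a conjugator brings \<open>\<beta> x\<close> only close to
  \<open>c\<close>. Before \<open>orbit_cobound_closed\<close> applies, its second component must be
  replaced by one that reaches \<open>c\<close> exactly and differs from it by an element of
  \<open>N\<close>.\<close>

lemma orbit_closed_level:
  assumes oc: "orbits_closed B" and css: "cyclic_subgroup_separable B" and tf: "torsion_free B"
    and N0: "fin_normal B N\<^sub>0" and q: "(q::nat) > 0" and x: "x \<in> carrier G"
  shows "orbit_closed G (level N\<^sub>0 (int q)) x"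
  unfolding orbit_closed_def
proof (intro ballI impI)
  fix y assume y: "y \<in> carrier G" and ne: "\<forall>k\<in>level N\<^sub>0 (int q). y \<noteq> k \<otimes> x \<otimes> inv k"
  interpret N0: normal N\<^sub>0 B using N0 by (rule B.fin_normalD)
  define b where "b = \<beta> x"
  define c where "c = \<beta> y"
  define n where "n = \<phi> y"
  have bB: "b \<in> carrier B" and cB: "c \<in> carrier B" and nF: "n \<in> B.fsupp"
    using x y by (auto simp: b_def c_def n_def)
  show "\<exists>L. fin_normal G L \<and> (\<forall>k\<in>level N\<^sub>0 (int q). y \<otimes> inv (k \<otimes> x \<otimes> inv k) \<notin> L)"
  proof (cases "\<forall>d\<in>N\<^sub>0. c \<noteq> d \<otimes>\<^bsub>B\<^esub> b \<otimes>\<^bsub>B\<^esub> inv\<^bsub>B\<^esub> d")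
    case True
    then obtain L where L: "fin_normal B L"
      "\<And>d. d \<in> N\<^sub>0 \<Longrightarrow> c \<otimes>\<^bsub>B\<^esub> inv\<^bsub>B\<^esub> (d \<otimes>\<^bsub>B\<^esub> b \<otimes>\<^bsub>B\<^esub> inv\<^bsub>B\<^esub> d) \<notin> L"
      using oc N0 bB cB unfolding orbits_closed_def orbit_closed_def by blast
    \<comment> \<open>Modulus 1 leaves the base component unrestricted, so only the second
      components are compared.\<close>
    have "y \<otimes> inv (k \<otimes> x \<otimes> inv k) \<notin> level L 1" if k: "k \<in> level N\<^sub>0 (int q)" for k
    proof
      have kG: "k \<in> carrier G" "\<beta> k \<in> N\<^sub>0" using k by (auto simp: level_def)
      assume "y \<otimes> inv (k \<otimes> x \<otimes> inv k) \<in> level L 1"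
      then have "\<beta> (y \<otimes> inv (k \<otimes> x \<otimes> inv k)) \<in> L" by (simp add: level_def)
      then show False using L(2)[OF kG(2)] kG x y by (simp add: b_def c_def)
    qed
    then show ?thesis using fin_normal_level[OF L(1), of 1] by auto
  next
    case False
    then obtain d0 where d0: "d0 \<in> N\<^sub>0" "c = d0 \<otimes>\<^bsub>B\<^esub> b \<otimes>\<^bsub>B\<^esub> inv\<^bsub>B\<^esub> d0" by blast
    have d0B: "d0 \<in> carrier B" using d0 by simp
    define m where "m = B.tr d0 (\<phi> x)"
    have mF: "m \<in> B.fsupp" using x d0B by (simp add: m_def B.tr_fsupp)
    \<comment> \<open>Otherwise \<open>n - e m = (1 - c) u\<close>, and \<open>(u, e d0)\<close>
      would be a forbidden conjugator.\<close>
    have "n - B.tr e m \<notin> B.cobound c (B.aug N\<^sub>0 (int q))"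
      if e: "e \<in> N\<^sub>0" "e \<otimes>\<^bsub>B\<^esub> c = c \<otimes>\<^bsub>B\<^esub> e" for e
    proof
      assume "n - B.tr e m \<in> B.cobound c (B.aug N\<^sub>0 (int q))"
      then obtain u where u: "u \<in> B.aug N\<^sub>0 (int q)" "n - B.tr e m = u - B.tr c u"
        by (auto simp: B.cobound_def)
      have eB: "e \<in> carrier B" using e(1) by simp
      have uF: "u \<in> B.fsupp" using u(1) by (rule B.aug_fsupp)
      define k where "k = elt u (e \<otimes>\<^bsub>B\<^esub> d0)"
      have k: "k \<in> carrier G" "\<phi> k = u" "\<beta> k = e \<otimes>\<^bsub>B\<^esub> d0"
        using uF eB d0B by (simp_all add: k_def)
      have "e \<otimes>\<^bsub>B\<^esub> d0 \<otimes>\<^bsub>B\<^esub> b \<otimes>\<^bsub>B\<^esub> inv\<^bsub>B\<^esub> (e \<otimes>\<^bsub>B\<^esub> d0) = e \<otimes>\<^bsub>B\<^esub> c \<otimes>\<^bsub>B\<^esub> inv\<^bsub>B\<^esub> e"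
        unfolding d0(2) using eB d0B bB by (rule B.conj_by_product)
      also have "\<dots> = c" unfolding e(2) using eB cB by (simp add: B.m_assoc)
      finally have c_eq: "e \<otimes>\<^bsub>B\<^esub> d0 \<otimes>\<^bsub>B\<^esub> b \<otimes>\<^bsub>B\<^esub> inv\<^bsub>B\<^esub> (e \<otimes>\<^bsub>B\<^esub> d0) = c" .
      have "\<phi> (k \<otimes> x \<otimes> inv k) = u + B.tr (e \<otimes>\<^bsub>B\<^esub> d0) (\<phi> x) - B.tr c u"
        using \<phi>_conj[OF k(1) x] c_eq by (simp only: k b_def)
      also have "B.tr (e \<otimes>\<^bsub>B\<^esub> d0) (\<phi> x) = B.tr e m"
        using eB d0B by (simp add: m_def B.tr_tr)
      also have "u + B.tr e m - B.tr c u = n" using u(2) by (simp add: algebra_simps)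
      finally have "\<phi> (k \<otimes> x \<otimes> inv k) = \<phi> y" by (simp add: n_def)
      moreover have "\<beta> (k \<otimes> x \<otimes> inv k) = \<beta> y"
        using k x c_eq by (simp add: b_def c_def)
      ultimately have "y = k \<otimes> x \<otimes> inv k" using k x y by (intro eqI) auto
      moreover have "k \<in> level N\<^sub>0 (int q)" using k e(1) d0(1) u(1) by (simp add: level_def)
      ultimately show False using ne by blast
    qed
    then obtain N r where N: "fin_normal B N" "(r::nat) > 0"
      and Nr: "\<And>e u. e \<in> N\<^sub>0 \<Longrightarrow> e \<otimes>\<^bsub>B\<^esub> c = c \<otimes>\<^bsub>B\<^esub> e \<Longrightarrow> u \<in> B.aug N\<^sub>0 (int q) \<Longrightarrow>
        n - B.tr e m - (u - B.tr c u) \<notin> B.aug N (int r)"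
      using B.orbit_cobound_closed[OF css tf cB N0 q mF nF] by blast
    interpret N: normal N B using N(1) by (rule B.fin_normalD)
    \<comment> \<open>Corrections of the conjugator must lie in \<open>N\<close> to be harmless and
      in \<open>N\<^sub>0\<close> to keep it admissible.\<close>
    define N1 where "N1 = N \<inter> N\<^sub>0"
    have N1: "fin_normal B N1" unfolding N1_def using N(1) N0 by (rule B.fin_normal_Int)
    interpret N1: normal N1 B using N1 by (rule B.fin_normalD)
    obtain T where T: "finite T" "T \<subseteq> N\<^sub>0" "\<And>d. d \<in> N\<^sub>0 \<Longrightarrow> \<exists>t\<in>T. d \<otimes>\<^bsub>B\<^esub> inv\<^bsub>B\<^esub> t \<in> N1"
      using B.finite_coset_representatives[OF B.fin_normalD(2,3)[OF N1] N0.subset] by blast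
    \<comment> \<open>For each of the finitely many \<open>t\<close>, either \<open>c\<close> lies
      in the \<open>N1\<close>-orbit of \<open>t b t^-1\<close> or \<open>L\<close> keeps it away
      from that whole orbit. So closeness modulo \<open>L\<close> gives an exact equality.\<close>
    define Good where "Good t L \<longleftrightarrow>
      (\<forall>\<nu>\<in>N1. c \<noteq> \<nu> \<otimes>\<^bsub>B\<^esub> (t \<otimes>\<^bsub>B\<^esub> b \<otimes>\<^bsub>B\<^esub> inv\<^bsub>B\<^esub> t) \<otimes>\<^bsub>B\<^esub> inv\<^bsub>B\<^esub> \<nu>) \<longrightarrow>
      (\<forall>\<nu>\<in>N1. c \<otimes>\<^bsub>B\<^esub> inv\<^bsub>B\<^esub> (\<nu> \<otimes>\<^bsub>B\<^esub> (t \<otimes>\<^bsub>B\<^esub> b \<otimes>\<^bsub>B\<^esub> inv\<^bsub>B\<^esub> t) \<otimes>\<^bsub>B\<^esub> inv\<^bsub>B\<^esub> \<nu>) \<notin> L)" for t L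
    have "\<exists>L. fin_normal B L \<and> (\<forall>t\<in>T. Good t L)"
    proof (rule B.fin_normal_common[OF T(1)])
      fix t assume "t \<in> T"
      then have "t \<otimes>\<^bsub>B\<^esub> b \<otimes>\<^bsub>B\<^esub> inv\<^bsub>B\<^esub> t \<in> carrier B" using T(2) bB by auto
      then have "orbit_closed B N1 (t \<otimes>\<^bsub>B\<^esub> b \<otimes>\<^bsub>B\<^esub> inv\<^bsub>B\<^esub> t)"
        using oc N1 by (simp add: orbits_closed_def)
      then show "\<exists>L. fin_normal B L \<and> Good t L"
        using cB B.fin_normal_carrier unfolding orbit_closed_def Good_def by blast
    next
      fix t L M assume "Good t L" "M \<subseteq> L"
      then show "Good t M" unfolding Good_def by blast
    qed
    then obtain L where L: "fin_normal B L" "\<And>t. t \<in> T \<Longrightarrow> Good t L" by blast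
    define M where "M = N1 \<inter> L"
    have M: "fin_normal B M" unfolding M_def using N1 L(1) by (rule B.fin_normal_Int)
    interpret M: normal M B using M by (rule B.fin_normalD)
    have "y \<otimes> inv (k \<otimes> x \<otimes> inv k) \<notin> level M (int r)" if k: "k \<in> level N\<^sub>0 (int q)" for k
    proof
      assume w: "y \<otimes> inv (k \<otimes> x \<otimes> inv k) \<in> level M (int r)"
      define d where "d = \<beta> k"
      define u where "u = \<phi> k"
      have kG: "k \<in> carrier G" and d: "d \<in> N\<^sub>0" and u: "u \<in> B.aug N\<^sub>0 (int q)"
        using k by (auto simp: level_def d_def u_def)
      have dB: "d \<in> carrier B" using d by simp
      have uF: "u \<in> B.fsupp" using u by (rule B.aug_fsupp)
      define c' where "c' = d \<otimes>\<^bsub>B\<^esub> b \<otimes>\<^bsub>B\<^esub> inv\<^bsub>B\<^esub> d"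
      have c'B: "c' \<in> carrier B" using dB bB by (simp add: c'_def)
      have xG: "k \<otimes> x \<otimes> inv k \<in> carrier G" using kG x by simp
      define z where "z = \<phi> (k \<otimes> x \<otimes> inv k)"
      have zF: "z \<in> B.fsupp" using xG by (simp add: z_def)
      have z: "z = u + B.tr d (\<phi> x) - B.tr c' u"
        using \<phi>_conj[OF kG x] by (simp only: z_def u_def c'_def d_def b_def)
      have \<beta>z: "\<beta> (k \<otimes> x \<otimes> inv k) = c'" using kG x by (simp add: c'_def d_def b_def)
      define \<mu>' where "\<mu>' = c \<otimes>\<^bsub>B\<^esub> inv\<^bsub>B\<^esub> c'"
      have \<mu>'M: "\<mu>' \<in> M" and \<phi>w: "n - B.tr \<mu>' z \<in> B.aug M (int r)"
        using w xG y \<beta>z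
        by (simp_all add: level_def \<mu>'_def c_def n_def z_def \<phi>_mult_inv)
      obtain t where t: "t \<in> T" "d \<otimes>\<^bsub>B\<^esub> inv\<^bsub>B\<^esub> t \<in> N1" using T(3)[OF d] by blast
      have tN0: "t \<in> N\<^sub>0" using t(1) T(2) by blast
      then have tB: "t \<in> carrier B" by simp
      define \<nu> where "\<nu> = d \<otimes>\<^bsub>B\<^esub> inv\<^bsub>B\<^esub> t"
      have \<nu>: "\<nu> \<in> N1" "\<nu> \<in> carrier B" using t(2) dB tB by (auto simp: \<nu>_def)
      have d_eq: "d = \<nu> \<otimes>\<^bsub>B\<^esub> t" using dB tB by (simp add: \<nu>_def B.m_assoc)
      have "c' = \<nu> \<otimes>\<^bsub>B\<^esub> (t \<otimes>\<^bsub>B\<^esub> b \<otimes>\<^bsub>B\<^esub> inv\<^bsub>B\<^esub> t) \<otimes>\<^bsub>B\<^esub> inv\<^bsub>B\<^esub> \<nu>"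
        unfolding c'_def d_eq using \<nu>(2) tB bB by (rule B.conj_by_product)
      moreover have "\<mu>' \<in> L" using \<mu>'M by (simp add: M_def)
      ultimately obtain \<nu>' where \<nu>': "\<nu>' \<in> N1"
        "c = \<nu>' \<otimes>\<^bsub>B\<^esub> (t \<otimes>\<^bsub>B\<^esub> b \<otimes>\<^bsub>B\<^esub> inv\<^bsub>B\<^esub> t) \<otimes>\<^bsub>B\<^esub> inv\<^bsub>B\<^esub> \<nu>'"
        using L(2)[OF t(1)] \<nu>(1) unfolding Good_def \<mu>'_def by blast
      have \<nu>'B: "\<nu>' \<in> carrier B" "\<nu>' \<in> N\<^sub>0" using \<nu>'(1) by (auto simp: N1_def)
      \<comment> \<open>Both \<open>\<nu>' t\<close> and \<open>d0\<close> conjugate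
        \<open>b\<close> to \<open>c\<close>, so \<open>e\<close> centralises \<open>c\<close>; and
        \<open>d = \<mu> e d0\<close> with \<open>\<mu> = \<nu> \<nu>'^-1\<close> in
        \<open>N\<close>.\<close>
      define e where "e = \<nu>' \<otimes>\<^bsub>B\<^esub> t \<otimes>\<^bsub>B\<^esub> inv\<^bsub>B\<^esub> d0"
      have eB: "e \<in> carrier B" using \<nu>'B tB d0B by (simp add: e_def)
      have eN0: "e \<in> N\<^sub>0" using \<nu>'B tN0 d0(1) by (simp add: e_def)
      have ec: "e \<otimes>\<^bsub>B\<^esub> c = c \<otimes>\<^bsub>B\<^esub> e"
      proof -
        have "e \<otimes>\<^bsub>B\<^esub> c = \<nu>' \<otimes>\<^bsub>B\<^esub> t \<otimes>\<^bsub>B\<^esub> b \<otimes>\<^bsub>B\<^esub> inv\<^bsub>B\<^esub> d0"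
          unfolding e_def d0(2) using \<nu>'B tB d0B bB by (simp add: B.m_assoc B.inv_mult_cancel)
        moreover have "c \<otimes>\<^bsub>B\<^esub> e = \<nu>' \<otimes>\<^bsub>B\<^esub> t \<otimes>\<^bsub>B\<^esub> b \<otimes>\<^bsub>B\<^esub> inv\<^bsub>B\<^esub> d0"
          unfolding e_def \<nu>'(2) using \<nu>'B tB d0B bB by (simp add: B.m_assoc B.inv_mult_cancel)
        ultimately show ?thesis by simp
      qed
      define \<mu> where "\<mu> = \<nu> \<otimes>\<^bsub>B\<^esub> inv\<^bsub>B\<^esub> \<nu>'"
      have \<mu>: "\<mu> \<in> N" "\<mu> \<in> carrier B" using \<nu> \<nu>' by (auto simp: \<mu>_def N1_def)
      have d_eq': "d = \<mu> \<otimes>\<^bsub>B\<^esub> (e \<otimes>\<^bsub>B\<^esub> d0)"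
        unfolding d_eq \<mu>_def e_def using \<nu>(2) \<nu>'B tB d0B by (simp add: B.m_assoc B.inv_mult_cancel)
      have tr_d: "B.tr d (\<phi> x) = B.tr \<mu> (B.tr e m)"
        unfolding d_eq' m_def using \<mu>(2) eB d0B by (simp add: B.tr_tr)
      have MN: "M \<subseteq> N" by (auto simp: M_def N1_def)
      have \<mu>'N: "\<mu>' \<in> N" using \<mu>'M MN by blast
      \<comment> \<open>\<open>\<mu>\<close> and \<open>\<mu>'\<close> lie in \<open>N\<close>, so
        modulo \<open>aug N r\<close> they can be removed, while \<open>\<mu>' c' = c\<close> turns
        \<open>c' u\<close> into \<open>c u\<close>.\<close>
      have "n - B.tr \<mu>' z \<in> B.aug N (int r)"
        using \<phi>w B.aug_mono[OF M.is_subgroup N.is_subgroup MN dvd_refl] by blast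
      moreover have "B.tr \<mu>' z - z \<in> B.aug N (int r)"
        by (rule B.tr_diff_aug[OF N.is_subgroup \<mu>'N zF])
      moreover have "B.tr \<mu> (B.tr e m) - B.tr e m \<in> B.aug N (int r)"
        using B.tr_fsupp[OF eB mF] by (rule B.tr_diff_aug[OF N.is_subgroup \<mu>(1)])
      moreover have "B.tr \<mu>' (B.tr c' u) - B.tr c' u \<in> B.aug N (int r)"
        using B.tr_fsupp[OF c'B uF] by (rule B.tr_diff_aug[OF N.is_subgroup \<mu>'N])
      ultimately have "((n - B.tr \<mu>' z) + (B.tr \<mu>' z - z)) + ((B.tr \<mu> (B.tr e m) - B.tr e m)
          + (B.tr \<mu>' (B.tr c' u) - B.tr c' u)) \<in> B.aug N (int r)"
        by (intro B.aug_closed(2))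
      moreover have "B.tr \<mu>' (B.tr c' u) = B.tr c u"
        using c'B cB by (simp add: \<mu>'_def B.tr_tr B.m_assoc)
      moreover have "((n - B.tr \<mu>' z) + (B.tr \<mu>' z - z)) + ((B.tr \<mu> (B.tr e m) - B.tr e m)
          + (B.tr c u - B.tr c' u)) = n - B.tr e m - (u - B.tr c u)"
        by (simp add: z tr_d algebra_simps)
      ultimately have "n - B.tr e m - (u - B.tr c u) \<in> B.aug N (int r)" by metis
      then show False using Nr[OF eN0 ec u] by blast
    qed
    then show ?thesis using fin_normal_level[OF M, of "int r"] N(2) by auto
  qed
qed

lemma orbits_closed_wreath:
  assumes "orbits_closed B" "cyclic_subgroup_separable B" "torsion_free B"
  shows "orbits_closed G"
  unfolding orbits_closed_def
proof (intro allI impI)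
  fix K x assume K: "fin_normal G K" and x: "x \<in> carrier G"
  obtain N q where Nq: "fin_normal B N" "(q::nat) > 0" "level N (int q) \<subseteq> K"
    using level_subset[OF K] .
  show "orbit_closed G K x"
  proof (rule orbit_closed_supergroup[OF _ fin_normalD(2)[OF K] Nq(3) orbit_closed_level[OF assms Nq(1,2)] x])
    show "fin_normal G (level N (int q))" using Nq(1,2) by (simp add: fin_normal_level)
  qed
qed


section \<open>Torsion-freeness and cyclic subgroup separability of the wreath product\<close>

lemma torsion_free_wreath:
  assumes "torsion_free B" shows "torsion_free G"
  unfolding torsion_free_def
proof (intro ballI allI impI)
  fix x and n :: nat assume x: "x \<in> carrier G" and n: "n > 0" and eq: "x [^] n = \<one>"
  have "\<beta> x [^]\<^bsub>B\<^esub> n = \<one>\<^bsub>B\<^esub>" using \<beta>.hom_nat_pow[OF x, of n] eq by simp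
  then have \<beta>x: "\<beta> x = \<one>\<^bsub>B\<^esub>" using B.torsion_freeD[OF assms] x n by simp
  have "scale (int n) (\<phi> x) = 0" using \<phi>_pow_base[OF x \<beta>x, of n] eq by (simp add: \<phi>_one)
  then have "\<phi> x = 0" using n by (auto simp: scale_def fun_eq_iff)
  then show "x = \<one>" using x \<beta>x by (intro eqI) (auto simp: \<phi>_one)
qed

text \<open>A nonzero coefficient \<open>m s\<close> controls the factor. If it does not divide
  \<open>n s\<close>, the modulus \<open>\<bar>m s\<bar>\<close> suffices. If
  \<open>n s = l m s\<close>, a congruence modulo \<open>\<bar>m s\<bar> r3\<close> forces
  \<open>i\<close> and \<open>l\<close> to agree modulo \<open>r3\<close>, so it is enough that
  \<open>r3\<close> detects \<open>n - l m\<close>.\<close>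

lemma separate_multiples:
  assumes css: "cyclic_subgroup_separable B" and m: "m \<in> B.fsupp" and n: "n \<in> B.fsupp"
    and ne: "\<And>i. n \<noteq> scale i m"
  obtains N r where "fin_normal B N" "(r::nat) > 0" "\<And>i. n - scale i m \<notin> B.aug N (int r)"
proof (cases "m = 0")
  case True
  have z: "scale i m = 0" for i by (simp add: True scale_def fun_eq_iff)
  then have "n \<noteq> 0" using ne by metis
  then obtain N r where "fin_normal B N" "(r::nat) > 0" "n \<notin> B.aug N (int r)"
    using B.separate_zero[OF css n] by blast
  then show ?thesis using that[of N r] z by simp
next
  case False
  then obtain s where s: "m s \<noteq> 0" by (auto simp: fun_eq_iff)
  have sB: "s \<in> carrier B" using m s by (rule B.fsupp_carrier)
  obtain N1 where N1: "fin_normal B N1"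
    "\<And>M. fin_normal B M \<Longrightarrow> M \<subseteq> N1 \<Longrightarrow> csum m (M #>\<^bsub>B\<^esub> s) = m s"
    using B.separate_point[OF css m sB] by blast
  obtain N2 where N2: "fin_normal B N2"
    "\<And>M. fin_normal B M \<Longrightarrow> M \<subseteq> N2 \<Longrightarrow> csum n (M #>\<^bsub>B\<^esub> s) = n s"
    using B.separate_point[OF css n sB] by blast
  have N12: "fin_normal B (N1 \<inter> N2)" using N1(1) N2(1) by (rule B.fin_normal_Int)
  have key: "int r dvd n s - i * m s"
    if M: "fin_normal B M" "M \<subseteq> N1 \<inter> N2" and mem: "n - scale i m \<in> B.aug M (int r)" for M i r
  proof -
    have "int r dvd csum (n - scale i m) (M #>\<^bsub>B\<^esub> s)" using mem sB by (auto simp: B.aug_def)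
    also have "csum (n - scale i m) (M #>\<^bsub>B\<^esub> s) = csum n (M #>\<^bsub>B\<^esub> s) - csum (scale i m) (M #>\<^bsub>B\<^esub> s)"
      using n m by (intro csum_diff B.finite_supp B.fsupp_closed(4))
    also have "\<dots> = n s - i * m s" using M N1(2)[of M] N2(2)[of M] by (simp add: csum_scale)
    finally show ?thesis .
  qed
  define p where "p = nat \<bar>m s\<bar>"
  have p: "p > 0" "int p dvd k * m s" "int p dvd k \<longleftrightarrow> m s dvd k" for k
    using s by (auto simp: p_def)
  show ?thesis
  proof (cases "m s dvd n s")
    case F: False
    have "n - scale i m \<notin> B.aug (N1 \<inter> N2) (int p)" for i
    proof
      assume "n - scale i m \<in> B.aug (N1 \<inter> N2) (int p)"
      then have "int p dvd n s - i * m s" using key[OF N12 order_refl] by blast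
      then have "int p dvd n s" using p(2)[of i] by (metis dvd_diffD dvd_diff_commute diff_add_cancel dvd_add)
      then show False using F p(3) by blast
    qed
    then show ?thesis using that N12 p(1) by blast
  next
    case True
    then obtain l where l: "n s = m s * l" by (elim dvdE)
    define w where "w = n - scale l m"
    have wF: "w \<in> B.fsupp" unfolding w_def by (intro B.fsupp_closed(3)[OF n] B.fsupp_closed(4)[OF m])
    have "w \<noteq> 0" using ne[of l] by (simp add: w_def)
    then obtain N3 r3 where N3: "fin_normal B N3" "(r3::nat) > 0" "w \<notin> B.aug N3 (int r3)"
      using B.separate_zero[OF css wF] by blast
    define N where "N = (N1 \<inter> N2) \<inter> N3"
    have N: "fin_normal B N" unfolding N_def using N12 N3(1) by (rule B.fin_normal_Int)
    have "n - scale i m \<notin> B.aug N (int (p * r3))" for i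
    proof
      assume mem: "n - scale i m \<in> B.aug N (int (p * r3))"
      have "N \<subseteq> N1 \<inter> N2" by (auto simp: N_def)
      then have "int (p * r3) dvd n s - i * m s" using mem by (rule key[OF N])
      also have "n s - i * m s = m s * (l - i)" by (simp add: l algebra_simps)
      finally have "int p * int r3 dvd m s * (l - i)" by simp
      then have "\<bar>m s * int r3\<bar> dvd m s * (l - i)" by (simp add: abs_mult p_def)
      then have "m s * int r3 dvd m s * (l - i)" by (simp only: abs_dvd_iff)
      then have "int r3 dvd l - i" using s by (simp only: dvd_mult_cancel_left simp_thms)
      then have "int r3 dvd i - l" by (simp add: dvd_diff_commute)
      then have "scale (i - l) m \<in> B.aug N3 (int r3)" by (rule B.scale_aug[OF m])
      moreover have "n - scale i m \<in> B.aug N3 (int r3)"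
        using mem B.aug_mono[OF B.fin_normalD(2)[OF N] B.fin_normalD(2)[OF N3(1)], of "int r3" "int (p * r3)"]
        by (auto simp: N_def)
      ultimately have "(n - scale i m) + scale (i - l) m \<in> B.aug N3 (int r3)"
        using B.aug_closed(2) by blast
      moreover have "(n - scale i m) + scale (i - l) m = w"
        by (simp add: w_def scale_def fun_eq_iff algebra_simps)
      ultimately show False using N3(3) by simp
    qed
    then show ?thesis using that[OF N, of "p * r3"] p(1) N3(2) by simp
  qed
qed

text \<open>If the second component of \<open>h\<close> is a power of \<open>b\<close>, there are
  two situations. For \<open>b = 1\<close> with \<open>h\<close> in the base group, multiples of one
  vector have to be separated. For \<open>b\<close> of infinite order, only one exponent is possible
  in \<open>B\<close>, and finite quotients have to exclude the others.\<close>

lemma cyclic_subgroup_separable_wreath: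
  assumes css: "cyclic_subgroup_separable B" and tf: "torsion_free B"
  shows "cyclic_subgroup_separable G"
  unfolding cyclic_subgroup_separable_iff
proof (intro ballI impI)
  fix g h assume g: "g \<in> carrier G" and h: "h \<in> carrier G" and ne: "\<forall>i::int. h \<noteq> g [^] i"
  define b where "b = \<beta> g"
  have bB: "b \<in> carrier B" using g by (simp add: b_def)
  have \<beta>_pow: "\<beta> (h \<otimes> inv (g [^] i)) = \<beta> h \<otimes>\<^bsub>B\<^esub> inv\<^bsub>B\<^esub> (b [^]\<^bsub>B\<^esub> i)" for i :: int
    using g h by (simp add: b_def \<beta>.hom_int_pow)
  show "\<exists>N. fin_normal G N \<and> (\<forall>i::int. h \<otimes> inv (g [^] i) \<notin> N)"
  proof (cases "\<exists>i::int. \<beta> h = b [^]\<^bsub>B\<^esub> i")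
    case False
    then obtain N where N: "fin_normal B N" "\<forall>i::int. \<beta> h \<otimes>\<^bsub>B\<^esub> inv\<^bsub>B\<^esub> (b [^]\<^bsub>B\<^esub> i) \<notin> N"
      using css bB \<beta>_closed[OF h] unfolding B.cyclic_subgroup_separable_iff by blast
    then have "\<forall>i::int. h \<otimes> inv (g [^] i) \<notin> level N 1"
      using \<beta>_pow by (auto simp: level_def)
    then show ?thesis using fin_normal_level[OF N(1), of 1] by auto
  next
    case True
    then obtain i0 :: int where i0: "\<beta> h = b [^]\<^bsub>B\<^esub> i0" ..
    show ?thesis
    proof (cases "b = \<one>\<^bsub>B\<^esub>")
      case b1: True
      then have \<beta>h: "\<beta> h = \<one>\<^bsub>B\<^esub>" using i0 by simp
      have \<beta>g: "\<beta> g = \<one>\<^bsub>B\<^esub>" using b1 by (simp add: b_def)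
      have \<beta>gi: "\<beta> (g [^] i) = \<one>\<^bsub>B\<^esub>" for i :: int using g by (simp add: \<beta>.hom_int_pow \<beta>g)
      have "\<phi> h \<noteq> scale i (\<phi> g)" for i
      proof
        assume "\<phi> h = scale i (\<phi> g)"
        then have "h = g [^] i"
          using g h \<beta>gi \<beta>h by (intro eqI) (auto simp: \<phi>_int_pow_base[OF g \<beta>g])
        then show False using ne by blast
      qed
      then obtain N r where N: "fin_normal B N" "(r::nat) > 0"
        "\<And>i. \<phi> h - scale i (\<phi> g) \<notin> B.aug N (int r)"
        using separate_multiples[OF css \<phi>_fsupp[OF g] \<phi>_fsupp[OF h]] by blast
      have "h \<otimes> inv (g [^] i) \<notin> level N (int r)" for i :: int
      proof
        assume "h \<otimes> inv (g [^] i) \<in> level N (int r)"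
        then have "\<phi> (h \<otimes> inv (g [^] i)) \<in> B.aug N (int r)" by (simp add: level_def)
        moreover have "\<phi> (h \<otimes> inv (g [^] i)) = \<phi> h - scale i (\<phi> g)"
          using g h \<beta>gi \<beta>h
          by (simp add: \<phi>_mult_inv \<phi>_int_pow_base[OF g \<beta>g] B.tr_one B.fsupp_closed(4))
        ultimately show False using N(3) by simp
      qed
      then show ?thesis using fin_normal_level[OF N(1), of "int r"] N(2) by auto
    next
      case False
      \<comment> \<open>\<open>h'\<close> is the error at the only exponent possible in
        \<open>B\<close>. It lies in the base group and is nontrivial.\<close>
      define h' where "h' = h \<otimes> inv (g [^] i0)"
      have h': "h' \<in> carrier G" using g h by (simp add: h'_def)
      have \<beta>h': "\<beta> h' = \<one>\<^bsub>B\<^esub>" unfolding h'_def \<beta>_pow i0 using bB by simp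
      have "\<phi> h' \<noteq> 0"
      proof
        assume "\<phi> h' = 0"
        then have "h' = \<one>" using h' \<beta>h' by (intro eqI) (auto simp: \<phi>_one)
        then have "h = g [^] i0"
          using g h unfolding h'_def by (metis inv_closed inv_equality inv_inv int_pow_closed)
        then show False using ne by blast
      qed
      then obtain N3 r where N3: "fin_normal B N3" "(r::nat) > 0" "\<phi> h' \<notin> B.aug N3 (int r)"
        using B.separate_zero[OF css \<phi>_fsupp[OF h']] by blast
      interpret N3: normal N3 B using N3(1) by (rule B.fin_normalD)
      obtain p :: nat where p: "p > 0" "b [^]\<^bsub>B\<^esub> p \<in> N3" using B.fin_normal_pow[OF N3(1)] bB by metis
      have inf: "b [^]\<^bsub>B\<^esub> k \<noteq> \<one>\<^bsub>B\<^esub>" if "k > 0" for k :: nat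
        using B.torsion_freeD[OF tf bB, of k] that False by blast
      \<comment> \<open>With \<open>p r\<close> dividing the exponent, the norm sum in
        \<open>\<phi> (g^k)\<close> vanishes modulo \<open>aug N3 r\<close>. So no further power of
        \<open>g\<close> can cancel \<open>\<phi> h'\<close>.\<close>
      obtain N4 where N4: "fin_normal B N4" "\<And>k::nat. b [^]\<^bsub>B\<^esub> k \<in> N4 \<Longrightarrow> p * r dvd k"
        using B.separate_powers[OF css bB inf, of "p * r"] p(1) N3(2) by auto
      interpret N4: normal N4 B using N4(1) by (rule B.fin_normalD)
      define N where "N = N3 \<inter> N4"
      have N: "fin_normal B N" unfolding N_def using N3(1) N4(1) by (rule B.fin_normal_Int)
      have nat_pow: "\<phi> (g [^] k) \<in> B.aug N3 (int r)" if k: "b [^]\<^bsub>B\<^esub> k \<in> N4" for k :: nat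
      proof -
        obtain j where "k = p * r * j" using N4(2)[OF k] by (elim dvdE)
        then have "k = p * (r * j)" by (simp only: mult.assoc)
        then show ?thesis
          unfolding \<phi>_pow[OF g] b_def[symmetric]
          using B.tr_sum_aug[OF N3.normal_axioms bB p(2) \<phi>_fsupp[OF g], of "int r" "r * j"] by simp
      qed
      have int_pow: "\<phi> (g [^] k) \<in> B.aug N3 (int r)" if k: "b [^]\<^bsub>B\<^esub> k \<in> N4" for k :: int
      proof (cases k rule: int_cases2)
        case (nonneg l)
        then show ?thesis using nat_pow[of l] k by (simp add: int_pow_int)
      next
        case (nonpos l)
        have "inv\<^bsub>B\<^esub> (b [^]\<^bsub>B\<^esub> k) \<in> N4" using k by blast
        then have "b [^]\<^bsub>B\<^esub> l \<in> N4" using bB by (simp add: nonpos B.int_pow_neg int_pow_int)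
        then have "\<phi> (g [^] l) \<in> B.aug N3 (int r)" by (rule nat_pow)
        then have "- B.tr (inv\<^bsub>B\<^esub> \<beta> (g [^] l)) (\<phi> (g [^] l)) \<in> B.aug N3 (int r)"
          using g by (intro B.aug_closed(1) B.tr_aug N3.normal_axioms) auto
        then show ?thesis using g by (simp add: nonpos int_pow_neg int_pow_int \<phi>_inv)
      qed
      have "h \<otimes> inv (g [^] j) \<notin> level N (int r)" for j :: int
      proof
        assume mem: "h \<otimes> inv (g [^] j) \<in> level N (int r)"
        have eq: "h \<otimes> inv (g [^] j) = h' \<otimes> g [^] (i0 - j)"
          using g h by (simp add: h'_def int_pow_diff m_assoc inv_mult_cancel)
        have "\<beta> (h \<otimes> inv (g [^] j)) \<in> N4" using mem by (simp add: level_def N_def)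
        then have "b [^]\<^bsub>B\<^esub> (i0 - j) \<in> N4"
          unfolding eq using g h' by (simp add: \<beta>h' b_def \<beta>.hom_int_pow)
        then have \<phi>g: "\<phi> (g [^] (i0 - j)) \<in> B.aug N3 (int r)" by (rule int_pow)
        have "\<phi> (h \<otimes> inv (g [^] j)) \<in> B.aug N (int r)" using mem by (simp add: level_def)
        then have "\<phi> (h \<otimes> inv (g [^] j)) \<in> B.aug N3 (int r)"
          using B.aug_mono[OF B.fin_normalD(2)[OF N] N3.is_subgroup, of "int r" "int r"] by (auto simp: N_def)
        also have "\<phi> (h \<otimes> inv (g [^] j)) = \<phi> h' + \<phi> (g [^] (i0 - j))"
          unfolding eq using g h' by (simp add: \<phi>_mult \<beta>h' B.tr_one)
        finally have "\<phi> h' + \<phi> (g [^] (i0 - j)) - \<phi> (g [^] (i0 - j)) \<in> B.aug N3 (int r)"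
          using \<phi>g B.aug_closed(3) by blast
        then show False using N3(3) by simp
      qed
      then show ?thesis using fin_normal_level[OF N, of "int r"] N3(2) by auto
    qed
  qed
qed

section \<open>Derived series and finite generation\<close>

lemma derived_series_image: "\<beta> ` (derived G ^^ k) (carrier G) = (derived B ^^ k) (carrier B)"
proof -
  have "\<beta> ` carrier G = carrier B"
  proof
    show "carrier B \<subseteq> \<beta> ` carrier G"
    proof
      fix b assume "b \<in> carrier B"
      then show "b \<in> \<beta> ` carrier G"
        using B.zero_fsupp by (intro image_eqI[of _ _ "elt 0 b"]) auto
    qed
  qed auto
  then show ?thesis using \<beta>.exp_of_derived_img[of "carrier G" k] by simp
qed

text \<open>After \<open>k\<close> steps the series of \<open>G\<close> lies in the kernel of
  \<open>\<beta>\<close>, the abelian base group.\<close>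

lemma derived_series_Suc_trivial:
  assumes "(derived B ^^ k) (carrier B) = {\<one>\<^bsub>B\<^esub>}"
  shows "(derived G ^^ Suc k) (carrier G) = {\<one>}"
proof -
  let ?D = "(derived G ^^ k) (carrier G)"
  have D: "?D \<subseteq> carrier G" by (rule exp_of_derived_in_carrier) simp
  have "derived G ?D = {\<one>}"
  proof (rule derived_subset_one[OF D])
    fix x y assume x: "x \<in> ?D" and y: "y \<in> ?D"
    have "\<beta> x \<in> \<beta> ` ?D" "\<beta> y \<in> \<beta> ` ?D" using x y by blast+
    then have "\<beta> x = \<one>\<^bsub>B\<^esub>" "\<beta> y = \<one>\<^bsub>B\<^esub>"
      unfolding derived_series_image assms by auto
    moreover have "x \<in> carrier G" "y \<in> carrier G" using x y D by auto
    ultimately show "x \<otimes> y = y \<otimes> x"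
      by (intro eqI) (auto simp: \<phi>_mult B.tr_one add.commute)
  qed
  then show ?thesis by simp
qed

text \<open>If the \<open>k\<close>-th term contains \<open>x\<close> above
  \<open>d \<noteq> 1\<close>, then by normality it contains the commutator \<open>y\<close> of the
  base element at 1 with \<open>x\<close>, and \<open>\<phi> y = 1 - d\<close>. As the term is
  abelian, \<open>d\<close> would fix \<open>1 - d\<close>.\<close>

lemma derived_series_trivialD:
  assumes "(derived G ^^ Suc k) (carrier G) = {\<one>}"
  shows "(derived B ^^ k) (carrier B) = {\<one>\<^bsub>B\<^esub>}"
proof -
  let ?D = "(derived G ^^ k) (carrier G)"
  have "?D \<lhd> G"
    by (induction k) (simp_all add: normal_self derived_is_normal)
  then interpret D: normal ?D G .
  have comm: "x \<otimes> y = y \<otimes> x" if xy: "x \<in> ?D" "y \<in> ?D" for x y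
  proof -
    have "x \<otimes> y \<otimes> inv x \<otimes> inv y \<in> derived_set G ?D" using xy by blast
    then have "x \<otimes> y \<otimes> inv x \<otimes> inv y \<in> derived G ?D"
      unfolding derived_def by (rule generate.incl)
    then have eq: "x \<otimes> y \<otimes> inv x \<otimes> inv y = \<one>" using assms by simp
    have G: "x \<in> carrier G" "y \<in> carrier G" using xy D.subset by auto
    have "x \<otimes> y = (x \<otimes> y \<otimes> inv x \<otimes> inv y) \<otimes> (y \<otimes> x)"
      using G by (simp add: m_assoc inv_mult_cancel)
    then show ?thesis using eq G by simp
  qed
  have "d = \<one>\<^bsub>B\<^esub>" if d: "d \<in> (derived B ^^ k) (carrier B)" for d
  proof (rule ccontr)
    assume d1: "d \<noteq> \<one>\<^bsub>B\<^esub>"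
    obtain x where x: "x \<in> ?D" "d = \<beta> x" using d derived_series_image[of k] by blast
    have xG: "x \<in> carrier G" using x(1) D.subset by blast
    have dB: "d \<in> carrier B" using xG x(2) by simp
    define \<delta> where "\<delta> = elt (point \<one>\<^bsub>B\<^esub>) \<one>\<^bsub>B\<^esub>"
    have \<delta>: "\<delta> \<in> carrier G" "\<phi> \<delta> = point \<one>\<^bsub>B\<^esub>" "\<beta> \<delta> = \<one>\<^bsub>B\<^esub>"
      by (simp_all add: \<delta>_def B.point_fsupp)
    define y where "y = \<delta> \<otimes> x \<otimes> inv \<delta> \<otimes> inv x"
    have yD: "y \<in> ?D"
      unfolding y_def using x(1) \<delta>(1) by (intro D.m_closed D.inv_op_closed2 D.m_inv_closed)
    have yG: "y \<in> carrier G" using xG \<delta>(1) by (simp add: y_def)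
    have \<beta>y: "\<beta> y = \<one>\<^bsub>B\<^esub>" using xG \<delta> by (simp add: y_def)
    have "\<phi> (\<delta> \<otimes> x \<otimes> inv \<delta>) = point \<one>\<^bsub>B\<^esub> + \<phi> x - point d"
      using \<phi>_conj[OF \<delta>(1) xG] xG dB \<delta> x(2) by (simp add: B.tr_one B.tr_point)
    moreover have "\<beta> (\<delta> \<otimes> x \<otimes> inv \<delta>) = d" using xG \<delta> x(2) dB by simp
    ultimately have \<phi>y: "\<phi> y = point \<one>\<^bsub>B\<^esub> - point d"
      unfolding y_def using \<phi>_mult_inv[of "\<delta> \<otimes> x \<otimes> inv \<delta>" x] xG \<delta>(1) x(2) dB
      by (simp add: B.tr_one)
    have "\<phi> (x \<otimes> y) = \<phi> (y \<otimes> x)" using comm[OF x(1) yD] by simp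
    then have "B.tr d (\<phi> y) = \<phi> y"
      using xG yG \<beta>y x(2) by (simp add: \<phi>_mult B.tr_one)
    then have "point d - point (d \<otimes>\<^bsub>B\<^esub> d) = point \<one>\<^bsub>B\<^esub> - point d"
      using dB by (simp add: \<phi>y B.tr_diff B.tr_point)
    \<comment> \<open>At \<open>d\<close> the left side is 1 and the right side is -1, since both 1
      and \<open>d^2\<close> differ from \<open>d\<close>.\<close>
    then have "(point d - point (d \<otimes>\<^bsub>B\<^esub> d)) d = (point \<one>\<^bsub>B\<^esub> - point d) d" by metis
    then have "point d d - point (d \<otimes>\<^bsub>B\<^esub> d) d = (point \<one>\<^bsub>B\<^esub> d - point d d :: int)"
      by (simp only: minus_apply)
    moreover have "d \<otimes>\<^bsub>B\<^esub> d \<noteq> d" using d1 dB by simp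
    ultimately show False using d1 by (simp add: point_def split: if_splits)
  qed
  moreover have "\<one>\<^bsub>B\<^esub> \<in> (derived B ^^ k) (carrier B)"
    using subgroup.one_closed[OF B.exp_of_derived_is_subgroup[OF B.subgroup_self]] .
  ultimately show ?thesis by blast
qed

lemma carrier_nontrivial: "carrier G \<noteq> {\<one>}"
proof
  assume "carrier G = {\<one>}"
  then have "elt (point \<one>\<^bsub>B\<^esub>) \<one>\<^bsub>B\<^esub> = \<one>" using elt_closed B.point_fsupp by blast
  then have "point \<one>\<^bsub>B\<^esub> = (0 :: 'b \<Rightarrow> int)" using \<phi>_elt[of "point \<one>\<^bsub>B\<^esub>" "\<one>\<^bsub>B\<^esub>"] by (simp add: B.point_fsupp \<phi>_one)
  then have "point \<one>\<^bsub>B\<^esub> \<one>\<^bsub>B\<^esub> = (0::int)" by simp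
  then show False by (simp add: point_def)
qed

text \<open>Finitely many generators have a finite joint support, so all of them vanish at some
  \<open>g\<close>. Vanishing at \<open>g\<close> defines a proper subgroup of the base
  group.\<close>

lemma base_not_finitely_generated:
  assumes inf: "infinite (carrier B)" and F: "finite F"
  shows "generate G F \<noteq> {x \<in> carrier G. \<beta> x = \<one>\<^bsub>B\<^esub>}"
proof
  let ?M = "{x \<in> carrier G. \<beta> x = \<one>\<^bsub>B\<^esub>}"
  assume gen: "generate G F = ?M"
  have FM: "F \<subseteq> ?M" unfolding gen[symmetric] by (rule subsetI) (rule generate.incl)
  define S where "S = (\<Union>x\<in>F. {g. \<phi> x g \<noteq> 0})"
  have "finite S" unfolding S_def using F FM by (auto intro!: B.finite_supp)
  then have "\<not> carrier B \<subseteq> S" using inf by (meson finite_subset)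
  then obtain g where g: "g \<in> carrier B" "g \<notin> S" by blast
  have "subgroup {x \<in> ?M. \<phi> x g = 0} G"
  proof (rule subgroupI)
    show "{x \<in> ?M. \<phi> x g = 0} \<noteq> {}" by (auto simp: \<phi>_one intro!: exI[of _ \<one>])
    fix x assume x: "x \<in> {x \<in> ?M. \<phi> x g = 0}"
    then show "inv x \<in> {x \<in> ?M. \<phi> x g = 0}" by (auto simp: \<phi>_inv B.tr_one)
    fix y assume "y \<in> {x \<in> ?M. \<phi> x g = 0}"
    then show "x \<otimes> y \<in> {x \<in> ?M. \<phi> x g = 0}" using x by (auto simp: \<phi>_mult B.tr_one)
  qed auto
  moreover have "F \<subseteq> {x \<in> ?M. \<phi> x g = 0}" using FM g(2) by (auto simp: S_def)
  ultimately have sub: "generate G F \<subseteq> {x \<in> ?M. \<phi> x g = 0}" by (rule generate_subgroup_incl[rotated])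
  have "elt (point g) \<one>\<^bsub>B\<^esub> \<in> generate G F" unfolding gen using g(1) by (simp add: B.point_fsupp)
  then have "\<phi> (elt (point g) \<one>\<^bsub>B\<^esub>) g = 0" using sub by blast
  then show False using g(1) by (simp add: B.point_fsupp) (simp add: point_def)
qed

lemma not_polycyclic_wreath:
  assumes "infinite (carrier B)" shows "\<not> polycyclic G"
proof
  assume "polycyclic G"
  moreover have "subgroup {x \<in> carrier G. \<beta> x = \<one>\<^bsub>B\<^esub>} G"
    using \<beta>.subgroup_kernel by (simp add: kernel_def)
  ultimately show False
    using polycyclic_subgroup_finitely_generated base_not_finitely_generated[OF assms] by blast
qed

end

section \<open>The iterated wreath products\<close>

text \<open>Elements of \<open>sum_group\<close> are \<open>undefined\<close> outside the carrier,
  those of \<open>fsupp\<close> vanish there. \<open>\<phi>\<close> extends by zero and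
  \<open>elt\<close> restricts to the carrier before inverting \<open>h\<close>.\<close>

lemma integer_wreath_if_iso:
  assumes G: "group G" and B: "group B" and h: "h \<in> iso G (wreath_product integer_group B)"
  shows "\<exists>\<phi> \<beta> elt. integer_wreath G B \<phi> \<beta> elt"
proof -
  interpret G: group G by fact
  interpret B: group B by fact
  let ?W = "wreath_product integer_group B"
  let ?S = "sum_group (carrier B) (\<lambda>_. integer_group)"
  have hom: "h \<in> hom G ?W" and bij: "bij_betw h (carrier G) (carrier ?W)"
    using h by (auto simp: iso_def)
  have carrW: "carrier ?W = carrier ?S \<times> carrier B" by (simp add: wreath_product_def)
  have carrS: "f \<in> carrier ?S \<longleftrightarrow> f \<in> extensional (carrier B) \<and> finite {x \<in> carrier B. f x \<noteq> 0}" for f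
    by (auto simp: carrier_sum_group PiE_iff)
  define \<phi> where "\<phi> x = (\<lambda>b. if b \<in> carrier B then fst (h x) b else 0)" for x
  define \<beta> where "\<beta> x = snd (h x)" for x
  define elt where "elt f b = inv_into (carrier G) h (restrict f (carrier B), b)" for f b
  have hW: "h x \<in> carrier ?W" if "x \<in> carrier G" for x
    using bij that by (auto simp: bij_betw_def)
  have rW: "(restrict f (carrier B), b) \<in> carrier ?W" if "f \<in> B.fsupp" "b \<in> carrier B" for f b
    using that by (auto simp: carrW carrS B.fsupp_def intro: finite_subset[of _ "{x. f x \<noteq> 0}"])
  have h_elt: "h (elt f b) = (restrict f (carrier B), b)" if "f \<in> B.fsupp" "b \<in> carrier B" for f b
    unfolding elt_def using bij rW[OF that] by (simp add: bij_betw_def f_inv_into_f)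
  have "integer_wreath G B \<phi> \<beta> elt"
  proof (unfold_locales)
    fix x assume x: "x \<in> carrier G"
    have fs: "fst (h x) \<in> carrier ?S" and sn: "snd (h x) \<in> carrier B" using hW[OF x] by (auto simp: carrW)
    have "{b. \<phi> x b \<noteq> 0} = {b \<in> carrier B. fst (h x) b \<noteq> 0}" by (auto simp: \<phi>_def)
    then show "\<phi> x \<in> B.fsupp" using fs by (auto simp: B.fsupp_def carrS)
    show "\<beta> x \<in> carrier B" using sn by (simp add: \<beta>_def)
    have "restrict (\<phi> x) (carrier B) = fst (h x)"
      using fs by (auto simp: \<phi>_def carrS extensional_def fun_eq_iff)
    then have "elt (\<phi> x) (\<beta> x) = inv_into (carrier G) h (h x)"
      by (simp add: elt_def \<beta>_def)
    then show "elt (\<phi> x) (\<beta> x) = x" using bij x by (simp add: bij_betw_def)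
    fix y assume y: "y \<in> carrier G"
    have "h (x \<otimes>\<^bsub>G\<^esub> y) = h x \<otimes>\<^bsub>?W\<^esub> h y" using hom x y by (simp add: hom_def)
    also have "\<dots> = (\<lambda>b\<in>carrier B. fst (h x) b + left_translate B (snd (h x)) (fst (h y)) b,
        snd (h x) \<otimes>\<^bsub>B\<^esub> snd (h y))"
      by (simp add: wreath_product_def split_beta)
    finally have hxy: "h (x \<otimes>\<^bsub>G\<^esub> y) = \<dots>" .
    show "\<beta> (x \<otimes>\<^bsub>G\<^esub> y) = \<beta> x \<otimes>\<^bsub>B\<^esub> \<beta> y" by (simp add: \<beta>_def hxy)
    show "\<phi> (x \<otimes>\<^bsub>G\<^esub> y) = \<phi> x + B.tr (\<beta> x) (\<phi> y)"
      using sn by (auto simp: \<phi>_def \<beta>_def hxy B.tr_def left_translate_def fun_eq_iff)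
  next
    fix f b assume f: "f \<in> B.fsupp" and b: "b \<in> carrier B"
    show "elt f b \<in> carrier G"
      unfolding elt_def using bij rW[OF f b] by (simp add: bij_betw_def inv_into_into)
    show "\<phi> (elt f b) = f"
      using f B.fsupp_carrier[OF f] by (auto simp: \<phi>_def h_elt[OF f b] fun_eq_iff)
    show "\<beta> (elt f b) = b" by (simp add: \<beta>_def h_elt[OF f b])
  qed
  then show ?thesis by blast
qed

lemma one_singleton_group [simp]: "\<one>\<^bsub>singleton_group c\<^esub> = c"
  by (simp add: singleton_group_def)

text \<open>The dummy \<open>iterated_wreath 0\<close> is trivial, so that the first group of the family is a wreath product, too.\<close>

lemma integer_wreath_trivial:
  assumes G: "group G" and h: "h \<in> iso G integer_group"
  shows "\<exists>\<phi> \<beta> elt. integer_wreath G (singleton_group c) \<phi> \<beta> elt"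
proof -
  interpret G: group G by fact
  interpret B: group "singleton_group c" by simp
  have hom: "h \<in> hom G integer_group" and bij: "bij_betw h (carrier G) UNIV"
    using h by (auto simp: iso_def)
  have fsupp: "f \<in> B.fsupp \<longleftrightarrow> (\<forall>b. b \<noteq> c \<longrightarrow> f b = 0)" for f
  proof
    assume f: "\<forall>b. b \<noteq> c \<longrightarrow> f b = 0"
    then have "{x. f x \<noteq> 0} \<subseteq> {c}" by auto
    then show "f \<in> B.fsupp" by (auto simp: B.fsupp_def intro: finite_subset[of _ "{c}"])
  qed (auto simp: B.fsupp_def)
  have inv_h: "h (inv_into (carrier G) h i) = i" "inv_into (carrier G) h i \<in> carrier G" for i
    using bij by (auto simp: bij_betw_def f_inv_into_f inv_into_into)
  have "integer_wreath G (singleton_group c) (\<lambda>x b. if b = c then h x else 0) (\<lambda>_. c)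
      (\<lambda>f _. inv_into (carrier G) h (f c))"
  proof (unfold_locales)
    fix x y assume x: "x \<in> carrier G" and y: "y \<in> carrier G"
    have "h (x \<otimes>\<^bsub>G\<^esub> y) = h x + h y" using hom x y by (simp add: hom_def)
    then show "(\<lambda>b. if b = c then h (x \<otimes>\<^bsub>G\<^esub> y) else 0)
        = (\<lambda>b. if b = c then h x else 0) + B.tr c (\<lambda>b. if b = c then h y else 0)"
      by (auto simp: B.tr_def fun_eq_iff)
  next
    fix x assume "x \<in> carrier G"
    then show "inv_into (carrier G) h (if c = c then h x else 0) = x"
      using bij by (simp add: bij_betw_def)
  qed (auto simp: fsupp inv_h)
  then show ?thesis by blast
qed

lemma iterated_wreath_integer_wreath:
  "\<exists>\<phi> \<beta> elt. integer_wreath (iterated_wreath (Suc k)) (iterated_wreath k) \<phi> \<beta> elt"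
proof (cases k)
  case 0
  obtain h where "h \<in> iso (iterated_wreath 1) integer_group"
    using iterated_wreath_1 by (auto simp: is_iso_def)
  then show ?thesis
    using integer_wreath_trivial[OF group_iterated_wreath, of h 1 0] by (simp add: 0)
next
  case (Suc j)
  obtain h where "h \<in> iso (iterated_wreath (k + 1)) (wreath_product integer_group (iterated_wreath k))"
    using iterated_wreath_Suc[of k] Suc by (auto simp: is_iso_def)
  then show ?thesis
    using integer_wreath_if_iso[OF group_iterated_wreath group_iterated_wreath, of h "k + 1" k] by simp
qed

section \<open>Induction along the family\<close>

lemma singleton_group_properties:
  "torsion_free (singleton_group c)" "orbits_closed (singleton_group c)"
  "cyclic_subgroup_separable (singleton_group c)"
proof -
  interpret group "singleton_group c" by simp
  show "torsion_free (singleton_group c)" by (simp add: torsion_free_def)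
  show "cyclic_subgroup_separable (singleton_group c)"
    using generate.one[of "singleton_group c"] by (auto simp: cyclic_subgroup_separable_def)
  show "orbits_closed (singleton_group c)"
    unfolding orbits_closed_def orbit_closed_def
  proof (intro allI impI ballI)
    fix K x y
    assume K: "fin_normal (singleton_group c) K" and x: "x \<in> carrier (singleton_group c)"
      and y: "y \<in> carrier (singleton_group c)"
      and ne: "\<forall>k\<in>K. y \<noteq> k \<otimes>\<^bsub>singleton_group c\<^esub> x \<otimes>\<^bsub>singleton_group c\<^esub> inv\<^bsub>singleton_group c\<^esub> k"
    have "c \<in> K" using subgroup.one_closed[OF fin_normalD(2)[OF K]] by simp
    then have "c \<otimes>\<^bsub>singleton_group c\<^esub> x \<otimes>\<^bsub>singleton_group c\<^esub> inv\<^bsub>singleton_group c\<^esub> c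
        \<in> carrier (singleton_group c)"
      using x by (intro m_closed inv_closed) simp_all
    then have "y = c \<otimes>\<^bsub>singleton_group c\<^esub> x \<otimes>\<^bsub>singleton_group c\<^esub> inv\<^bsub>singleton_group c\<^esub> c"
      using y by simp
    then show "\<exists>L. fin_normal (singleton_group c) L \<and> (\<forall>k\<in>K. y \<otimes>\<^bsub>singleton_group c\<^esub>
        inv\<^bsub>singleton_group c\<^esub> (k \<otimes>\<^bsub>singleton_group c\<^esub> x \<otimes>\<^bsub>singleton_group c\<^esub> inv\<^bsub>singleton_group c\<^esub> k) \<notin> L)"
      using ne \<open>c \<in> K\<close> by blast
  qed
qed

lemma iterated_wreath_properties:
  "torsion_free (iterated_wreath k) \<and> orbits_closed (iterated_wreath k) \<and>
    cyclic_subgroup_separable (iterated_wreath k)"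
proof (induction k)
  case 0
  then show ?case by (simp add: singleton_group_properties)
next
  case (Suc k)
  obtain \<phi> \<beta> elt where "integer_wreath (iterated_wreath (Suc k)) (iterated_wreath k) \<phi> \<beta> elt"
    using iterated_wreath_integer_wreath by blast
  then interpret integer_wreath "iterated_wreath (Suc k)" "iterated_wreath k" \<phi> \<beta> elt .
  show ?case
    using Suc torsion_free_wreath orbits_closed_wreath cyclic_subgroup_separable_wreath by blast
qed

text \<open>The equivalence for all \<open>j\<close> gives both bounds on the derived length, and
  its case \<open>j = 0\<close> shows that the groups with positive index are nontrivial. The
  trivial group at index 0 starts the count.\<close>

lemma iterated_wreath_derived_series:
  "(derived (iterated_wreath k) ^^ j) (carrier (iterated_wreath k)) = {\<one>\<^bsub>iterated_wreath k\<^esub>} \<longleftrightarrow> k \<le> j"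
proof (induction k arbitrary: j)
  case 0
  interpret group "singleton_group (0::nat)" by simp
  have "(derived (singleton_group (0::nat)) ^^ j) {0} = {0}"
    using exp_of_derived_in_carrier[of "{0}" j]
      subgroup.one_closed[OF exp_of_derived_is_subgroup[OF subgroup_self, of j]] by auto
  then show ?case by simp
next
  case (Suc k)
  obtain \<phi> \<beta> elt where "integer_wreath (iterated_wreath (Suc k)) (iterated_wreath k) \<phi> \<beta> elt"
    using iterated_wreath_integer_wreath by blast
  then interpret integer_wreath "iterated_wreath (Suc k)" "iterated_wreath k" \<phi> \<beta> elt .
  show ?case
  proof (cases j)
    case 0
    then show ?thesis using carrier_nontrivial by simp
  next
    case (Suc i)
    then show ?thesis
      using derived_series_Suc_trivial[of i] derived_series_trivialD[of i] Suc.IH[of i]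
      by (auto simp del: iterated_wreath.simps funpow.simps)
  qed
qed

lemma iterated_wreath_infinite:
  assumes "k \<ge> 1"
  shows "infinite (carrier (iterated_wreath k))"
proof -
  interpret group "iterated_wreath k" by (rule group_iterated_wreath)
  have "carrier (iterated_wreath k) \<noteq> {\<one>\<^bsub>iterated_wreath k\<^esub>}"
    using iterated_wreath_derived_series[where k = k and j = 0] assms by simp
  then show ?thesis using torsion_free_infinite iterated_wreath_properties by blast
qed

theorem corollary7p4:
  shows "(\<forall>k\<ge>1. group (iterated_wreath k) \<and>
            torsion_free (iterated_wreath k) \<and>
            hereditarily_conjugacy_separable (iterated_wreath k) \<and>
            cyclic_subgroup_separable (iterated_wreath k) \<and>
            solvable (iterated_wreath k) \<and>
            derived_length (iterated_wreath k) = k) \<and>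
         (\<forall>k>1. \<not> polycyclic (iterated_wreath k))"
proof (intro conjI allI impI)
  fix k :: nat
  interpret group "iterated_wreath k" by (rule group_iterated_wreath)
  show "group (iterated_wreath k)" by (rule group_iterated_wreath)
  show "torsion_free (iterated_wreath k)" "cyclic_subgroup_separable (iterated_wreath k)"
    using iterated_wreath_properties by blast+
  show "hereditarily_conjugacy_separable (iterated_wreath k)"
    using iterated_wreath_properties by (intro hereditarily_conjugacy_separable_if_orbits_closed) blast
  show "solvable (iterated_wreath k)"
    unfolding solvable_def using subgroup_self iterated_wreath_derived_series[of k k]
    by (intro trivial_derived_seq_imp_solvable) auto
  show "derived_length (iterated_wreath k) = k"
    unfolding derived_length_def iterated_wreath_derived_series by (rule Least_equality) auto
next
  fix k :: nat assume "k > 1"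
  \<comment> \<open>The bound \<open>k > 1\<close> enters as \<open>j \<ge> 1\<close>, which makes
    the acting group \<open>iterated_wreath j\<close> infinite.\<close>
  then obtain j where j: "k = Suc j" "j \<ge> 1" by (cases k) auto
  obtain \<phi> \<beta> elt where "integer_wreath (iterated_wreath (Suc j)) (iterated_wreath j) \<phi> \<beta> elt"
    using iterated_wreath_integer_wreath by blast
  then interpret integer_wreath "iterated_wreath (Suc j)" "iterated_wreath j" \<phi> \<beta> elt .
  show "\<not> polycyclic (iterated_wreath k)"
    unfolding j(1) using iterated_wreath_infinite[OF j(2)] by (rule not_polycyclic_wreath)
qed

end
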